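(* There exists a constant $\alpha>0$, independent of $h$, such that for all $(\boldsymbol\sigma,u)\in\boldsymbol\Sigma_h\times V_h$ $$\alpha\,\|(\boldsymbol\sigma,u)\|_{nc}\le\sup_{\boldsymbol 0\ne(\boldsymbol\tau,v)\in\boldsymbol\Sigma_h\times V_h}\frac{\mathcal B_s[(\boldsymbol\sigma,u),(\boldsymbol\tau,v)]}{\|(\boldsymbol\tau,v)\|_{nc}},$$ where $\mathcal B_s[(\boldsymbol\sigma,u),(\boldsymbol\tau,v)]=a_s(\boldsymbol\sigma,\boldsymbol\tau)-b(\boldsymbol\tau,u)-b(\boldsymbol\sigma,v)$.
   Context: $\Omega\subset\mathbb R^2$ is a bounded, simply connected domain with polygonal boundary. $\{\mathcal T_h\}_{h>0}$ is a family of conforming triangulations of $\bar\Omega$ into straight-sided triangles $T$ with diameter $h_T$ and unit outward normal $\boldsymbol\nu_T$; $h=\max_{T\in\mathcal T_h}h_T$. $\mathcal E_I$ is the set of interior edges, $|e|$ the length of an edge $e$. For $e=\partial T\cap\partial T'\in\mathcal E_I$, a piecewise smooth vector field $\boldsymbol\tau$ has normal jump $[\![\boldsymbol\tau]\!]=\boldsymbol\tau|_T\cdot\boldsymbol\nu_T+\boldsymbol\tau|_{T'}\cdot\boldsymbol\nu_{T'}$, and a piecewise smooth scalar $q$ has jump $[\![q]\!]=q|_T\boldsymbol\nu_T+q|_{T'}\boldsymbol\nu_{T'}$. Spaces: $V_h$ is the space of functions that are constant on each $T\in\mathcal T_h$; $\mathrm{CR}_h$ is the space of $v\in L^2(\Omega)$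 with $v|_T$ affine for each $T\in\mathcal T_h$ and $\int_e[\![v]\!]=0$ for all $e\in\mathcal E_I$; $\boldsymbol\Sigma_h=[\mathrm{CR}_h]^2$. Forms, with $\operatorname{div}_h$ the elementwise divergence and $\gamma|_e=1/|e|$: $a_s(\boldsymbol\sigma,\boldsymbol\tau)=\int_\Omega\boldsymbol\sigma\cdot\boldsymbol\tau+\sum_{e\in\mathcal E_I}\int_e\gamma[\![\boldsymbol\sigma]\!][\![\boldsymbol\tau]\!]$, $\ b(\boldsymbol\tau,v)=\int_\Omega v\,\operatorname{div}_h\boldsymbol\tau$. Norm: $\|(\boldsymbol\tau,v)\|_{nc}^2=\|\boldsymbol\tau\|_{0,\Omega}^2+\sum_{e\in\mathcal E_I}\|\gamma^{1/2}[\![\boldsymbol\tau]\!]\|_{0,e}^2+\|\operatorname{div}_h\boldsymbol\tau\|_{0,\Omega}^2+\|v\|_{0,\Omega}^2$, with $\|\cdot\|_{0,D}$ the $L^2(D)$ norm. *)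

theory Defs
  imports "HOL-Analysis.Analysis"
begin

section \<open>Domain and triangulations\<close>

text \<open>
  The condition \<open>interior (closure \<Omega>) = \<Omega>\<close> is part of the usual meaning of
  ``polygonal boundary'': it excludes slits, that is, boundary segments with \<open>\<Omega>\<close> on both sides.
\<close>

definition polygonal_boundary :: "(real^2) set \<Rightarrow> bool" where
  "polygonal_boundary \<Omega> \<longleftrightarrow>
     interior (closure \<Omega>) = \<Omega> \<and>
     (\<exists>S. finite S \<and> frontier \<Omega> = (\<Union>(a, b)\<in>S. closed_segment a b))"

definition polygonal_domain :: "(real^2) set \<Rightarrow> bool" where
  "polygonal_domain \<Omega> \<longleftrightarrow>
     open \<Omega> \<and> \<Omega> \<noteq> {} \<and> bounded \<Omega> \<and> connected \<Omega> \<and> simply_connected \<Omega> \<and> polygonal_boundary \<Omega>"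

text \<open>
  Triangles are closed and nondegenerate. The predicate \<open>triangulation\<close> of the library contains
  conformity: any two members meet in a common (possibly empty) face.
\<close>

definition conforming_triangulation :: "(real^2) set \<Rightarrow> (real^2) set set \<Rightarrow> bool" where
  "conforming_triangulation \<Omega> \<T> \<longleftrightarrow>
     triangulation \<T> \<and> (\<forall>T\<in>\<T>. 2 simplex T) \<and> \<Union>\<T> = closure \<Omega>"

definition mesh_size :: "(real^2) set set \<Rightarrow> real" where
  "mesh_size \<T> = Max (diameter ` \<T>)"

definition interior_edges :: "(real^2) set set \<Rightarrow> (real^2) set set" where
  "interior_edges \<T> = {e. \<exists>T\<in>\<T>. \<exists>T'\<in>\<T>. T \<noteq> T' \<and> e edge_of T \<and> e edge_of T'}"

definition outward_normal :: "(real^2) set \<Rightarrow> (real^2) set \<Rightarrow> real^2" where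
  "outward_normal T e = (THE n. norm n = 1 \<and> (\<forall>x\<in>e. \<forall>y\<in>T. n \<bullet> y \<le> n \<bullet> x))"


section \<open>Integrals and \<open>L\<^sup>2\<close> norms\<close>

text \<open>Arc length integral over a segment; the value does not depend on the chosen orientation.\<close>

definition edge_integral :: "(real^2) set \<Rightarrow> (real^2 \<Rightarrow> 'a::euclidean_space) \<Rightarrow> 'a" where
  "edge_integral e f =
     (let (a, b) = (SOME (a, b). e = closed_segment a b)
      in dist a b *\<^sub>R integral {0..1} (\<lambda>t. f (linepath a b t)))"

definition L2 :: "(real^2) set \<Rightarrow> (real^2 \<Rightarrow> real) set" where
  "L2 D = {v. v \<in> borel_measurable (lebesgue_on D) \<and> integrable (lebesgue_on D) (\<lambda>x. (v x)\<^sup>2)}"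

definition L2_norm :: "(real^2) set \<Rightarrow> (real^2 \<Rightarrow> 'a::euclidean_space) \<Rightarrow> real" where
  "L2_norm D f = sqrt (LINT x|lebesgue_on D. (norm (f x))\<^sup>2)"

definition edge_L2_norm :: "(real^2) set \<Rightarrow> (real^2 \<Rightarrow> 'a::euclidean_space) \<Rightarrow> real" where
  "edge_L2_norm e f = sqrt (edge_integral e (\<lambda>x. (norm (f x))\<^sup>2))"


section \<open>Traces, jumps and the elementwise divergence\<close>

text \<open>
  Piecewise smooth functions are represented by functions on the plane whose values on the (null)
  union of the edges are irrelevant: every condition refers to the interiors of the triangles, and
  the restriction to the closed triangle, \<open>q|\<^sub>T\<close>, is the continuous extension from the interior.
\<close>

definition elem_trace :: "(real^2 \<Rightarrow> 'a::euclidean_space) \<Rightarrow> (real^2) set \<Rightarrow> real^2 \<Rightarrow> 'a" where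
  "elem_trace q T x = Lim (at x within interior T) q"

text \<open>An interior edge belongs to exactly two triangles, so the sums below have two terms.\<close>

definition jump :: "(real^2) set set \<Rightarrow> (real^2 \<Rightarrow> real) \<Rightarrow> (real^2) set \<Rightarrow> real^2 \<Rightarrow> real^2" where
  "jump \<T> q e x = (\<Sum>T\<in>{T\<in>\<T>. e edge_of T}. elem_trace q T x *\<^sub>R outward_normal T e)"

definition normal_jump ::
    "(real^2) set set \<Rightarrow> (real^2 \<Rightarrow> real^2) \<Rightarrow> (real^2) set \<Rightarrow> real^2 \<Rightarrow> real" where
  "normal_jump \<T> \<tau> e x = (\<Sum>T\<in>{T\<in>\<T>. e edge_of T}. elem_trace \<tau> T x \<bullet> outward_normal T e)"

definition divergence :: "(real^2 \<Rightarrow> real^2) \<Rightarrow> real^2 \<Rightarrow> real" where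
  "divergence \<tau> x = (\<Sum>i\<in>UNIV. frechet_derivative \<tau> (at x) (axis i 1) $ i)"

definition div_h :: "(real^2) set set \<Rightarrow> (real^2 \<Rightarrow> real^2) \<Rightarrow> real^2 \<Rightarrow> real" where
  "div_h \<T> \<tau> x = (if x \<in> (\<Union>T\<in>\<T>. interior T) then divergence \<tau> x else 0)"


section \<open>Discrete spaces, forms and norm\<close>

definition V_h :: "(real^2) set set \<Rightarrow> (real^2 \<Rightarrow> real) set" where
  "V_h \<T> = {v. \<forall>T\<in>\<T>. \<exists>c. \<forall>x\<in>interior T. v x = c}"

definition CR_h :: "(real^2) set \<Rightarrow> (real^2) set set \<Rightarrow> (real^2 \<Rightarrow> real) set" where
  "CR_h \<Omega> \<T> = {v \<in> L2 \<Omega>.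
     (\<forall>T\<in>\<T>. \<exists>a c. \<forall>x\<in>interior T. v x = a \<bullet> x + c) \<and>
     (\<forall>e\<in>interior_edges \<T>. edge_integral e (jump \<T> v e) = 0)}"

definition Sigma_h :: "(real^2) set \<Rightarrow> (real^2) set set \<Rightarrow> (real^2 \<Rightarrow> real^2) set" where
  "Sigma_h \<Omega> \<T> = {\<tau>. \<forall>i. (\<lambda>x. \<tau> x $ i) \<in> CR_h \<Omega> \<T>}"

definition edge_weight :: "(real^2) set \<Rightarrow> real" where
  "edge_weight e = 1 / diameter e"

definition a_s ::
    "(real^2) set \<Rightarrow> (real^2) set set \<Rightarrow> (real^2 \<Rightarrow> real^2) \<Rightarrow> (real^2 \<Rightarrow> real^2) \<Rightarrow> real" where
  "a_s \<Omega> \<T> \<sigma> \<tau> =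
     (LINT x|lebesgue_on \<Omega>. \<sigma> x \<bullet> \<tau> x) +
     (\<Sum>e\<in>interior_edges \<T>.
        edge_integral e (\<lambda>x. edge_weight e * normal_jump \<T> \<sigma> e x * normal_jump \<T> \<tau> e x))"

definition b_form ::
    "(real^2) set \<Rightarrow> (real^2) set set \<Rightarrow> (real^2 \<Rightarrow> real^2) \<Rightarrow> (real^2 \<Rightarrow> real) \<Rightarrow> real" where
  "b_form \<Omega> \<T> \<tau> v = (LINT x|lebesgue_on \<Omega>. v x * div_h \<T> \<tau> x)"

definition B_s ::
    "(real^2) set \<Rightarrow> (real^2) set set \<Rightarrow> (real^2 \<Rightarrow> real^2) \<times> (real^2 \<Rightarrow> real) \<Rightarrow>
     (real^2 \<Rightarrow> real^2) \<times> (real^2 \<Rightarrow> real) \<Rightarrow> real" where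
  "B_s \<Omega> \<T> = (\<lambda>(\<sigma>, u) (\<tau>, v). a_s \<Omega> \<T> \<sigma> \<tau> - b_form \<Omega> \<T> \<tau> u - b_form \<Omega> \<T> \<sigma> v)"

definition nc_norm ::
    "(real^2) set \<Rightarrow> (real^2) set set \<Rightarrow> (real^2 \<Rightarrow> real^2) \<times> (real^2 \<Rightarrow> real) \<Rightarrow> real" where
  "nc_norm \<Omega> \<T> = (\<lambda>(\<tau>, v). sqrt (
     (L2_norm \<Omega> \<tau>)\<^sup>2 +
     (\<Sum>e\<in>interior_edges \<T>.
        (edge_L2_norm e (\<lambda>x. sqrt (edge_weight e) * normal_jump \<T> \<tau> e x))\<^sup>2) +
     (L2_norm \<Omega> (div_h \<T> \<tau>))\<^sup>2 +
     (L2_norm \<Omega> v)\<^sup>2))"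

text \<open>Elements of the discrete spaces are identified when they agree almost everywhere in \<open>\<Omega>\<close>.\<close>

definition ae_zero :: "(real^2) set \<Rightarrow> (real^2 \<Rightarrow> real^2) \<times> (real^2 \<Rightarrow> real) \<Rightarrow> bool" where
  "ae_zero \<Omega> = (\<lambda>(\<tau>, v). AE x in lebesgue_on \<Omega>. \<tau> x = 0 \<and> v x = 0)"

end

theory Submission
  imports Defs "HOL-Analysis.Analysis"
begin

text \<open>
  The constant in the inf-sup condition depends only on the radius of a ball around the origin that
  contains \<open>\<Omega>\<close>; the shape of the triangles does not enter.

  \<^bold>\<open>Reduction.\<close> Given \<open>(\<sigma>, u)\<close>, let \<open>\<tau>\<close> represent the functional \<open>b(_, u)\<close> with respect to the
  form \<open>a_s + (div_h _, div_h _)\<close> on Crouzeix--Raviart fields. The test pair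
  \<open>(\<sigma> - \<tau>, - u - div_h \<sigma>)\<close> makes the form at least half of the squared norms of \<open>\<sigma>\<close> and of \<open>\<tau>\<close>.
  What remains is a bound of \<open>u\<close>, or equally of \<open>w = u - div_h \<tau>\<close>, by \<open>a_s(\<tau>, \<tau>)\<close>: this is
  \<open>dual_estimate\<close>, and \<open>coeff_inf_sup\<close> draws the conclusion.

  \<^bold>\<open>A field in equilibrium.\<close> The equations that define \<open>\<tau>\<close>, tested with the basis function of one
  edge, balance forces across that edge. Add to the pressure \<open>w I\<close> on each triangle a constant
  tensor \<open>S\<close> made of the jumps \<open>j\<close> of \<open>\<tau>\<close> on its edges and an affine tensor \<open>E\<close> made of the edge
  values \<open>C\<close> of \<open>\<tau>\<close>. The balance says exactly that the resulting piecewise affine tensor \<open>X\<close>, extended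
  by zero to the plane, has a distributional divergence without concentrations on edges; its density
  is minus the mean of \<open>\<tau>\<close> on each triangle (\<open>stress_weak_divergence\<close>).

  \<^bold>\<open>Compensation.\<close> If the rows of \<open>X\<close> were divergence free, they would be rotated gradients, \<open>det X\<close>
  would be a null Lagrangian, and its integral would vanish. With a force density \<open>g\<close> the integral of
  \<open>det X\<close> is controlled by \<open>g\<close> times the potentials, and the same identity with the weight
  \<open>|x|\<^sup>2 / 2\<close> controls the potentials. As \<open>det (w I) = w\<^sup>2\<close>, this bounds the square of
  \<open>tr X / 2\<close> by \<open>g\<close> and by the deviation \<open>det X - (tr X / 2)\<^sup>2\<close> (\<open>smooth_trace_estimate\<close>; mollification
  gives \<open>weak_trace_estimate\<close>).

  \<^bold>\<open>Why thin triangles do no harm.\<close> \<open>S\<close> is a combination of the dyads of the tangents with the normals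
  of the three edges. Each dyad is nilpotent, and the mixed determinant of two of them is the square of twice
  the area. So \<open>|T| |det S|\<close> is at most a multiple of the sum of the \<open>j\<^sup>2\<close>, and the mixed terms of \<open>S\<close>
  and \<open>E\<close> are bounded in the same way, because the distance of a point of \<open>T\<close> from a vertex, measured
  across an edge, is at most the height (\<open>local_stress_bounds\<close>).
\<close>

section \<open>A weighted null Lagrangian estimate for smooth tensors\<close>
abbreviation square :: "real \<Rightarrow> (real \<times> real) set" where
  "square R \<equiv> cbox (-R, -R) (R, R)"

lemma mem_square: "(x, y) \<in> square R \<longleftrightarrow> \<bar>x\<bar> \<le> R \<and> \<bar>y\<bar> \<le> R"
  by (auto simp: cbox_Pair_eq)

lemma continuous_on_square_slices:
  fixes F :: "real \<times> real \<Rightarrow> real"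
  assumes "continuous_on (square R) F"
  shows "\<bar>y\<bar> \<le> R \<Longrightarrow> continuous_on {-R..R} (\<lambda>s. F (s, y))"
    and "\<bar>x\<bar> \<le> R \<Longrightarrow> continuous_on {-R..R} (\<lambda>t. F (x, t))"
  by (auto intro!: continuous_on_compose2[OF assms] continuous_intros simp: mem_square)

lemma integral_square_dx:
  fixes F :: "real \<times> real \<Rightarrow> real"
  assumes R: "0 \<le> R" and c: "continuous_on (square R) F'"
    and d: "\<And>x y. \<bar>x\<bar> \<le> R \<Longrightarrow> \<bar>y\<bar> \<le> R \<Longrightarrow>
      ((\<lambda>s. F (s, y)) has_real_derivative F' (x, y)) (at x within {-R..R})"
  shows "integral (square R) F' = integral {-R..R} (\<lambda>y. F (R, y) - F (-R, y))"
proof -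
  have "integral (square R) F' = integral {-R..R} (\<lambda>x. integral {-R..R} (\<lambda>y. F' (x, y)))"
    using integral_prod_continuous[OF c] by simp
  also have "\<dots> = integral {-R..R} (\<lambda>y. integral {-R..R} (\<lambda>x. F' (x, y)))"
    using integral_swap_continuous[of "-R" "-R" R R "\<lambda>x y. F' (x,y)"] c by simp
  also have "\<dots> = integral {-R..R} (\<lambda>y. F (R, y) - F (-R, y))"
  proof (rule integral_cong)
    fix y assume y: "y \<in> {-R..R}"
    have "((\<lambda>x. F' (x, y)) has_integral (F (R, y) - F (-R, y))) {-R..R}"
      using R y by (intro fundamental_theorem_of_calculus)
        (auto simp: has_real_derivative_iff_has_vector_derivative[symmetric] intro!: d)
    then show "integral {-R..R} (\<lambda>x. F' (x, y)) = F (R, y) - F (-R, y)"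
      by (rule integral_unique)
  qed
  finally show ?thesis .
qed

lemma integral_square_dy:
  fixes F :: "real \<times> real \<Rightarrow> real"
  assumes R: "0 \<le> R" and c: "continuous_on (square R) F'"
    and d: "\<And>x y. \<bar>x\<bar> \<le> R \<Longrightarrow> \<bar>y\<bar> \<le> R \<Longrightarrow>
      ((\<lambda>t. F (x, t)) has_real_derivative F' (x, y)) (at y within {-R..R})"
  shows "integral (square R) F' = integral {-R..R} (\<lambda>x. F (x, R) - F (x, -R))"
proof -
  have "integral (square R) F' = integral {-R..R} (\<lambda>x. integral {-R..R} (\<lambda>y. F' (x, y)))"
    using integral_prod_continuous[OF c] by simp
  also have "\<dots> = integral {-R..R} (\<lambda>x. F (x, R) - F (x, -R))"
  proof (rule integral_cong)
    fix x assume x: "x \<in> {-R..R}"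
    have "((\<lambda>y. F' (x, y)) has_integral (F (x, R) - F (x, -R))) {-R..R}"
      using R x by (intro fundamental_theorem_of_calculus)
        (auto simp: has_real_derivative_iff_has_vector_derivative[symmetric] intro!: d)
    then show "integral {-R..R} (\<lambda>y. F' (x, y)) = F (x, R) - F (x, -R)"
      by (rule integral_unique)
  qed
  finally show ?thesis .
qed

definition primitive :: "real \<Rightarrow> (real \<times> real \<Rightarrow> real) \<Rightarrow> real \<times> real \<Rightarrow> real" where
  "primitive R F p = integral {-R..fst p} (\<lambda>s. F (s, snd p))"

lemma primitive_at_left [simp]: "primitive R F (-R, y) = 0"
  by (simp add: primitive_def)

lemma continuous_on_primitive:
  assumes R: "0 \<le> R" and c: "continuous_on (square R) F"
  shows "continuous_on (square R) (primitive R F)"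
proof -
  have *: "primitive R F p = (fst p + R) * integral (cbox 0 1) (\<lambda>t. F (- R + t * (fst p + R), snd p))"
    if p: "p \<in> square R" for p
  proof -
    obtain x y where [simp]: "p = (x, y)" by force
    have xy: "\<bar>x\<bar> \<le> R" "\<bar>y\<bar> \<le> R" using p by (auto simp: cbox_Pair_eq)
    have "((\<lambda>t. (x + R) *\<^sub>R (\<lambda>s. F (s, y)) (- R + t * (x + R))) has_integral
        (integral {- R + 0 * (x + R) .. - R + 1 * (x + R)} (\<lambda>s. F (s, y)))) {0..1}"
    proof (rule has_integral_substitution)
      show "(\<lambda>t. - R + t * (x + R)) ` {0..1} \<subseteq> {-R..R}"
      proof (rule image_subsetI)
        fix t :: real assume t: "t \<in> {0..1}"
        have "t * (x + R) \<le> 1 * (x + R)" using t xy by (intro mult_right_mono) auto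
        moreover have "0 \<le> t * (x + R)" using t xy by (intro mult_nonneg_nonneg) auto
        ultimately show "- R + t * (x + R) \<in> {-R..R}" using xy by auto
      qed
      show "continuous_on {-R..R} (\<lambda>s. F (s, y))"
        using continuous_on_square_slices(1)[OF c] xy by blast
      show "- R + 0 * (x + R) \<le> - R + 1 * (x + R)" using xy by auto
    qed (auto intro!: derivative_eq_intros)
    from integral_unique[OF this] show ?thesis
      by (simp add: primitive_def)
  qed
  have "continuous_on (square R) (\<lambda>p. integral (cbox 0 1) (\<lambda>t. F (- R + t * (fst p + R), snd p)))"
  proof (rule integral_continuous_on_param)
    have "(\<lambda>q. (- R + snd q * (fst (fst q) + R), snd (fst q))) ` (square R \<times> cbox 0 1) \<subseteq> square R"
    proof (rule image_subsetI)
      fix q assume "q \<in> square R \<times> cbox 0 (1::real)"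
      then obtain x y t where q: "q = ((x, y), t)" "0 \<le> t" "t \<le> 1" "\<bar>x\<bar> \<le> R" "\<bar>y\<bar> \<le> R"
        by (auto simp: mem_square)
      have "t * (x + R) \<le> 1 * (x + R)" using q by (intro mult_right_mono) auto
      moreover have "0 \<le> t * (x + R)" using q by (intro mult_nonneg_nonneg) auto
      ultimately show "(- R + snd q * (fst (fst q) + R), snd (fst q)) \<in> square R"
        using q by (auto simp: mem_square abs_le_iff)
    qed
    then show "continuous_on (square R \<times> cbox 0 1) (\<lambda>(p, t). F (- R + t * (fst p + R), snd p))"
      by (auto simp: split_beta intro!: continuous_on_compose2[OF c] continuous_intros)
  qed
  then have "continuous_on (square R) (\<lambda>p. (fst p + R) * integral (cbox 0 1) (\<lambda>t. F (- R + t * (fst p + R), snd p)))"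
    by (intro continuous_intros)
  then show ?thesis
    using * by (subst continuous_on_cong[OF refl]) auto
qed

lemma primitive_dx:
  assumes "continuous_on (square R) F" "\<bar>x\<bar> \<le> R" "\<bar>y\<bar> \<le> R"
  shows "((\<lambda>s. primitive R F (s, y)) has_real_derivative F (x, y)) (at x within {-R..R})"
  unfolding primitive_def fst_conv snd_conv
  using integral_has_real_derivative[OF continuous_on_square_slices(1)[OF assms(1,3)], of x] assms
  by (auto simp: abs_le_iff)

lemma primitive_dy:
  assumes c: "continuous_on (square R) F" and c': "continuous_on (square R) F'"
    and d: "\<And>x y. \<bar>x\<bar> \<le> R \<Longrightarrow> \<bar>y\<bar> \<le> R \<Longrightarrow>
      ((\<lambda>t. F (x, t)) has_real_derivative F' (x, y)) (at y within {-R..R})"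
    and xy: "\<bar>x\<bar> \<le> R" "\<bar>y\<bar> \<le> R"
  shows "((\<lambda>t. primitive R F (x, t)) has_real_derivative primitive R F' (x, y)) (at y within {-R..R})"
proof -
  have "((\<lambda>t. integral (cbox (-R) x) (\<lambda>s. F (s, t))) has_real_derivative
      integral (cbox (-R) x) (\<lambda>s. F' (s, y))) (at y within {-R..R})"
  proof (rule leibniz_rule_field_derivative[where fx = "\<lambda>t s. F' (s, t)"])
    show "((\<lambda>t. F (s, t)) has_real_derivative F' (s, t)) (at t within {-R..R})"
      if "t \<in> {-R..R}" "s \<in> cbox (-R) x" for s t
      using that xy by (intro d) auto
    show "(\<lambda>s. F (s, t)) integrable_on cbox (-R) x" if "t \<in> {-R..R}" for t
      using that xy by (intro integrable_continuous continuous_on_subset[OF continuous_on_square_slices(1)[OF c]]) auto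
    show "continuous_on ({-R..R} \<times> cbox (-R) x) (\<lambda>(t, s). F' (s, t))"
      using xy by (auto simp: split_beta mem_square intro!: continuous_on_compose2[OF c'] continuous_intros)
  qed (use xy in auto)
  then show ?thesis by (simp add: primitive_def)
qed

text \<open>
  Cauchy--Schwarz against the constant 1, from the nonnegative variance of \<open>f\<close>.
\<close>

lemma power2_integral_le:
  fixes f :: "real \<Rightarrow> real"
  assumes c: "continuous_on {a..b} f" and ab: "a \<le> b"
  shows "(integral {a..b} f)\<^sup>2 \<le> (b - a) * integral {a..b} (\<lambda>x. (f x)\<^sup>2)"
proof (cases "a = b")
  case False
  with ab have ab: "0 < b - a" by simp
  define m where "m = integral {a..b} f / (b - a)"
  have i: "f integrable_on {a..b}" "(\<lambda>x. (f x)\<^sup>2) integrable_on {a..b}"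
    using c by (auto intro!: integrable_continuous_real continuous_intros)
  have "0 \<le> integral {a..b} (\<lambda>x. (f x - m)\<^sup>2)"
    by (intro integral_nonneg integrable_continuous_real continuous_intros c) auto
  also have "(\<lambda>x. (f x - m)\<^sup>2) = (\<lambda>x. (f x)\<^sup>2 - (2 * m) * f x + m\<^sup>2)"
    by (auto simp: power2_eq_square algebra_simps)
  also have "integral {a..b} \<dots> = integral {a..b} (\<lambda>x. (f x)\<^sup>2) - (2 * m) * integral {a..b} f + m\<^sup>2 * (b - a)"
    using i ab by (subst integral_add integral_diff; (intro integrable_diff integrable_on_mult_right)?) 
       (auto simp: integral_diff integrable_on_mult_right)
  also have "\<dots> = integral {a..b} (\<lambda>x. (f x)\<^sup>2) - (integral {a..b} f)\<^sup>2 / (b - a)"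
  proof -
    have "(integral {a..b} f)\<^sup>2 / (b - a) = m * integral {a..b} f"
      by (simp add: m_def power2_eq_square)
    moreover have "m\<^sup>2 * (b - a) = m * integral {a..b} f"
      using ab by (simp add: m_def power2_eq_square)
    ultimately show ?thesis by simp
  qed
  finally show ?thesis using ab by (simp add: field_simps)
qed auto

text \<open>
  Cauchy--Schwarz on each horizontal line bounds the primitive there; integrating over the lines gives
  both a trace bound on the right side of the square and a bound inside.
\<close>

lemma primitive_bounds:
  assumes R: "0 < R" and c: "continuous_on (square R) F"
  shows "integral {-R..R} (\<lambda>y. (primitive R F (R, y))\<^sup>2) \<le> 2 * R * integral (square R) (\<lambda>p. (F p)\<^sup>2)"
    and "integral (square R) (\<lambda>p. (primitive R F p)\<^sup>2) \<le> 4 * R\<^sup>2 * integral (square R) (\<lambda>p. (F p)\<^sup>2)"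
proof -
  let ?I = "\<lambda>y. integral {-R..R} (\<lambda>x. (F (x, y))\<^sup>2)"
  have c2: "continuous_on (square R) (\<lambda>p. (F p)\<^sup>2)" using c by (intro continuous_intros)
  have I_eq: "integral (square R) (\<lambda>p. (F p)\<^sup>2) = integral {-R..R} ?I"
    using integral_prod_continuous[OF c2]
      integral_swap_continuous[of "-R" "-R" R R "\<lambda>x y. (F (x,y))\<^sup>2"] c2 by (simp add: split_beta')
  have Ic: "continuous_on {-R..R} ?I"
  proof -
    have "continuous_on ({-R..R} \<times> cbox (-R) R) (\<lambda>z. (\<lambda>p. (F p)\<^sup>2) (snd z, fst z))"
      by (rule continuous_on_compose2[OF c2]) (auto simp: mem_square intro!: continuous_intros)
    then have "continuous_on ({-R..R} \<times> cbox (-R) R) (\<lambda>(y, x). (F (x, y))\<^sup>2)"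
      by (simp add: split_beta')
    from integral_continuous_on_param[OF this] show ?thesis by simp
  qed
  have pc: "continuous_on (square R) (\<lambda>p. (primitive R F p)\<^sup>2)"
    using R by (intro continuous_intros continuous_on_primitive c) auto
  have le: "(primitive R F (x, y))\<^sup>2 \<le> 2 * R * ?I y" if xy: "\<bar>x\<bar> \<le> R" "\<bar>y\<bar> \<le> R" for x y
  proof -
    have cy: "continuous_on {-R..R} (\<lambda>s. F (s, y))" using continuous_on_square_slices(1)[OF c xy(2)] .
    have cx: "continuous_on {-R..x} (\<lambda>s. F (s, y))" by (rule continuous_on_subset[OF cy]) (use xy in auto)
    have "(primitive R F (x, y))\<^sup>2 \<le> (x - - R) * integral {-R..x} (\<lambda>s. (F (s, y))\<^sup>2)"
      unfolding primitive_def fst_conv snd_conv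
      using xy by (intro power2_integral_le cx) auto
    also have "\<dots> \<le> (2 * R) * integral {-R..R} (\<lambda>s. (F (s, y))\<^sup>2)"
    proof (rule mult_mono)
      show "integral {-R..x} (\<lambda>s. (F (s, y))\<^sup>2) \<le> integral {-R..R} (\<lambda>s. (F (s, y))\<^sup>2)"
        using xy by (intro integral_subset_le integrable_continuous_real continuous_intros cx cy) auto
      show "0 \<le> integral {-R..x} (\<lambda>s. (F (s, y))\<^sup>2)"
        by (intro integral_nonneg integrable_continuous_real continuous_intros cx) auto
    qed (use xy R in auto)
    finally show ?thesis .
  qed
  have "integral {-R..R} (\<lambda>y. (primitive R F (R, y))\<^sup>2) \<le> integral {-R..R} (\<lambda>y. 2 * R * ?I y)"
  proof (rule integral_le)
    show "(\<lambda>y. (primitive R F (R, y))\<^sup>2) integrable_on {-R..R}"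
      using R by (intro integrable_continuous_real continuous_on_square_slices(2)[OF pc]) auto
    show "(\<lambda>y. 2 * R * ?I y) integrable_on {-R..R}"
      by (intro integrable_continuous_real continuous_intros Ic)
  qed (use R le in auto)
  then show "integral {-R..R} (\<lambda>y. (primitive R F (R, y))\<^sup>2) \<le> 2 * R * integral (square R) (\<lambda>p. (F p)\<^sup>2)"
    by (simp add: I_eq)
  have "integral (square R) (\<lambda>p. (primitive R F p)\<^sup>2)
      = integral {-R..R} (\<lambda>x. integral {-R..R} (\<lambda>y. (primitive R F (x, y))\<^sup>2))"
    using integral_prod_continuous[OF pc] by simp
  also have "\<dots> \<le> integral {-R..R} (\<lambda>x. 2 * R * integral (square R) (\<lambda>p. (F p)\<^sup>2))"
  proof (rule integral_le)
    have "continuous_on ({-R..R} \<times> cbox (-R) R) (\<lambda>(x, y). (primitive R F (x, y))\<^sup>2)"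
      using pc by (simp add: split_beta' cbox_Pair_eq)
    from integral_continuous_on_param[OF this]
    show "(\<lambda>x. integral {-R..R} (\<lambda>y. (primitive R F (x, y))\<^sup>2)) integrable_on {-R..R}"
      by (intro integrable_continuous_real) simp
    fix x assume x: "x \<in> {-R..R}"
    have "integral {-R..R} (\<lambda>y. (primitive R F (x, y))\<^sup>2) \<le> integral {-R..R} (\<lambda>y. 2 * R * ?I y)"
    proof (rule integral_le)
      show "(\<lambda>y. (primitive R F (x, y))\<^sup>2) integrable_on {-R..R}"
        using x by (intro integrable_continuous_real continuous_on_square_slices(2)[OF pc]) auto
      show "(\<lambda>y. 2 * R * ?I y) integrable_on {-R..R}"
        by (intro integrable_continuous_real continuous_intros Ic)
    qed (use R le x in auto)
    then show "integral {-R..R} (\<lambda>y. (primitive R F (x, y))\<^sup>2) \<le> 2 * R * integral (square R) (\<lambda>p. (F p)\<^sup>2)"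
      by (simp add: I_eq)
  qed (rule integrable_const_ivl)
  also have "\<dots> = 4 * R\<^sup>2 * integral (square R) (\<lambda>p. (F p)\<^sup>2)"
    using R by (simp add: power2_eq_square)
  finally show "integral (square R) (\<lambda>p. (primitive R F p)\<^sup>2) \<le> 4 * R\<^sup>2 * integral (square R) (\<lambda>p. (F p)\<^sup>2)" .
qed

text \<open>
  A one-dimensional Poincare inequality. It is applied on the right side of the square, where the
  tangential derivatives of the potentials are primitives of the forces.
\<close>

lemma power2_le_integral_power2:
  fixes A :: "real \<Rightarrow> real"
  assumes R: "0 < R" and A0: "A (-R) = 0" and c: "continuous_on {-R..R} A'"
    and d: "\<And>y. \<bar>y\<bar> \<le> R \<Longrightarrow> (A has_real_derivative A' y) (at y within {-R..R})"
  shows "integral {-R..R} (\<lambda>y. (A y)\<^sup>2) \<le> 4 * R\<^sup>2 * integral {-R..R} (\<lambda>y. (A' y)\<^sup>2)"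
proof -
  have Ac: "continuous_on {-R..R} A"
    by (intro DERIV_continuous_on[where D = A']) (auto intro!: d)
  have "integral {-R..R} (\<lambda>y. (A y)\<^sup>2) \<le> integral {-R..R} (\<lambda>y::real. 2 * R * integral {-R..R} (\<lambda>y. (A' y)\<^sup>2))"
  proof (rule integral_le)
    fix y assume y: "y \<in> {-R..R}"
    have "(A' has_integral (A y - A (-R))) {-R..y}"
      using y by (intro fundamental_theorem_of_calculus)
        (auto simp: has_real_derivative_iff_has_vector_derivative[symmetric]
          intro!: DERIV_subset[OF d])
    then have "A y = integral {-R..y} A'" using A0 by (simp add: integral_unique)
    moreover have cy: "continuous_on {-R..y} A'" by (rule continuous_on_subset[OF c]) (use y in auto)
    ultimately have "(A y)\<^sup>2 \<le> (y - - R) * integral {-R..y} (\<lambda>s. (A' s)\<^sup>2)"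
      using power2_integral_le[OF cy] y by auto
    also have "\<dots> \<le> (2 * R) * integral {-R..R} (\<lambda>s. (A' s)\<^sup>2)"
    proof (rule mult_mono)
      show "integral {-R..y} (\<lambda>s. (A' s)\<^sup>2) \<le> integral {-R..R} (\<lambda>s. (A' s)\<^sup>2)"
        using y by (intro integral_subset_le integrable_continuous_real continuous_intros c cy) auto
      show "0 \<le> integral {-R..y} (\<lambda>s. (A' s)\<^sup>2)"
        by (intro integral_nonneg integrable_continuous_real continuous_intros cy) auto
    qed (use y R in auto)
    finally show "(A y)\<^sup>2 \<le> 2 * R * integral {-R..R} (\<lambda>y. (A' y)\<^sup>2)" .
  qed (auto intro!: integrable_continuous_real continuous_intros Ac)
  also have "\<dots> = 4 * R\<^sup>2 * integral {-R..R} (\<lambda>y. (A' y)\<^sup>2)"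
    using R by (simp add: power2_eq_square)
  finally show ?thesis .
qed

text \<open>
  Write \<open>(P, Q)\<close> and \<open>(S, U)\<close> for the rows of \<open>X\<close> and \<open>g1, g2\<close> for minus their divergences. The
  potentials \<open>a, b\<close> are the primitives of \<open>Q, U\<close> in the first coordinate. Since the rows vanish on the
  boundary, \<open>P\<close> and \<open>S\<close> are minus the derivatives of \<open>a, b\<close> in the second coordinate, up to the primitives
  \<open>G1, G2\<close> of the forces; so \<open>PU - QS\<close> is a divergence up to terms that contain forces. Multiplied by
  the weight 1 this identity bounds the trace, up to a small multiple of the potentials. Multiplied by
  \<open>|x|\<^sup>2 / 2\<close> it bounds the potentials by the trace, because the derivatives of the weight times \<open>a, b\<close> and
  their derivatives are again exact up to \<open>(a\<^sup>2 + b\<^sup>2) / 2\<close>. The two bounds close for these constants.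
\<close>

lemma smooth_trace_estimate:
  fixes P Q S U :: "real \<times> real \<Rightarrow> real"
  assumes R: "0 < R"
    and cont: "continuous_on (square R) P" "continuous_on (square R) Q"
      "continuous_on (square R) S" "continuous_on (square R) U"
      "continuous_on (square R) P'" "continuous_on (square R) Q'"
      "continuous_on (square R) S'" "continuous_on (square R) U'"
    and dP: "\<And>x y. \<bar>x\<bar> \<le> R \<Longrightarrow> \<bar>y\<bar> \<le> R \<Longrightarrow>
      ((\<lambda>s. P (s, y)) has_real_derivative P' (x, y)) (at x within {-R..R})"
    and dQ: "\<And>x y. \<bar>x\<bar> \<le> R \<Longrightarrow> \<bar>y\<bar> \<le> R \<Longrightarrow>
      ((\<lambda>t. Q (x, t)) has_real_derivative Q' (x, y)) (at y within {-R..R})"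
    and dS: "\<And>x y. \<bar>x\<bar> \<le> R \<Longrightarrow> \<bar>y\<bar> \<le> R \<Longrightarrow>
      ((\<lambda>s. S (s, y)) has_real_derivative S' (x, y)) (at x within {-R..R})"
    and dU: "\<And>x y. \<bar>x\<bar> \<le> R \<Longrightarrow> \<bar>y\<bar> \<le> R \<Longrightarrow>
      ((\<lambda>t. U (x, t)) has_real_derivative U' (x, y)) (at y within {-R..R})"
    and zx: "\<And>y. P (R, y) = 0" "\<And>y. P (-R, y) = 0" "\<And>y. S (R, y) = 0" "\<And>y. S (-R, y) = 0"
    and zy: "\<And>x. Q (x, R) = 0" "\<And>x. Q (x, -R) = 0" "\<And>x. U (x, R) = 0" "\<And>x. U (x, -R) = 0"
  shows "integral (square R) (\<lambda>p. ((P p + U p) / 2)\<^sup>2) \<le>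
      3 * integral (square R) (\<lambda>p. \<bar>P p * U p - Q p * S p - ((P p + U p) / 2)\<^sup>2\<bar>)
      + 134 * R\<^sup>2 * integral (square R) (\<lambda>p. (P' p + Q' p)\<^sup>2 + (S' p + U' p)\<^sup>2)"
proof -
  define I :: "(real \<times> real \<Rightarrow> real) \<Rightarrow> real" where "I = integral (square R)"
  define J :: "(real \<Rightarrow> real) \<Rightarrow> real" where "J = integral {-R..R}"
  define g1 where "g1 p = - (P' p + Q' p)" for p
  define g2 where "g2 p = - (S' p + U' p)" for p
  define a where "a = primitive R Q"
  define b where "b = primitive R U"
  define G1 where "G1 = primitive R g1"
  define G2 where "G2 = primitive R g2"
  define v where "v p = (P p + U p) / 2" for p
  define D where "D p = P p * U p - Q p * S p - (v p)\<^sup>2" for p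
  have R0: "0 \<le> R" using R by simp
  have hi: "(h has_integral I h) (square R)" if "continuous_on (square R) h" for h
    unfolding I_def using that by (intro integrable_integral integrable_continuous)
  have iu: "I h = r" if "(h has_integral r) (square R)" for h r
    unfolding I_def using that by (rule integral_unique)
  have hj: "(h has_integral J h) {-R..R}" if "continuous_on {-R..R} h" for h
    unfolding J_def using that by (intro integrable_integral integrable_continuous_real)
  have ju: "J h = r" if "(h has_integral r) {-R..R}" for h r
    unfolding J_def using that by (rule integral_unique)
  have cg: "continuous_on (square R) g1" "continuous_on (square R) g2"
    unfolding g1_def g2_def by (intro continuous_intros cont)+
  have cp: "continuous_on (square R) a" "continuous_on (square R) b"
    "continuous_on (square R) G1" "continuous_on (square R) G2"
    unfolding a_def b_def G1_def G2_def by (intro continuous_on_primitive R0 cont cg)+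
  note c = cont cg cp
  have cv: "continuous_on (square R) v" unfolding v_def by (intro continuous_intros c) auto
  have cD: "continuous_on (square R) D" unfolding D_def by (intro continuous_intros c cv)
  note c = c cv cD
  have da: "((\<lambda>s. a (s, y)) has_real_derivative Q (x, y)) (at x within {-R..R})"
    and db: "((\<lambda>s. b (s, y)) has_real_derivative U (x, y)) (at x within {-R..R})"
    and dG1: "((\<lambda>s. G1 (s, y)) has_real_derivative g1 (x, y)) (at x within {-R..R})"
    and dG2: "((\<lambda>s. G2 (s, y)) has_real_derivative g2 (x, y)) (at x within {-R..R})"
    if "\<bar>x\<bar> \<le> R" "\<bar>y\<bar> \<le> R" for x y
    unfolding a_def b_def G1_def G2_def using that by (intro primitive_dx c; simp)+
  have pq: "primitive R Q' (x, y) = - G1 (x, y) - P (x, y)"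
    and pu: "primitive R U' (x, y) = - G2 (x, y) - S (x, y)" if xy: "\<bar>x\<bar> \<le> R" "\<bar>y\<bar> \<le> R" for x y
  proof -
    have *: "primitive R F' (x, y) = - primitive R g (x, y) - F (x, y)"
      if F': "continuous_on (square R) F'" and g: "continuous_on (square R) g"
        and H': "continuous_on (square R) H'"
        and H: "\<And>p. H' p = - g p - F' p"
        and dF: "\<And>x y. \<bar>x\<bar> \<le> R \<Longrightarrow> \<bar>y\<bar> \<le> R \<Longrightarrow>
          ((\<lambda>s. F (s, y)) has_real_derivative H' (x, y)) (at x within {-R..R})"
        and F0: "F (-R, y) = 0" for F F' g H' :: "real \<times> real \<Rightarrow> real"
    proof -
      have "((\<lambda>s. H' (s, y)) has_integral (F (x, y) - F (-R, y))) {-R..x}"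
        using xy by (intro fundamental_theorem_of_calculus)
         (auto simp: has_real_derivative_iff_has_vector_derivative[symmetric] intro!: DERIV_subset[OF dF])
      then have 1: "integral {-R..x} (\<lambda>s. H' (s, y)) = F (x, y)" using F0 by (simp add: integral_unique)
      have ci: "(\<lambda>s. h (s, y)) integrable_on {-R..x}" if "continuous_on (square R) h" for h :: "real \<times> real \<Rightarrow> real"
        using xy by (intro integrable_continuous_real continuous_on_subset[OF continuous_on_square_slices(1)[OF that]]) auto
      have "integral {-R..x} (\<lambda>s. F' (s, y)) = integral {-R..x} (\<lambda>s. - g (s, y) - H' (s, y))"
        by (simp add: H)
      also have "\<dots> = - integral {-R..x} (\<lambda>s. g (s, y)) - F (x, y)"
        using ci[OF g] ci[OF H'] 1 by (simp add: integral_diff integrable_neg)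
      finally show ?thesis by (simp add: primitive_def)
    qed
    show "primitive R Q' (x, y) = - G1 (x, y) - P (x, y)"
      unfolding G1_def by (rule *[where H' = P']) (use c dP zx in \<open>auto simp: g1_def\<close>)
    show "primitive R U' (x, y) = - G2 (x, y) - S (x, y)"
      unfolding G2_def by (rule *[where H' = S']) (use c dS zx in \<open>auto simp: g2_def\<close>)
  qed
  have ea: "((\<lambda>t. a (x, t)) has_real_derivative - G1 (x, y) - P (x, y)) (at y within {-R..R})"
    and eb: "((\<lambda>t. b (x, t)) has_real_derivative - G2 (x, y) - S (x, y)) (at y within {-R..R})"
    if "\<bar>x\<bar> \<le> R" "\<bar>y\<bar> \<le> R" for x y
    using primitive_dy[OF cont(2) cont(6) dQ that] primitive_dy[OF cont(4) cont(8) dU that] pq[OF that] pu[OF that]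
    by (simp_all add: a_def b_def)
  have left: "a (-R, y) = 0" "b (-R, y) = 0" "G2 (-R, y) = 0" for y
    by (simp_all add: a_def b_def G2_def)
  have bot: "a (x, R) = 0" "b (x, R) = 0" "a (x, -R) = 0" "b (x, -R) = 0" for x
    by (simp_all add: a_def b_def primitive_def zy)
  \<comment> \<open>\<open>E\<close> is the divergence of the field with components \<open>w P b + w a G2\<close> and \<open>w Q b\<close>;
      its terms without force or derivative of \<open>w\<close> are \<open>w (P U - Q S)\<close>.\<close>
  define E where "E w wx wy p =
      (wx p * P p * b p + w p * P' p * b p + w p * P p * U p)
    + (wy p * Q p * b p + w p * Q' p * b p + w p * Q p * (- G2 p - S p))
    + (wx p * a p * G2 p + w p * Q p * G2 p + w p * a p * g2 p)" for w wx wy :: "real \<times> real \<Rightarrow> real" and p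
  have E: "I (E w wx wy) = J (\<lambda>y. w (R, y) * a (R, y) * G2 (R, y))"
    if cw: "continuous_on (square R) w" "continuous_on (square R) wx" "continuous_on (square R) wy"
     and dx: "\<And>x y. ((\<lambda>s. w (s, y)) has_real_derivative wx (x, y)) (at x within {-R..R})"
     and dy: "\<And>x y. ((\<lambda>t. w (x, t)) has_real_derivative wy (x, y)) (at y within {-R..R})" for w wx wy
  proof -
    have "I (\<lambda>p. wx p * P p * b p + w p * P' p * b p + w p * P p * U p)
        = J (\<lambda>y. w (R, y) * P (R, y) * b (R, y) - w (-R, y) * P (-R, y) * b (-R, y))" (is "I ?E1 = _")
      unfolding I_def J_def
      by (rule integral_square_dx[OF R0, where F = "\<lambda>p. w p * P p * b p"])
        (auto intro!: continuous_intros c cw derivative_eq_intros dx dP db simp: algebra_simps)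
    then have 1: "I ?E1 = 0" by (simp add: zx J_def)
    have "I (\<lambda>p. wy p * Q p * b p + w p * Q' p * b p + w p * Q p * (- G2 p - S p))
        = J (\<lambda>x. w (x, R) * Q (x, R) * b (x, R) - w (x, -R) * Q (x, -R) * b (x, -R))" (is "I ?E2 = _")
      unfolding I_def J_def
      by (rule integral_square_dy[OF R0, where F = "\<lambda>p. w p * Q p * b p"])
        (auto intro!: continuous_intros c cw derivative_eq_intros dy dQ eb simp: algebra_simps)
    then have 2: "I ?E2 = 0" by (simp add: zy J_def)
    have "I (\<lambda>p. wx p * a p * G2 p + w p * Q p * G2 p + w p * a p * g2 p)
        = J (\<lambda>y. w (R, y) * a (R, y) * G2 (R, y) - w (-R, y) * a (-R, y) * G2 (-R, y))" (is "I ?E3 = _")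
      unfolding I_def J_def
      by (rule integral_square_dx[OF R0, where F = "\<lambda>p. w p * a p * G2 p"])
        (auto intro!: continuous_intros c cw derivative_eq_intros dx da dG2 simp: algebra_simps)
    then have 3: "I ?E3 = J (\<lambda>y. w (R, y) * a (R, y) * G2 (R, y))" by (simp add: left)
    have "I (E w wx wy) = I ?E1 + I ?E2 + I ?E3"
      unfolding E_def by (intro iu has_integral_add hi) (intro continuous_intros c cw)+
    then show ?thesis using 1 2 3 by simp
  qed
  have bigc: "continuous_on (square R) (E w wx wy)"
    if "continuous_on (square R) w" "continuous_on (square R) wx" "continuous_on (square R) wy" for w wx wy
    unfolding E_def by (intro continuous_intros c that)
  define \<Gamma>1 where "\<Gamma>1 = I (\<lambda>p. (g1 p)\<^sup>2)"
  define \<Gamma>2 where "\<Gamma>2 = I (\<lambda>p. (g2 p)\<^sup>2)"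
  define V where "V = I (\<lambda>p. (v p)\<^sup>2)"
  define \<Delta> where "\<Delta> = I (\<lambda>p. \<bar>D p\<bar>)"
  define Na where "Na = I (\<lambda>p. (a p)\<^sup>2)"
  define Nb where "Nb = I (\<lambda>p. (b p)\<^sup>2)"
  note I_intros = integrable_continuous continuous_intros c
  have nonneg: "0 \<le> \<Gamma>1" "0 \<le> \<Gamma>2" "0 \<le> V" "0 \<le> \<Delta>"
    unfolding \<Gamma>1_def \<Gamma>2_def V_def \<Delta>_def I_def by (intro integral_nonneg I_intros; simp)+
  \<comment> \<open>Only the right side of the square contributes boundary terms, and the potentials there
      are bounded by the forces alone.\<close>
  have cR: "continuous_on {-R..R} (\<lambda>y. h (R, y))" if "continuous_on (square R) h" for h :: "real \<times> real \<Rightarrow> real"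
    using continuous_on_square_slices(2)[OF that] R by simp
  note cR' = cp[THEN cR]
  define Ja where "Ja = J (\<lambda>y. (a (R, y))\<^sup>2)"
  define Jb where "Jb = J (\<lambda>y. (b (R, y))\<^sup>2)"
  define JG where "JG = J (\<lambda>y. (G2 (R, y))\<^sup>2)"
  have JG: "JG \<le> 2 * R * \<Gamma>2"
    unfolding JG_def J_def G2_def \<Gamma>2_def I_def by (rule primitive_bounds(1)[OF R cg(2)])
  have JG1: "J (\<lambda>y. (G1 (R, y))\<^sup>2) \<le> 2 * R * \<Gamma>1"
    unfolding J_def G1_def \<Gamma>1_def I_def by (rule primitive_bounds(1)[OF R cg(1)])
  have "Ja \<le> 4 * R\<^sup>2 * J (\<lambda>y. (- G1 (R, y))\<^sup>2)"
    unfolding Ja_def J_def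
    by (rule power2_le_integral_power2[OF R]) (use R ea[of R] in \<open>auto simp: bot zx intro!: continuous_intros cR'\<close>)
  also have "\<dots> \<le> 4 * R\<^sup>2 * (2 * R * \<Gamma>1)" using JG1 by (intro mult_left_mono) auto
  finally have Ja: "Ja \<le> 8 * R ^ 3 * \<Gamma>1" by (simp add: power2_eq_square power3_eq_cube mult_ac)
  have "Jb \<le> 4 * R\<^sup>2 * J (\<lambda>y. (- G2 (R, y))\<^sup>2)"
    unfolding Jb_def J_def
    by (rule power2_le_integral_power2[OF R]) (use R eb[of R] in \<open>auto simp: bot zx intro!: continuous_intros cR'\<close>)
  also have "\<dots> \<le> 4 * R\<^sup>2 * (2 * R * \<Gamma>2)" using JG by (intro mult_left_mono) (auto simp: JG_def)
  finally have Jb: "Jb \<le> 8 * R ^ 3 * \<Gamma>2" by (simp add: power2_eq_square power3_eq_cube mult_ac)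
  have IG: "I (\<lambda>p. (G1 p)\<^sup>2) \<le> 4 * R\<^sup>2 * \<Gamma>1" "I (\<lambda>p. (G2 p)\<^sup>2) \<le> 4 * R\<^sup>2 * \<Gamma>2"
    unfolding I_def G1_def G2_def \<Gamma>1_def \<Gamma>2_def by (rule primitive_bounds(2)[OF R] cg)+
  have young0: "x * y \<le> k * x\<^sup>2 + y\<^sup>2 / (4 * k)" if "0 < k" for x y k :: real
  proof -
    have "0 \<le> (2 * k * x - y)\<^sup>2 / (4 * k)" using that by simp
    also have "\<dots> = k * x\<^sup>2 + y\<^sup>2 / (4 * k) - x * y"
      using that by (simp add: power2_eq_square field_simps)
    finally show ?thesis by simp
  qed
  \<comment> \<open>The factors \<open>256\<close> and \<open>64\<close> in Young's inequality leave enough of \<open>V\<close> after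
      the bound of \<open>Na + Nb\<close> below, which contains \<open>128 R\<^sup>2 V\<close>, is inserted.\<close>
  have I1: "V \<le> J (\<lambda>y. a (R, y) * G2 (R, y)) + \<Delta> + (Na + Nb) / (256 * R\<^sup>2) + 64 * R\<^sup>2 * (\<Gamma>1 + \<Gamma>2)"
  proof -
    let ?E = "E (\<lambda>_. 1) (\<lambda>_. 0) (\<lambda>_. 0)"
    have cE: "continuous_on (square R) ?E" by (intro bigc continuous_intros)
    have "V \<le> I (\<lambda>p. ?E p + \<bar>D p\<bar> + (1 / (256 * R\<^sup>2)) * (a p)\<^sup>2 + (1 / (256 * R\<^sup>2)) * (b p)\<^sup>2
       + (64 * R\<^sup>2) * (g1 p)\<^sup>2 + (64 * R\<^sup>2) * (g2 p)\<^sup>2)"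
      unfolding V_def I_def
    proof (rule integral_le)
      fix p assume "p \<in> square R"
      have "(v p)\<^sup>2 = ?E p - D p + b p * g1 p + a p * (- g2 p)"
        by (simp add: E_def D_def g1_def g2_def algebra_simps)
      moreover have "b p * g1 p \<le> (1 / (256 * R\<^sup>2)) * (b p)\<^sup>2 + (64 * R\<^sup>2) * (g1 p)\<^sup>2"
        using young0[of "1 / (256 * R\<^sup>2)" "b p" "g1 p"] R by (simp add: mult_ac)
      moreover have "a p * (- g2 p) \<le> (1 / (256 * R\<^sup>2)) * (a p)\<^sup>2 + (64 * R\<^sup>2) * (g2 p)\<^sup>2"
        using young0[of "1 / (256 * R\<^sup>2)" "a p" "- g2 p"] R by (simp add: mult_ac)
      moreover have "- D p \<le> \<bar>D p\<bar>" by simp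
      ultimately show "(v p)\<^sup>2 \<le> ?E p + \<bar>D p\<bar> + (1 / (256 * R\<^sup>2)) * (a p)\<^sup>2 + (1 / (256 * R\<^sup>2)) * (b p)\<^sup>2
       + (64 * R\<^sup>2) * (g1 p)\<^sup>2 + (64 * R\<^sup>2) * (g2 p)\<^sup>2" by linarith
    qed (intro I_intros cE)+
    also have "\<dots> = I ?E + \<Delta> + (1 / (256 * R\<^sup>2)) * Na + (1 / (256 * R\<^sup>2)) * Nb + (64 * R\<^sup>2) * \<Gamma>1 + (64 * R\<^sup>2) * \<Gamma>2"
      unfolding \<Delta>_def Na_def Nb_def \<Gamma>1_def \<Gamma>2_def
      by (intro iu has_integral_add has_integral_mult_right hi) (intro continuous_intros c cE)+
    also have "I ?E = J (\<lambda>y. a (R, y) * G2 (R, y))"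
      using E[of "\<lambda>_. 1" "\<lambda>_. 0" "\<lambda>_. 0"] by simp
    finally show ?thesis by (simp add: add_divide_distrib algebra_simps)
  qed
  have J1: "J (\<lambda>y. a (R, y) * G2 (R, y)) \<le> 2 * R\<^sup>2 * (\<Gamma>1 + \<Gamma>2)"
  proof -
    have "J (\<lambda>y. a (R, y) * G2 (R, y)) \<le> J (\<lambda>y. (1 / (4 * R)) * (a (R, y))\<^sup>2 + R * (G2 (R, y))\<^sup>2)"
      unfolding J_def
    proof (rule integral_le)
      show "a (R, y) * G2 (R, y) \<le> (1 / (4 * R)) * (a (R, y))\<^sup>2 + R * (G2 (R, y))\<^sup>2" for y
        using young0[of "1 / (4 * R)" "a (R, y)" "G2 (R, y)"] R by (simp add: mult.commute[of R])
    qed (intro integrable_continuous_real continuous_intros cR')+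
    also have "\<dots> = (1 / (4 * R)) * Ja + R * JG"
      unfolding Ja_def JG_def
      by (intro ju has_integral_add has_integral_mult_right hj) (intro continuous_intros cR')+
    also have "\<dots> \<le> (1 / (4 * R)) * (8 * R ^ 3 * \<Gamma>1) + R * (2 * R * \<Gamma>2)"
      using R Ja JG by (intro add_mono mult_left_mono) auto
    also have "\<dots> = 2 * R\<^sup>2 * (\<Gamma>1 + \<Gamma>2)" using R by (simp add: power2_eq_square power3_eq_cube field_simps)
    finally show ?thesis .
  qed
  \<comment> \<open>The three terms added to \<open>E\<close> in \<open>H\<close> are exact derivatives that turn the
      products of \<open>a, b\<close> with their own derivatives into \<open>(a\<^sup>2 + b\<^sup>2) / 2\<close>.\<close>
  define w where "w p = ((fst p)\<^sup>2 + (snd p)\<^sup>2) / 2" for p :: "real \<times> real"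
  have cw: "continuous_on (square R) w" unfolding w_def by (intro continuous_intros) auto
  define H where "H p = E w fst snd p + ((b p)\<^sup>2 / 2 + fst p * b p * U p)
     - (snd p * Q p * b p + snd p * a p * U p) + ((a p)\<^sup>2 / 2 + snd p * a p * (- G1 p - P p))" for p
  have cE: "continuous_on (square R) (E w fst snd)" by (intro bigc cw continuous_intros)
  have cH: "continuous_on (square R) H" unfolding H_def by (intro continuous_intros cE c) auto
  have IH: "I H = J (\<lambda>y. w (R, y) * a (R, y) * G2 (R, y)) + (R / 2) * Jb - J (\<lambda>y. y * a (R, y) * b (R, y))"
  proof -
    have 0: "I (E w fst snd) = J (\<lambda>y. w (R, y) * a (R, y) * G2 (R, y))"
      by (rule E) (auto simp: w_def intro!: continuous_intros derivative_eq_intros)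
    have "I (\<lambda>p. (b p)\<^sup>2 / 2 + fst p * b p * U p) = J (\<lambda>y. fst (R, y) * (b (R, y))\<^sup>2 / 2 - fst (-R, y) * (b (-R, y))\<^sup>2 / 2)"
      (is "I ?h1 = _")
      unfolding I_def J_def
      by (rule integral_square_dx[OF R0, where F = "\<lambda>p. fst p * (b p)\<^sup>2 / 2"])
        (auto intro!: continuous_intros c derivative_eq_intros db simp: algebra_simps)
    also have "\<dots> = J (\<lambda>y. (R / 2) * (b (R, y))\<^sup>2)" by (simp add: left)
    finally have 1: "I ?h1 = (R / 2) * Jb" unfolding Jb_def J_def by simp
    have "I (\<lambda>p. snd p * Q p * b p + snd p * a p * U p)
        = J (\<lambda>y. snd (R, y) * a (R, y) * b (R, y) - snd (-R, y) * a (-R, y) * b (-R, y))" (is "I ?h2 = _")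
      unfolding I_def J_def
      by (rule integral_square_dx[OF R0, where F = "\<lambda>p. snd p * a p * b p"])
        (auto intro!: continuous_intros c derivative_eq_intros da db simp: algebra_simps)
    then have 2: "I ?h2 = J (\<lambda>y. y * a (R, y) * b (R, y))" by (simp add: left)
    have "I (\<lambda>p. (a p)\<^sup>2 / 2 + snd p * a p * (- G1 p - P p))
        = J (\<lambda>x. snd (x, R) * (a (x, R))\<^sup>2 / 2 - snd (x, -R) * (a (x, -R))\<^sup>2 / 2)" (is "I ?h3 = _")
      unfolding I_def J_def
      by (rule integral_square_dy[OF R0, where F = "\<lambda>p. snd p * (a p)\<^sup>2 / 2"])
        (auto intro!: continuous_intros c derivative_eq_intros ea simp: field_simps)
    then have 3: "I ?h3 = 0" by (simp add: bot J_def)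
    have "I H = I (E w fst snd) + I ?h1 - I ?h2 + I ?h3"
      unfolding H_def by (intro iu has_integral_add has_integral_diff hi) (intro continuous_intros c cE; simp)+
    then show ?thesis using 0 1 2 3 by simp
  qed
  have young: "m * t * x \<le> x\<^sup>2 / 16 + 4 * M\<^sup>2 * t\<^sup>2" if "\<bar>m\<bar> \<le> M" for m t x M :: real
  proof -
    have "m * t * x \<le> x\<^sup>2 / 16 + 4 * (m * t)\<^sup>2" using young0[of 4 "m * t" x] by simp
    moreover have "m\<^sup>2 \<le> M\<^sup>2" using that by (simp add: abs_le_square_iff[symmetric])
    then have "m\<^sup>2 * t\<^sup>2 \<le> M\<^sup>2 * t\<^sup>2" by (intro mult_right_mono) auto
    ultimately show ?thesis by (simp add: power_mult_distrib)
  qed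
  have R4: "(R\<^sup>2)\<^sup>2 = R ^ 4" and R2: "(2 * R)\<^sup>2 = 4 * R\<^sup>2" by (simp_all add: power_mult_distrib)
  have I2: "(Na + Nb) / 4 \<le> I H + R\<^sup>2 * \<Delta> + 32 * R\<^sup>2 * V + 4 * R\<^sup>2 * (4 * R\<^sup>2 * \<Gamma>1 + 4 * R\<^sup>2 * \<Gamma>2)
     + 4 * R ^ 4 * (\<Gamma>1 + \<Gamma>2)"
  proof -
    have "(Na + Nb) / 4 = I (\<lambda>p. (1/4) * (a p)\<^sup>2 + (1/4) * (b p)\<^sup>2)"
    proof -
      have "I (\<lambda>p. (1/4) * (a p)\<^sup>2 + (1/4) * (b p)\<^sup>2) = (1/4) * Na + (1/4) * Nb"
        unfolding Na_def Nb_def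
        by (intro iu has_integral_add has_integral_mult_right hi) (intro continuous_intros c)+
      then show ?thesis by simp
    qed
    also have "\<dots> \<le> I (\<lambda>p. H p + R\<^sup>2 * \<bar>D p\<bar> + (32 * R\<^sup>2) * (v p)\<^sup>2 + (4 * R\<^sup>2) * (G1 p)\<^sup>2 + (4 * R\<^sup>2) * (G2 p)\<^sup>2
       + (4 * R ^ 4) * (g1 p)\<^sup>2 + (4 * R ^ 4) * (g2 p)\<^sup>2)"
      unfolding I_def
    proof (rule integral_le)
      fix p assume "p \<in> square R"
      then have p: "\<bar>fst p\<bar> \<le> R" "\<bar>snd p\<bar> \<le> R"
        using mem_square[of "fst p" "snd p" R] by simp_all
      have "(fst p)\<^sup>2 \<le> R\<^sup>2" "(snd p)\<^sup>2 \<le> R\<^sup>2" using p R by (auto simp: abs_le_square_iff[symmetric])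
      then have w: "0 \<le> w p" "w p \<le> R\<^sup>2" by (auto simp: w_def)
      have "(a p)\<^sup>2 / 2 + (b p)\<^sup>2 / 2 = H p - w p * (v p)\<^sup>2 + w p * (- D p) + (- (2 * fst p)) * v p * b p + (2 * snd p) * v p * a p
         + snd p * G1 p * a p + (- fst p) * G2 p * a p + w p * g1 p * b p + (- w p) * g2 p * a p"
        by (simp add: H_def E_def D_def g1_def g2_def v_def field_simps power2_eq_square)
      moreover have "0 \<le> w p * (v p)\<^sup>2" using w by simp
      moreover have "w p * (- D p) \<le> R\<^sup>2 * \<bar>D p\<bar>" 
        using w by (intro order_trans[OF mult_left_mono[of _ "\<bar>D p\<bar>"] mult_right_mono]) auto
      moreover have "(- (2 * fst p)) * v p * b p \<le> (b p)\<^sup>2 / 16 + 4 * (2 * R)\<^sup>2 * (v p)\<^sup>2" using p by (intro young) auto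
      moreover have "(2 * snd p) * v p * a p \<le> (a p)\<^sup>2 / 16 + 4 * (2 * R)\<^sup>2 * (v p)\<^sup>2" using p by (intro young) auto
      moreover have "snd p * G1 p * a p \<le> (a p)\<^sup>2 / 16 + 4 * R\<^sup>2 * (G1 p)\<^sup>2" using p by (intro young) auto
      moreover have "(- fst p) * G2 p * a p \<le> (a p)\<^sup>2 / 16 + 4 * R\<^sup>2 * (G2 p)\<^sup>2" using p by (intro young) auto
      moreover have "w p * g1 p * b p \<le> (b p)\<^sup>2 / 16 + 4 * (R\<^sup>2)\<^sup>2 * (g1 p)\<^sup>2" using w by (intro young) auto
      moreover have "(- w p) * g2 p * a p \<le> (a p)\<^sup>2 / 16 + 4 * (R\<^sup>2)\<^sup>2 * (g2 p)\<^sup>2" using w by (intro young) auto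
      ultimately have "(a p)\<^sup>2 / 2 + (b p)\<^sup>2 / 2 \<le> H p + R\<^sup>2 * \<bar>D p\<bar> + 2 * ((b p)\<^sup>2 / 16) + 4 * ((a p)\<^sup>2 / 16)
         + 2 * (4 * (2 * R)\<^sup>2 * (v p)\<^sup>2) + 4 * R\<^sup>2 * (G1 p)\<^sup>2 + 4 * R\<^sup>2 * (G2 p)\<^sup>2
         + 4 * (R\<^sup>2)\<^sup>2 * (g1 p)\<^sup>2 + 4 * (R\<^sup>2)\<^sup>2 * (g2 p)\<^sup>2"
        by linarith
      then show "(1/4) * (a p)\<^sup>2 + (1/4) * (b p)\<^sup>2 \<le> H p + R\<^sup>2 * \<bar>D p\<bar> + (32 * R\<^sup>2) * (v p)\<^sup>2 + (4 * R\<^sup>2) * (G1 p)\<^sup>2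
         + (4 * R\<^sup>2) * (G2 p)\<^sup>2 + (4 * R ^ 4) * (g1 p)\<^sup>2 + (4 * R ^ 4) * (g2 p)\<^sup>2"
        using R4 R2 zero_le_power2[of "a p"] zero_le_power2[of "b p"] unfolding R4 R2 by linarith
    qed (intro I_intros cH)+
    also have "\<dots> = I H + R\<^sup>2 * \<Delta> + (32 * R\<^sup>2) * V + (4 * R\<^sup>2) * I (\<lambda>p. (G1 p)\<^sup>2) + (4 * R\<^sup>2) * I (\<lambda>p. (G2 p)\<^sup>2)
       + (4 * R ^ 4) * \<Gamma>1 + (4 * R ^ 4) * \<Gamma>2"
      unfolding \<Delta>_def V_def \<Gamma>1_def \<Gamma>2_def
      by (intro iu has_integral_add has_integral_mult_right hi) (intro continuous_intros c cH)+
    also have "\<dots> \<le> I H + R\<^sup>2 * \<Delta> + (32 * R\<^sup>2) * V + (4 * R\<^sup>2) * (4 * R\<^sup>2 * \<Gamma>1) + (4 * R\<^sup>2) * (4 * R\<^sup>2 * \<Gamma>2)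
       + (4 * R ^ 4) * \<Gamma>1 + (4 * R ^ 4) * \<Gamma>2"
      using IG by (intro add_mono mult_left_mono order.refl) auto
    finally show ?thesis by (simp add: algebra_simps)
  qed
  have I3: "I H \<le> 10 * R ^ 4 * (\<Gamma>1 + \<Gamma>2)"
  proof -
    have "J (\<lambda>y. w (R, y) * a (R, y) * G2 (R, y)) - J (\<lambda>y. y * a (R, y) * b (R, y))
       = J (\<lambda>y. w (R, y) * a (R, y) * G2 (R, y) - y * a (R, y) * b (R, y))"
      unfolding J_def
      by (intro integral_diff[symmetric] integrable_continuous_real continuous_intros cR' cR[OF cw])
    also have "\<dots> \<le> J (\<lambda>y. (R / 4 + R / 2) * (a (R, y))\<^sup>2 + (R / 2) * (b (R, y))\<^sup>2 + R ^ 3 * (G2 (R, y))\<^sup>2)"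
      unfolding J_def
    proof (rule integral_le)
      fix y assume y: "y \<in> {-R..R}"
      have "y\<^sup>2 \<le> R\<^sup>2" using y by (auto simp: abs_le_square_iff[symmetric])
      then have w: "0 \<le> w (R, y)" "w (R, y) \<le> R\<^sup>2" by (auto simp: w_def)
      have "w (R, y) * (a (R, y) * G2 (R, y)) \<le> w (R, y) * ((1 / (4 * R)) * (a (R, y))\<^sup>2 + (G2 (R, y))\<^sup>2 / (4 * (1 / (4 * R))))"
        using R by (intro mult_left_mono young0 w) auto
      also have "\<dots> \<le> R\<^sup>2 * ((1 / (4 * R)) * (a (R, y))\<^sup>2 + (G2 (R, y))\<^sup>2 / (4 * (1 / (4 * R))))"
        using R by (intro mult_right_mono w add_nonneg_nonneg) auto
      also have "\<dots> = (R / 4) * (a (R, y))\<^sup>2 + R ^ 3 * (G2 (R, y))\<^sup>2"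
        using R by (simp add: power2_eq_square power3_eq_cube field_simps)
      finally have 1: "w (R, y) * (a (R, y) * G2 (R, y)) \<le> (R / 4) * (a (R, y))\<^sup>2 + R ^ 3 * (G2 (R, y))\<^sup>2" .
      have "(- y) * (a (R, y) * b (R, y)) \<le> \<bar>y\<bar> * \<bar>a (R, y) * b (R, y)\<bar>"
        by (metis abs_ge_self abs_minus_cancel abs_mult)
      also have "\<dots> \<le> R * ((1/2) * (a (R, y))\<^sup>2 + (1/2) * (b (R, y))\<^sup>2)"
        using y young0[of "1/2" "\<bar>a (R, y)\<bar>" "\<bar>b (R, y)\<bar>"] by (intro mult_mono) (auto simp: abs_mult)
      finally have 2: "(- y) * (a (R, y) * b (R, y)) \<le> (R/2) * (a (R, y))\<^sup>2 + (R/2) * (b (R, y))\<^sup>2"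
        by (simp add: algebra_simps)
      show "w (R, y) * a (R, y) * G2 (R, y) - y * a (R, y) * b (R, y)
         \<le> (R / 4 + R / 2) * (a (R, y))\<^sup>2 + (R / 2) * (b (R, y))\<^sup>2 + R ^ 3 * (G2 (R, y))\<^sup>2"
        using 1 2 unfolding distrib_right by (simp add: mult.assoc)
    qed (intro integrable_continuous_real continuous_intros cR' cR[OF cw])+
    also have "\<dots> = (R / 4 + R / 2) * Ja + (R / 2) * Jb + R ^ 3 * JG"
      unfolding Ja_def Jb_def JG_def
      by (intro ju has_integral_add has_integral_mult_right hj) (intro continuous_intros cR')+
    finally have "I H \<le> (R / 4 + R / 2) * Ja + R * Jb + R ^ 3 * JG"
      unfolding IH by (simp add: algebra_simps)
    also have "\<dots> \<le> (R / 4 + R / 2) * (8 * R ^ 3 * \<Gamma>1) + R * (8 * R ^ 3 * \<Gamma>2) + R ^ 3 * (2 * R * \<Gamma>2)"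
      using R Ja Jb JG by (intro add_mono mult_left_mono) auto
    also have "\<dots> = 6 * (R ^ 4 * \<Gamma>1) + 10 * (R ^ 4 * \<Gamma>2)" by (simp add: power3_eq_cube power4_eq_xxxx)
    also have "\<dots> \<le> 10 * (R ^ 4 * \<Gamma>1) + 10 * (R ^ 4 * \<Gamma>2)" using nonneg by simp
    finally show ?thesis by (simp add: algebra_simps)
  qed
  have "(Na + Nb) / 4 \<le> R\<^sup>2 * (\<Delta> + 32 * V + 30 * R\<^sup>2 * (\<Gamma>1 + \<Gamma>2))"
    using I2 I3 by (simp add: power2_eq_square power4_eq_xxxx algebra_simps)
  then have "(Na + Nb) / (256 * R\<^sup>2) \<le> (\<Delta> + 32 * V + 30 * R\<^sup>2 * (\<Gamma>1 + \<Gamma>2)) / 64"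
    using R by (simp add: field_simps)
  with I1 J1 have "V \<le> 3 * \<Delta> + 134 * (R\<^sup>2 * (\<Gamma>1 + \<Gamma>2))"
  proof -
    assume *: "(Na + Nb) / (256 * R\<^sup>2) \<le> (\<Delta> + 32 * V + 30 * R\<^sup>2 * (\<Gamma>1 + \<Gamma>2)) / 64"
    define z where "z = R\<^sup>2 * (\<Gamma>1 + \<Gamma>2)"
    have z: "0 \<le> z" using nonneg by (simp add: z_def)
    have "V \<le> 2 * z + \<Delta> + (\<Delta> + 32 * V + 30 * z) / 64 + 64 * z"
      using I1 J1 * unfolding mult.assoc z_def[symmetric] by linarith
    then have "64 * V \<le> 128 * z + 64 * \<Delta> + \<Delta> + 32 * V + 30 * z + 4096 * z"
      by (simp add: field_simps)
    moreover have "V \<ge> 0" "\<Delta> \<ge> 0" using nonneg by auto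
    ultimately have "V \<le> 3 * \<Delta> + 134 * z" using z by linarith
    then show ?thesis by (simp add: z_def)
  qed
  moreover have "I (\<lambda>p. (P' p + Q' p)\<^sup>2 + (S' p + U' p)\<^sup>2) = \<Gamma>1 + \<Gamma>2"
    unfolding \<Gamma>1_def \<Gamma>2_def g1_def g2_def power2_minus
    by (intro iu has_integral_add hi) (intro continuous_intros c)+
  ultimately show ?thesis
    unfolding V_def \<Delta>_def D_def v_def I_def by simp
qed


section \<open>Mollification in the plane\<close>
lemma vector_2_nth [simp]: "(vector [x, y] :: real^2) $ 1 = x" "(vector [x, y] :: real^2) $ 2 = y"
  by (simp_all add: vector_2)

lemma Basis_real2: "(Basis :: (real^2) set) = {axis 1 1, axis 2 1}"
  by (auto simp: Basis_vec_def UNIV_2)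

lemma measurable_vector_2 [measurable]:
  "(\<lambda>p. vector [fst p, snd p] :: real^2) \<in> borel_measurable borel"
proof (rule borel_measurable_continuous_onI)
  show "continuous_on UNIV (\<lambda>p. vector [fst p, snd p] :: real^2)"
  proof -
    have *: "(\<lambda>p. vector [fst p, snd p] :: real^2) = (\<lambda>p. fst p *\<^sub>R axis 1 1 + snd p *\<^sub>R axis 2 1)"
      by (auto simp: vec_eq_iff forall_2 axis_def)
    show ?thesis by (subst *) (intro continuous_intros)
  qed
qed

lemma lborel_plane: "(lborel :: (real^2) measure) = distr lborel borel (\<lambda>p. vector [fst p, snd p])"
proof (rule lborel_eqI)
  fix l u :: "real^2" assume lu: "\<And>b. b \<in> Basis \<Longrightarrow> l \<bullet> b \<le> u \<bullet> b"
  have v: "(\<lambda>p. vector [fst p, snd p]) -` box l u = box (l $ 1, l $ 2) (u $ 1, u $ 2)"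
    by (auto simp: box_def Basis_real2 inner_axis Basis_prod_def)
  have "emeasure (distr lborel borel (\<lambda>p. vector [fst p, snd p] :: real^2)) (box l u)
      = emeasure lborel (box (l $ 1, l $ 2) (u $ 1, u $ 2))"
    by (subst emeasure_distr) (auto simp: v)
  also have "\<dots> = (\<Prod>b\<in>Basis. ((u $ 1, u $ 2) - (l $ 1, l $ 2)) \<bullet> b)"
    using lu[of "axis 1 1"] lu[of "axis 2 1"]
    by (subst emeasure_lborel_box) (auto simp: Basis_prod_def Basis_real2 inner_axis)
  also have "\<dots> = (\<Prod>b\<in>Basis. (u - l) \<bullet> b)"
    by (simp add: Basis_prod_def Basis_real2 inner_axis axis_eq_axis mult.commute)
  finally show "emeasure (distr lborel borel (\<lambda>p. vector [fst p, snd p] :: real^2)) (box l u)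
      = (\<Prod>b\<in>Basis. (u - l) \<bullet> b)" .
qed simp

lemma integral_plane:
  fixes f :: "real^2 \<Rightarrow> real"
  assumes "f \<in> borel_measurable borel"
  shows "(LINT z|lborel. f z) = (LINT p|lborel. f (vector [fst p, snd p]))"
    and "integrable lborel f \<longleftrightarrow> integrable lborel (\<lambda>p. f (vector [fst p, snd p]))"
proof -
  show "(LINT z|lborel. f z) = (LINT p|lborel. f (vector [fst p, snd p]))"
    using assms by (subst lborel_plane) (rule integral_distr; simp)
  show "integrable lborel f \<longleftrightarrow> integrable lborel (\<lambda>p. f (vector [fst p, snd p]))"
    using assms by (subst lborel_plane) (rule integrable_distr_eq; simp)
qed

lemma integral_plane_product:
  fixes u v :: "real \<Rightarrow> real"
  assumes u: "integrable lborel u" and v: "integrable lborel v"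
  shows "integrable lborel (\<lambda>z::real^2. u (z $ 1) * v (z $ 2))"
    and "(LINT z|lborel. u ((z::real^2) $ 1) * v (z $ 2)) = (LINT x|lborel. u x) * (LINT y|lborel. v y)"
proof -
  have m[measurable]: "u \<in> borel_measurable borel" "v \<in> borel_measurable borel"
    using u v by auto
  have m2: "(\<lambda>z::real^2. u (z $ 1) * v (z $ 2)) \<in> borel_measurable borel"
    by measurable
  have i: "integrable (lborel \<Otimes>\<^sub>M lborel) (\<lambda>p. u (fst p) * v (snd p))"
  proof (rule lborel_pair.Fubini_integrable)
    show "integrable lborel (\<lambda>x. \<integral>y. norm (u (fst (x, y)) * v (snd (x, y))) \<partial>lborel)"
      using u v by (simp add: abs_mult)
    show "AE x in lborel. integrable lborel (\<lambda>y. u (fst (x, y)) * v (snd (x, y)))"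
      using v by simp
  qed measurable
  then show "integrable lborel (\<lambda>z::real^2. u (z $ 1) * v (z $ 2))"
    using integral_plane(2)[OF m2] by (simp add: lborel_prod)
  have "(LINT z|lborel. u ((z::real^2) $ 1) * v (z $ 2)) = (LINT p|(lborel \<Otimes>\<^sub>M lborel). u (fst p) * v (snd p))"
    using integral_plane(1)[OF m2] by (simp add: lborel_prod)
  also have "\<dots> = (LINT x|lborel. (LINT y|lborel. u x * v y))"
    using lborel_pair.integral_fst'[OF i] by simp
  also have "\<dots> = (LINT x|lborel. u x) * (LINT y|lborel. v y)"
    by simp
  finally show "(LINT z|lborel. u ((z::real^2) $ 1) * v (z $ 2)) = (LINT x|lborel. u x) * (LINT y|lborel. v y)" .
qed

lemma integral_square_plane:
  fixes F :: "real \<times> real \<Rightarrow> real"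
  assumes c: "continuous_on UNIV F"
  shows "integral (cbox (-R, -R) (R, R)) F
     = (LINT z|lborel. indicator {z::real^2. \<bar>z $ 1\<bar> \<le> R \<and> \<bar>z $ 2\<bar> \<le> R} z * F (z $ 1, z $ 2))"
proof -
  have [measurable]: "F \<in> borel_measurable borel" by (rule borel_measurable_continuous_onI[OF c])
  have m: "{z::real^2. \<bar>z $ 1\<bar> \<le> R \<and> \<bar>z $ 2\<bar> \<le> R} \<in> sets borel" by measurable
  have "set_integrable lborel (cbox (-R, -R) (R, R)) F"
    unfolding set_integrable_def
    by (intro borel_integrable_compact compact_cbox continuous_on_subset[OF c]) auto
  then have "integral (cbox (-R, -R) (R, R)) F = (LINT p|lborel. indicator (cbox (-R, -R) (R, R)) p * F p)"
    by (simp add: set_borel_integral_eq_integral(2)[symmetric] set_lebesgue_integral_def)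
  also have "\<dots> = (LINT p|lborel. indicator {z::real^2. \<bar>z $ 1\<bar> \<le> R \<and> \<bar>z $ 2\<bar> \<le> R} (vector [fst p, snd p]) * F (fst p, snd p))"
    by (rule Bochner_Integration.integral_cong) (auto simp: indicator_def cbox_Pair_eq)
  also have "\<dots> = (LINT z|lborel. indicator {z::real^2. \<bar>z $ 1\<bar> \<le> R \<and> \<bar>z $ 2\<bar> \<le> R} z * F (z $ 1, z $ 2))"
    using m by (subst integral_plane(1)) auto
  finally show ?thesis .
qed

lemma has_real_derivative_integral:
  fixes f f' :: "real \<Rightarrow> 'a \<Rightarrow> real"
  assumes i: "\<And>s. integrable M (f s)" and m: "f' x \<in> borel_measurable M"
    and d: "\<And>s z. ((\<lambda>s. f s z) has_real_derivative f' s z) (at s)"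
    and b: "\<And>s z. \<bar>f' s z\<bar> \<le> w z" and w: "integrable M w"
  shows "((\<lambda>s. LINT z|M. f s z) has_real_derivative (LINT z|M. f' x z)) (at x)"
  unfolding DERIV_def
proof (unfold tendsto_at_iff_sequentially, safe)
  fix h :: "nat \<Rightarrow> real" assume h0: "\<forall>i. h i \<in> UNIV - {0}" and h: "h \<longlonglongrightarrow> 0"
  have eq: "((LINT z|M. f (x + h n) z) - (LINT z|M. f x z)) / h n = (LINT z|M. (f (x + h n) z - f x z) / h n)" for n
    using i by simp
  have "(\<lambda>n. LINT z|M. (f (x + h n) z - f x z) / h n) \<longlonglongrightarrow> (LINT z|M. f' x z)"
  proof (rule integral_dominated_convergence[OF m _ w])
    show "(\<lambda>z. (f (x + h n) z - f x z) / h n) \<in> borel_measurable M" for n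
      using i by (intro borel_measurable_divide borel_measurable_diff) auto
    show "AE z in M. (\<lambda>n. (f (x + h n) z - f x z) / h n) \<longlonglongrightarrow> f' x z"
    proof (rule AE_I2)
      fix z
      have "((\<lambda>h. (f (x + h) z - f x z) / h) \<longlongrightarrow> f' x z) (at 0)"
        using d[where s = x and z = z] by (simp add: DERIV_def)
      then show "(\<lambda>n. (f (x + h n) z - f x z) / h n) \<longlonglongrightarrow> f' x z"
        using h0 h by (auto simp: tendsto_at_iff_sequentially o_def)
    qed
    show "AE z in M. norm ((f (x + h n) z - f x z) / h n) \<le> w z" for n
    proof (rule AE_I2)
      fix z
      have "norm (f (x + h n) z - f x z) \<le> w z * norm (x + h n - x)"
        by (rule field_differentiable_bound[of UNIV "\<lambda>s. f s z" "\<lambda>s. f' s z"]) (use d b in auto)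
      then show "norm ((f (x + h n) z - f x z) / h n) \<le> w z"
        using h0 by (simp add: divide_le_eq)
    qed
  qed
  then show "((\<lambda>y. ((LINT z|M. f (x + y) z) - (LINT z|M. f x z)) / y) \<circ> h) \<longlonglongrightarrow> (LINT z|M. f' x z)"
    by (simp add: o_def eq)
qed

lemma continuous_on_integral:
  fixes f :: "'b::metric_space \<Rightarrow> 'a \<Rightarrow> real"
  assumes m: "\<And>p. f p \<in> borel_measurable M"
    and c: "\<And>z. continuous_on UNIV (\<lambda>p. f p z)"
    and b: "\<And>p z. \<bar>f p z\<bar> \<le> w z" and w: "integrable M w"
  shows "continuous_on UNIV (\<lambda>p. LINT z|M. f p z)"
  unfolding continuous_on_sequentially
proof safe
  fix p and q :: "nat \<Rightarrow> 'b" assume q: "q \<longlonglongrightarrow> p"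
  have "(\<lambda>n. LINT z|M. f (q n) z) \<longlonglongrightarrow> (LINT z|M. f p z)"
  proof (rule integral_dominated_convergence[OF m m w])
    show "AE z in M. (\<lambda>n. f (q n) z) \<longlonglongrightarrow> f p z"
      using c q by (auto simp: continuous_on_sequentially o_def)
  qed (use b in auto)
  then show "((\<lambda>p. LINT z|M. f p z) \<circ> q) \<longlonglongrightarrow> (LINT z|M. f p z)" by (simp add: o_def)
qed

text \<open>
  A bump function of mass 1 that is once continuously differentiable; one derivative is all that the
  estimate for smooth tensors uses.
\<close>

definition kern :: "real \<Rightarrow> real" where "kern t = 15 / 16 * (max 0 (1 - t\<^sup>2))\<^sup>2"
definition kern' :: "real \<Rightarrow> real" where "kern' t = - (15 / 4) * t * max 0 (1 - t\<^sup>2)"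

lemma kern_0: "1 \<le> \<bar>t\<bar> \<Longrightarrow> kern t = 0"
  using abs_le_square_iff[of 1 t] by (simp add: kern_def max_def)

lemma kern_bounds: "0 \<le> kern t" "kern t \<le> 1" "\<bar>kern' t\<bar> \<le> 4"
proof -
  show "0 \<le> kern t" by (simp add: kern_def)
  have "max 0 (1 - t\<^sup>2) \<le> 1" by simp
  then have "(max 0 (1 - t\<^sup>2))\<^sup>2 \<le> 1" by (simp add: power_le_one)
  then show "kern t \<le> 1" unfolding kern_def by linarith
  show "\<bar>kern' t\<bar> \<le> 4"
  proof (cases "1 \<le> \<bar>t\<bar>")
    case True
    then have "max 0 (1 - t\<^sup>2) = 0" using abs_le_square_iff[of 1 t] by simp
    then show ?thesis by (simp add: kern'_def)
  next
    case False
    then have "\<bar>t\<bar> * max 0 (1 - t\<^sup>2) \<le> 1 * 1" by (intro mult_mono) auto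
    moreover have "\<bar>kern' t\<bar> = 15 / 4 * (\<bar>t\<bar> * max 0 (1 - t\<^sup>2))" by (simp add: kern'_def abs_mult)
    ultimately show ?thesis by simp
  qed
qed

lemma kern_deriv: "(kern has_real_derivative kern' t) (at t)"
proof -
  have *: "((\<lambda>u. (max 0 u)\<^sup>2) has_real_derivative 2 * max 0 u) (at u)" for u :: real
  proof -
    consider "u < 0" | "u = 0" | "0 < u" by linarith
    then show ?thesis
    proof cases
      case 1
      have "((\<lambda>u::real. 0) has_real_derivative 2 * max 0 u) (at u)" using 1 by simp
      then show ?thesis
        by (rule has_field_derivative_transform_within_open[where S = "{..<0}"]) (use 1 in auto)
    next
      case 3
      have "((\<lambda>u::real. u\<^sup>2) has_real_derivative 2 * max 0 u) (at u)"
        using 3 by (auto intro!: derivative_eq_intros)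
      then show ?thesis
        by (rule has_field_derivative_transform_within_open[where S = "{0<..}"]) (use 3 in auto)
    next
      case 2
      have "((\<lambda>h::real. (max 0 h)\<^sup>2 / h) \<longlongrightarrow> 0) (at 0)"
      proof (rule tendsto_rabs_zero_cancel, rule tendsto_sandwich[of "\<lambda>_. 0" _ _ "\<lambda>h. \<bar>h\<bar>"])
        show "\<forall>\<^sub>F h in at 0. \<bar>(max 0 h)\<^sup>2 / h\<bar> \<le> \<bar>h::real\<bar>"
          by (rule always_eventually) (auto simp: max_def power2_eq_square)
        show "((\<lambda>h::real. \<bar>h\<bar>) \<longlongrightarrow> 0) (at 0)" by (rule tendsto_eq_intros refl | simp)+
      qed auto
      then show ?thesis using 2 by (simp add: DERIV_def)
    qed
  qed
  have "((\<lambda>t. (max 0 (1 - t\<^sup>2))\<^sup>2) has_real_derivative (2 * max 0 (1 - t\<^sup>2)) * (- 2 * t)) (at t)"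
    by (rule DERIV_chain2[OF *]) (auto intro!: derivative_eq_intros)
  then have "((\<lambda>t. 15 / 16 * (max 0 (1 - t\<^sup>2))\<^sup>2) has_real_derivative 15 / 16 * ((2 * max 0 (1 - t\<^sup>2)) * (- 2 * t))) (at t)"
    by (rule DERIV_cmult)
  then show ?thesis by (simp add: kern_def[abs_def] kern'_def mult_ac)
qed

lemma kern_cont: "continuous_on S kern" "continuous_on S kern'"
  unfolding kern_def[abs_def] kern'_def[abs_def] by (intro continuous_intros)+

lemma kern_measurable [measurable]: "kern \<in> borel_measurable borel" "kern' \<in> borel_measurable borel"
  by (intro borel_measurable_continuous_onI kern_cont)+

lemma kern_integral: "integrable lborel kern" "(LINT t|lborel. kern t) = 1"
proof -
  have eq: "kern = (\<lambda>t. 15 / 16 * (1 - t\<^sup>2)\<^sup>2 * indicator {-1..1} t)"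
  proof
    fix t :: real
    show "kern t = 15 / 16 * (1 - t\<^sup>2)\<^sup>2 * indicator {-1..1} t"
    proof (cases "1 \<le> \<bar>t\<bar>")
      case True
      then have "t = 1 \<or> t = -1 \<or> t \<notin> {-1..1}" by auto
      then show ?thesis using kern_0[OF True] by (auto simp: indicator_def)
    next
      case False
      then have "t\<^sup>2 \<le> 1" using abs_le_square_iff[of t 1] by simp
      then show ?thesis using False by (auto simp: kern_def indicator_def max_def)
    qed
  qed
  let ?F = "\<lambda>t::real. 15 / 16 * (t - 2 / 3 * t ^ 3 + t ^ 5 / 5)"
  have "has_bochner_integral lborel (\<lambda>t. 15 / 16 * (1 - t\<^sup>2)\<^sup>2 * indicator {-1..1} t) (?F 1 - ?F (-1))"
    by (rule has_bochner_integral_FTC_Icc_real)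
      (auto intro!: derivative_eq_intros continuous_intros simp: power2_eq_square power4_eq_xxxx algebra_simps)
  then have "has_bochner_integral lborel kern 1" unfolding eq by simp
  then show "integrable lborel kern" "(LINT t|lborel. kern t) = 1"
    by (auto simp: has_bochner_integral_iff)
qed

definition kern_n :: "nat \<Rightarrow> real \<Rightarrow> real" where "kern_n n t = real (Suc n) * kern (real (Suc n) * t)"
definition kern_n' :: "nat \<Rightarrow> real \<Rightarrow> real" where "kern_n' n t = (real (Suc n))\<^sup>2 * kern' (real (Suc n) * t)"

lemma kern_n_props:
  shows kern_n_0: "1 \<le> real (Suc n) * \<bar>t\<bar> \<Longrightarrow> kern_n n t = 0"
    and kern_n_nonneg: "0 \<le> kern_n n t" and kern_n_le: "\<bar>kern_n n t\<bar> \<le> real (Suc n)"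
    and kern_n'_le: "\<bar>kern_n' n t\<bar> \<le> 4 * (real (Suc n))\<^sup>2"
    and kern_n_deriv: "(kern_n n has_real_derivative kern_n' n t) (at t)"
    and kern_n_cont: "continuous_on S (kern_n n)" "continuous_on S (kern_n' n)"
    and kern_n_measurable [measurable]: "kern_n n \<in> borel_measurable borel" "kern_n' n \<in> borel_measurable borel"
    and kern_n_integral: "integrable lborel (\<lambda>t. kern_n n (x - t))" "(LINT t|lborel. kern_n n (x - t)) = 1"
proof -
  show "kern_n n t = 0" if "1 \<le> real (Suc n) * \<bar>t\<bar>"
    unfolding kern_n_def using that by (subst kern_0) (auto simp: abs_mult)
  show "0 \<le> kern_n n t" "\<bar>kern_n n t\<bar> \<le> real (Suc n)"
    unfolding kern_n_def using kern_bounds[of "real (Suc n) * t"] by (auto simp: abs_mult mult_left_le)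
  show "\<bar>kern_n' n t\<bar> \<le> 4 * (real (Suc n))\<^sup>2"
    unfolding kern_n'_def using kern_bounds(3)[of "real (Suc n) * t"]
    by (simp add: abs_mult del: of_nat_Suc)
  show "(kern_n n has_real_derivative kern_n' n t) (at t)"
    unfolding kern_n_def[abs_def] kern_n'_def
    by (auto intro!: derivative_eq_intros DERIV_chain2[OF kern_deriv] simp: power2_eq_square simp del: of_nat_Suc)
  show c: "continuous_on S (kern_n n)" "continuous_on S (kern_n' n)" for S
    unfolding kern_n_def[abs_def] kern_n'_def[abs_def]
    by (intro continuous_intros continuous_on_compose2[OF kern_cont(1)[of UNIV]]
      continuous_on_compose2[OF kern_cont(2)[of UNIV]] subset_UNIV)+
  show "kern_n n \<in> borel_measurable borel" "kern_n' n \<in> borel_measurable borel"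
    by (intro borel_measurable_continuous_onI c)+
  have "has_bochner_integral lborel kern 1" using kern_integral by (simp add: has_bochner_integral_iff)
  have eq: "(\<lambda>t. kern (real (Suc n) * x + (- real (Suc n)) * t)) = (\<lambda>t. kern (real (Suc n) * (x - t)))"
    by (simp add: right_diff_distrib del: of_nat_Suc)
  have "integrable lborel (\<lambda>t. kern (real (Suc n) * x + (- real (Suc n)) * t))"
    by (rule lborel_integrable_real_affine[OF kern_integral(1)]) simp
  then have i: "integrable lborel (\<lambda>t. kern (real (Suc n) * (x - t)))"
    unfolding eq .
  then show "integrable lborel (\<lambda>t. kern_n n (x - t))"
    unfolding kern_n_def by (rule integrable_mult_right)
  have "(LINT t|lborel. kern t) = \<bar>- real (Suc n)\<bar> *\<^sub>R (LINT t|lborel. kern (real (Suc n) * x + (- real (Suc n)) * t))"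
    by (rule lborel_integral_real_affine) simp
  also note eq
  finally have "real (Suc n) * (LINT t|lborel. kern (real (Suc n) * (x - t))) = 1"
    using kern_integral(2) by (simp del: of_nat_Suc)
  then show "(LINT t|lborel. kern_n n (x - t)) = 1"
    unfolding kern_n_def by (simp del: of_nat_Suc)
qed

text \<open>
  The kernel is a product, so that differentiation and testing act on one coordinate at a time.
\<close>

definition mollify :: "nat \<Rightarrow> (real^2 \<Rightarrow> real) \<Rightarrow> real \<times> real \<Rightarrow> real" where
  "mollify n F p = (LINT z|lborel. F z * (kern_n n (fst p - z $ 1) * kern_n n (snd p - z $ 2)))"

definition mollify_dx :: "nat \<Rightarrow> (real^2 \<Rightarrow> real) \<Rightarrow> real \<times> real \<Rightarrow> real" where
  "mollify_dx n F p = (LINT z|lborel. F z * (kern_n' n (fst p - z $ 1) * kern_n n (snd p - z $ 2)))"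

definition mollify_dy :: "nat \<Rightarrow> (real^2 \<Rightarrow> real) \<Rightarrow> real \<times> real \<Rightarrow> real" where
  "mollify_dy n F p = (LINT z|lborel. F z * (kern_n n (fst p - z $ 1) * kern_n' n (snd p - z $ 2)))"

lemma integrable_times_bounded:
  fixes F h :: "'a \<Rightarrow> real"
  assumes F: "integrable M F" and h: "h \<in> borel_measurable M" "\<And>z. \<bar>h z\<bar> \<le> K"
  shows "integrable M (\<lambda>z. F z * h z)"
proof (rule Bochner_Integration.integrable_bound[OF integrable_mult_left[OF F, of K]])
  show "AE z in M. norm (F z * h z) \<le> norm (F z * K)"
  proof (rule AE_I2)
    fix z
    have "\<bar>h z\<bar> \<le> \<bar>K\<bar>" using h(2)[of z] by linarith
    then show "norm (F z * h z) \<le> norm (F z * K)" by (simp add: abs_mult mult_left_mono)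
  qed
qed (use F h in measurable)

lemma continuous_on_integral_kernel:
  fixes F :: "'a \<Rightarrow> real" and k :: "'b::metric_space \<Rightarrow> 'a \<Rightarrow> real"
  assumes F: "integrable M F" and k: "\<And>p. k p \<in> borel_measurable M"
    and c: "\<And>z. continuous_on UNIV (\<lambda>p. k p z)" and b: "\<And>p z. \<bar>k p z\<bar> \<le> K"
  shows "continuous_on UNIV (\<lambda>p. LINT z|M. F z * k p z)"
proof (rule continuous_on_integral[where w = "\<lambda>z. \<bar>F z\<bar> * K"])
  show "(\<lambda>z. F z * k p z) \<in> borel_measurable M" for p
    using F k by (intro borel_measurable_times) auto
  show "continuous_on UNIV (\<lambda>p. F z * k p z)" for z
    by (intro continuous_intros c)
  show "\<bar>F z * k p z\<bar> \<le> \<bar>F z\<bar> * K" for p z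
    unfolding abs_mult by (intro mult_left_mono b) simp
  show "integrable M (\<lambda>z. \<bar>F z\<bar> * K)" using F by simp
qed

lemma kern_bounds2:
  "\<bar>kern_n n s * kern_n n t\<bar> \<le> real (Suc n) * real (Suc n)"
  "\<bar>kern_n' n s * kern_n n t\<bar> \<le> (4 * (real (Suc n))\<^sup>2) * real (Suc n)"
  "\<bar>kern_n n s * kern_n' n t\<bar> \<le> real (Suc n) * (4 * (real (Suc n))\<^sup>2)"
  unfolding abs_mult by (intro mult_mono kern_n_le kern_n'_le; simp)+

lemma shift: "((\<lambda>s. kern_n n (s - c)) has_real_derivative kern_n' n (s - c)) (at s)"
proof -
  have "((\<lambda>s. s - c) has_real_derivative 1) (at s)" by (auto intro!: derivative_eq_intros)
  from DERIV_chain2[OF kern_n_deriv this] show ?thesis by simp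
qed

lemma shift_cont:
  fixes f :: "real \<times> real \<Rightarrow> real"
  assumes "continuous_on UNIV f"
  shows "continuous_on UNIV (\<lambda>p. kern_n n (f p))" "continuous_on UNIV (\<lambda>p. kern_n' n (f p))"
  by (rule continuous_on_compose2[OF kern_n_cont(1) assms subset_UNIV],
      rule continuous_on_compose2[OF kern_n_cont(2) assms subset_UNIV])

context
  fixes F :: "real^2 \<Rightarrow> real"
  assumes F: "integrable lborel F"
begin

lemma mollify_continuous: "continuous_on UNIV (mollify n F)"
  and mollify_dx_continuous: "continuous_on UNIV (mollify_dx n F)"
  and mollify_dy_continuous: "continuous_on UNIV (mollify_dy n F)"
proof -
  show "continuous_on UNIV (mollify n F)" unfolding mollify_def[abs_def]
  proof (rule continuous_on_integral_kernel[where K = "real (Suc n) * real (Suc n)", OF F])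
    show "continuous_on UNIV (\<lambda>p. kern_n n (fst p - z $ 1) * kern_n n (snd p - z $ 2))" for z :: "real^2"
      by (intro continuous_on_mult shift_cont continuous_intros)
  qed (measurable, rule kern_bounds2)
  show "continuous_on UNIV (mollify_dx n F)" unfolding mollify_dx_def[abs_def]
  proof (rule continuous_on_integral_kernel[where K = "(4 * (real (Suc n))\<^sup>2) * real (Suc n)", OF F])
    show "continuous_on UNIV (\<lambda>p. kern_n' n (fst p - z $ 1) * kern_n n (snd p - z $ 2))" for z :: "real^2"
      by (intro continuous_on_mult shift_cont continuous_intros)
  qed (measurable, rule kern_bounds2)
  show "continuous_on UNIV (mollify_dy n F)" unfolding mollify_dy_def[abs_def]
  proof (rule continuous_on_integral_kernel[where K = "real (Suc n) * (4 * (real (Suc n))\<^sup>2)", OF F])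
    show "continuous_on UNIV (\<lambda>p. kern_n n (fst p - z $ 1) * kern_n' n (snd p - z $ 2))" for z :: "real^2"
      by (intro continuous_on_mult shift_cont continuous_intros)
  qed (measurable, rule kern_bounds2)
qed

lemma mollify_deriv_x: "((\<lambda>s. mollify n F (s, y)) has_real_derivative mollify_dx n F (x, y)) (at x)"
  unfolding mollify_def mollify_dx_def fst_conv snd_conv
proof (rule has_real_derivative_integral[where w = "\<lambda>z. \<bar>F z\<bar> * ((4 * (real (Suc n))\<^sup>2) * real (Suc n))"])
  show "integrable lborel (\<lambda>z. F z * (kern_n n (s - z $ 1) * kern_n n (y - z $ 2)))" for s
    by (rule integrable_times_bounded[where K = "real (Suc n) * real (Suc n)", OF F]) (measurable, rule kern_bounds2)
  show "((\<lambda>s. F z * (kern_n n (s - z $ 1) * kern_n n (y - z $ 2))) has_real_derivative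
      F z * (kern_n' n (s - z $ 1) * kern_n n (y - z $ 2))) (at s)" for s z
    by (intro DERIV_cmult DERIV_cmult_right shift)
  show "\<bar>F z * (kern_n' n (s - z $ 1) * kern_n n (y - z $ 2))\<bar> \<le> \<bar>F z\<bar> * ((4 * (real (Suc n))\<^sup>2) * real (Suc n))" for s z
    unfolding abs_mult[of "F z"] by (intro mult_left_mono kern_bounds2) auto
qed (use F in auto)

lemma mollify_deriv_y: "((\<lambda>t. mollify n F (x, t)) has_real_derivative mollify_dy n F (x, y)) (at y)"
  unfolding mollify_def mollify_dy_def fst_conv snd_conv
proof (rule has_real_derivative_integral[where w = "\<lambda>z. \<bar>F z\<bar> * (real (Suc n) * (4 * (real (Suc n))\<^sup>2))"])
  show "integrable lborel (\<lambda>z. F z * (kern_n n (x - z $ 1) * kern_n n (t - z $ 2)))" for t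
    by (rule integrable_times_bounded[where K = "real (Suc n) * real (Suc n)", OF F]) (measurable, rule kern_bounds2)
  show "((\<lambda>t. F z * (kern_n n (x - z $ 1) * kern_n n (t - z $ 2))) has_real_derivative
      F z * (kern_n n (x - z $ 1) * kern_n' n (t - z $ 2))) (at t)" for t z
    by (intro DERIV_cmult shift)
  show "\<bar>F z * (kern_n n (x - z $ 1) * kern_n' n (t - z $ 2))\<bar> \<le> \<bar>F z\<bar> * (real (Suc n) * (4 * (real (Suc n))\<^sup>2))" for t z
    unfolding abs_mult[of "F z"] by (intro mult_left_mono kern_bounds2) auto
qed (use F in auto)


end


section \<open>The trace estimate for discontinuous tensors\<close>
context
  fixes F :: "real^2 \<Rightarrow> real"
  assumes F: "integrable lborel F"
begin

lemma mollify_support: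
  assumes supp: "\<And>z. \<not> (\<bar>z $ 1\<bar> \<le> r \<and> \<bar>z $ 2\<bar> \<le> r) \<Longrightarrow> F z = 0" and p: "r + 1 \<le> \<bar>x\<bar> \<or> r + 1 \<le> \<bar>y\<bar>"
  shows "mollify n F (x, y) = 0"
proof -
  have "F z * (kern_n n (x - z $ 1) * kern_n n (y - z $ 2)) = 0" for z
  proof (cases "\<bar>z $ 1\<bar> \<le> r \<and> \<bar>z $ 2\<bar> \<le> r")
    case True
    have *: "kern_n n t = 0" if "1 \<le> \<bar>t\<bar>" for t
    proof (rule kern_n_0)
      have "1 * 1 \<le> real (Suc n) * \<bar>t\<bar>" using that by (intro mult_mono) auto
      then show "1 \<le> real (Suc n) * \<bar>t\<bar>" by simp
    qed
    have "1 \<le> \<bar>x - z $ 1\<bar> \<or> 1 \<le> \<bar>y - z $ 2\<bar>" using p True by linarith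
    then have "kern_n n (x - z $ 1) = 0 \<or> kern_n n (y - z $ 2) = 0" using * by blast
    then show ?thesis by auto
  qed (use supp in auto)
  then show ?thesis unfolding mollify_def fst_conv snd_conv by (simp only: integral_zero)
qed

lemma mollify_bound:
  assumes "\<And>z. \<bar>F z\<bar> \<le> K"
  shows "\<bar>mollify n F p\<bar> \<le> K"
proof -
  let ?k = "\<lambda>z::real^2. kern_n n (fst p - z $ 1) * kern_n n (snd p - z $ 2)"
  note k = integral_plane_product[OF kern_n_integral(1) kern_n_integral(1), of n "fst p" n "snd p"]
  have "\<bar>mollify n F p\<bar> \<le> (LINT z|lborel. \<bar>F z * ?k z\<bar>)"
    unfolding mollify_def by (rule integral_abs_bound)
  also have "\<dots> \<le> (LINT z|lborel. K * ?k z)"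
  proof (rule integral_mono)
    show "integrable lborel (\<lambda>z. \<bar>F z * ?k z\<bar>)"
      by (intro integrable_abs integrable_times_bounded[where K = "real (Suc n) * real (Suc n)", OF F]) (measurable, rule kern_bounds2)
    show "integrable lborel (\<lambda>z. K * ?k z)" using k(1) by simp
    show "\<bar>F z * ?k z\<bar> \<le> K * ?k z" for z
      using assms[of z] kern_n_nonneg by (simp add: abs_mult mult_right_mono)
  qed
  also have "\<dots> = K" using k(2) by (simp add: kern_n_integral(2))
  finally show ?thesis .
qed

lemma mollify_tendsto:
  assumes c: "isCont F z0"
  shows "(\<lambda>n. mollify n F (z0 $ 1, z0 $ 2)) \<longlonglongrightarrow> F z0"
proof (rule LIMSEQ_I)
  fix e :: real assume "0 < e"
  then have e: "0 < e / 2" by simp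
  obtain d where d: "0 < d" "\<And>z. dist z z0 < d \<Longrightarrow> \<bar>F z - F z0\<bar> < e / 2"
    using c[unfolded continuous_at_eps_delta, rule_format, OF e] by (auto simp: dist_real_def)
  obtain N where N: "2 / d < real N" using reals_Archimedean2 by blast
  show "\<exists>no. \<forall>n\<ge>no. norm (mollify n F (z0 $ 1, z0 $ 2) - F z0) < e"
  proof (intro exI allI impI)
    fix n assume n: "N \<le> n"
    let ?k = "\<lambda>z::real^2. kern_n n (z0 $ 1 - z $ 1) * kern_n n (z0 $ 2 - z $ 2)"
    note k = integral_plane_product[OF kern_n_integral(1) kern_n_integral(1), of n "z0 $ 1" n "z0 $ 2"]
    have i: "integrable lborel (\<lambda>z. F z * ?k z)"
      by (rule integrable_times_bounded[where K = "real (Suc n) * real (Suc n)", OF F]) (measurable, rule kern_bounds2)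
    have "mollify n F (z0 $ 1, z0 $ 2) - F z0 = (LINT z|lborel. F z * ?k z) - (LINT z|lborel. F z0 * ?k z)"
      using k(2) by (simp add: mollify_def kern_n_integral(2))
    also have "\<dots> = (LINT z|lborel. F z * ?k z - F z0 * ?k z)"
      using i k(1) by simp
    finally have eq: "mollify n F (z0 $ 1, z0 $ 2) - F z0 = (LINT z|lborel. F z * ?k z - F z0 * ?k z)" .
    have "\<bar>LINT z|lborel. F z * ?k z - F z0 * ?k z\<bar> \<le> (LINT z|lborel. \<bar>F z * ?k z - F z0 * ?k z\<bar>)"
      by (rule integral_abs_bound)
    also have "\<dots> \<le> (LINT z|lborel. e / 2 * ?k z)"
    proof (rule integral_mono)
      show "integrable lborel (\<lambda>z. \<bar>F z * ?k z - F z0 * ?k z\<bar>)" using i k(1) by simp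
      show "integrable lborel (\<lambda>z. e / 2 * ?k z)" using k(1) by simp
      fix z
      show "\<bar>F z * ?k z - F z0 * ?k z\<bar> \<le> e / 2 * ?k z"
      proof (cases "?k z = 0")
        case False
        then have "\<not> 1 \<le> real (Suc n) * \<bar>z0 $ 1 - z $ 1\<bar>" "\<not> 1 \<le> real (Suc n) * \<bar>z0 $ 2 - z $ 2\<bar>"
          using kern_n_0[of n "z0 $ 1 - z $ 1"] kern_n_0[of n "z0 $ 2 - z $ 2"] by (metis mult_zero_left, metis mult_zero_right)
        then have "\<bar>z0 $ 1 - z $ 1\<bar> < 1 / real (Suc n)" "\<bar>z0 $ 2 - z $ 2\<bar> < 1 / real (Suc n)"
          by (simp_all add: not_le pos_less_divide_eq mult.commute del: of_nat_Suc)
        moreover have "norm (z0 - z) \<le> \<bar>(z0 - z) $ 1\<bar> + \<bar>(z0 - z) $ 2\<bar>"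
          using norm_le_l1_cart[of "z0 - z"] by (simp add: sum_2)
        moreover have "2 / real (Suc n) < d"
        proof -
          have "2 / d < real (Suc n)" using N n by linarith
          then show ?thesis using d(1) by (simp add: pos_divide_less_eq mult.commute del: of_nat_Suc)
        qed
        ultimately have "dist z z0 < d" by (simp add: dist_norm norm_minus_commute)
        from d(2)[OF this] have "\<bar>F z - F z0\<bar> * ?k z \<le> e / 2 * ?k z"
          using kern_n_nonneg by (intro mult_right_mono) auto
        moreover have "\<bar>F z * ?k z - F z0 * ?k z\<bar> = \<bar>F z - F z0\<bar> * ?k z"
          using kern_n_nonneg by (simp add: left_diff_distrib[symmetric] abs_mult)
        ultimately show ?thesis by simp
      next
        case True
        show ?thesis unfolding True by simp
      qed
    qed
    also have "\<dots> = e / 2" using k(2) by (simp add: kern_n_integral(2))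
    also have "\<dots> < e" using \<open>0 < e\<close> by simp
    finally show "norm (mollify n F (z0 $ 1, z0 $ 2) - F z0) < e" unfolding eq by simp
  qed
qed

end

text \<open>
  The class to which a triangulation leads: bounded, zero outside a square and continuous off a null set,
  so that mollifications converge almost everywhere with a common bound.
\<close>

definition box_fun :: "real \<Rightarrow> real \<Rightarrow> (real^2 \<Rightarrow> real) \<Rightarrow> bool" where
  "box_fun r K F \<longleftrightarrow> F \<in> borel_measurable borel \<and> (\<forall>z. \<bar>F z\<bar> \<le> K) \<and>
     (\<forall>z. \<not> (\<bar>z $ 1\<bar> \<le> r \<and> \<bar>z $ 2\<bar> \<le> r) \<longrightarrow> F z = 0) \<and> (AE z in lborel. isCont F z)"

abbreviation plane_square :: "real \<Rightarrow> (real^2) set" where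
  "plane_square R \<equiv> {z. \<bar>z $ 1\<bar> \<le> R \<and> \<bar>z $ 2\<bar> \<le> R}"

lemma plane_square_integrable: "integrable lborel (\<lambda>z. indicator (plane_square R) z * (c :: real))"
proof -
  have *: "plane_square R = cbox (vector [-R, -R]) (vector [R, R])"
    by (auto simp: cbox_def Basis_real2 inner_axis)
  then have "integrable lborel (indicat_real (plane_square R))"
    unfolding * by (intro integrable_real_indicator emeasure_lborel_cbox_finite) auto
  then show ?thesis by simp
qed

lemma box_fun_integrable:
  assumes "box_fun r K F" shows "integrable lborel F"
proof (rule Bochner_Integration.integrable_bound[OF plane_square_integrable[of r K]])
  show "F \<in> borel_measurable lborel" using assms by (simp add: box_fun_def)
  show "AE z in lborel. norm (F z) \<le> norm (indicator (plane_square r) z * K)"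
    using assms by (intro AE_I2) (auto simp: box_fun_def indicator_def intro: order_trans[OF _ abs_ge_self])
qed

text \<open>
  The divergence of \<open>(P, Q)\<close> on the plane is \<open>g\<close>, tested with products of functions of one variable:
  the kernel of the mollifier is such a product.
\<close>

definition weak_divergence :: "(real^2 \<Rightarrow> real) \<Rightarrow> (real^2 \<Rightarrow> real) \<Rightarrow> (real^2 \<Rightarrow> real) \<Rightarrow> bool" where
  "weak_divergence P Q g \<longleftrightarrow> (\<forall>f f' h h'.
     (\<forall>t. (f has_real_derivative f' t) (at t)) \<longrightarrow> continuous_on UNIV f' \<longrightarrow>
     (\<forall>t. (h has_real_derivative h' t) (at t)) \<longrightarrow> continuous_on UNIV h' \<longrightarrow>
     (LINT z|lborel. P z * (f' (z $ 1) * h (z $ 2)) + Q z * (f (z $ 1) * h' (z $ 2)))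
       = - (LINT z|lborel. g z * (f (z $ 1) * h (z $ 2))))"

text \<open>
  For a fixed point the kernel is a product test function, and moving the derivative from the point to
  the integration variable changes its sign.
\<close>

lemma mollify_divergence:
  assumes P: "box_fun r K P" and Q: "box_fun r K Q" and w: "weak_divergence P Q g"
  shows "mollify_dx n P p + mollify_dy n Q p = mollify n g p"
proof -
  obtain x y where p: "p = (x, y)" by force
  have d: "((\<lambda>s. kern_n n (c - s)) has_real_derivative - kern_n' n (c - t)) (at t)" for c t
  proof -
    have "((\<lambda>s. c - s) has_real_derivative - 1) (at t)" by (auto intro!: derivative_eq_intros)
    from DERIV_chain2[OF kern_n_deriv this] show ?thesis by simp
  qed
  have c: "continuous_on UNIV (\<lambda>t. - kern_n' n (c - t))" for c
    by (intro continuous_on_minus continuous_on_compose2[OF kern_n_cont(2)[of UNIV] _ subset_UNIV] continuous_intros)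
  have i: "integrable lborel (\<lambda>z. P z * (kern_n' n (x - z $ 1) * kern_n n (y - z $ 2)))"
     "integrable lborel (\<lambda>z. Q z * (kern_n n (x - z $ 1) * kern_n' n (y - z $ 2)))"
    by (rule integrable_times_bounded[OF box_fun_integrable[OF P], where K = "(4 * (real (Suc n))\<^sup>2) * real (Suc n)"])
       (measurable, rule kern_bounds2,
        rule integrable_times_bounded[OF box_fun_integrable[OF Q], where K = "real (Suc n) * (4 * (real (Suc n))\<^sup>2)"],
        measurable, rule kern_bounds2)
  have "(LINT z|lborel. P z * (- kern_n' n (x - z $ 1) * kern_n n (y - z $ 2)) + Q z * (kern_n n (x - z $ 1) * - kern_n' n (y - z $ 2)))
      = - (LINT z|lborel. g z * (kern_n n (x - z $ 1) * kern_n n (y - z $ 2)))"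
    using w[unfolded weak_divergence_def, rule_format, OF d c d c, of x y] by simp
  moreover have "(LINT z|lborel. P z * (- kern_n' n (x - z $ 1) * kern_n n (y - z $ 2)) + Q z * (kern_n n (x - z $ 1) * - kern_n' n (y - z $ 2)))
     = - (LINT z|lborel. P z * (kern_n' n (x - z $ 1) * kern_n n (y - z $ 2)) + Q z * (kern_n n (x - z $ 1) * kern_n' n (y - z $ 2)))"
    by (subst Bochner_Integration.integral_minus[symmetric]) (rule Bochner_Integration.integral_cong; simp)
  ultimately show ?thesis
    using i by (simp add: p mollify_def mollify_dx_def mollify_dy_def)
qed

lemma box_fun_mollify:
  assumes F: "box_fun r K F"
  shows "\<bar>mollify n F p\<bar> \<le> K" "continuous_on UNIV (mollify n F)"
    "continuous_on UNIV (mollify_dx n F)" "continuous_on UNIV (mollify_dy n F)"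
    "((\<lambda>s. mollify n F (s, y)) has_real_derivative mollify_dx n F (x, y)) (at x)"
    "((\<lambda>t. mollify n F (x, t)) has_real_derivative mollify_dy n F (x, y)) (at y)"
    "r + 1 \<le> \<bar>x\<bar> \<or> r + 1 \<le> \<bar>y\<bar> \<Longrightarrow> mollify n F (x, y) = 0"
    "AE z in lborel. (\<lambda>n. mollify n F (z $ 1, z $ 2)) \<longlonglongrightarrow> F z"
proof -
  note i = box_fun_integrable[OF F]
  show "\<bar>mollify n F p\<bar> \<le> K" by (rule mollify_bound[OF i]) (use F in \<open>auto simp: box_fun_def\<close>)
  show "AE z in lborel. (\<lambda>n. mollify n F (z $ 1, z $ 2)) \<longlonglongrightarrow> F z"
  proof -
    have "AE z in lborel. isCont F z" using F by (simp add: box_fun_def)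
    then show ?thesis by (rule AE_mp) (intro AE_I2 impI mollify_tendsto[OF i])
  qed
  show "r + 1 \<le> \<bar>x\<bar> \<or> r + 1 \<le> \<bar>y\<bar> \<Longrightarrow> mollify n F (x, y) = 0"
    by (rule mollify_support[OF i, of r]) (use F in \<open>auto simp: box_fun_def\<close>)
qed (rule mollify_continuous mollify_dx_continuous mollify_dy_continuous mollify_deriv_x mollify_deriv_y;
     rule box_fun_integrable[OF F])+

text \<open>
  Apply the estimate for smooth tensors to mollifications on the square of half-width \<open>r + 1\<close>, which
  contains their supports, and pass to the limit by dominated convergence.
\<close>

lemma weak_trace_estimate:
  fixes P Q S U g1 g2 :: "real^2 \<Rightarrow> real"
  assumes r: "0 \<le> r"
    and F: "box_fun r K P" "box_fun r K Q" "box_fun r K S" "box_fun r K U" "box_fun r K g1" "box_fun r K g2"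
    and w: "weak_divergence P Q g1" "weak_divergence S U g2"
  shows "(LINT z|lborel. ((P z + U z) / 2)\<^sup>2) \<le>
      3 * (LINT z|lborel. \<bar>P z * U z - Q z * S z - ((P z + U z) / 2)\<^sup>2\<bar>)
      + 134 * (r + 1)\<^sup>2 * (LINT z|lborel. (g1 z)\<^sup>2 + (g2 z)\<^sup>2)"
proof -
  define R where "R = r + 1"
  have R: "0 < R" using r by (simp add: R_def)
  have K: "0 \<le> K" using F(1) unfolding box_fun_def by (meson abs_ge_zero order_trans)
  note m = F[THEN box_fun_mollify(1)] and c = F[THEN box_fun_mollify(2)]
    and lim = F[THEN box_fun_mollify(8)] and z = F[THEN box_fun_mollify(7)]
  have [measurable]: "mollify n h \<in> borel_measurable borel" if "box_fun r K h" for h n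
    using box_fun_mollify(2)[OF that] by (rule borel_measurable_continuous_onI)
  note [measurable] = F
  have mF [measurable]: "P \<in> borel_measurable borel" "Q \<in> borel_measurable borel" "S \<in> borel_measurable borel"
     "U \<in> borel_measurable borel" "g1 \<in> borel_measurable borel" "g2 \<in> borel_measurable borel"
    using F by (auto simp: box_fun_def)
  let ?V = "\<lambda>P U. ((P + U) / 2)\<^sup>2 :: real"
  let ?D = "\<lambda>P Q S U. \<bar>P * U - Q * S - ((P + U) / 2)\<^sup>2\<bar> :: real"
  let ?G = "\<lambda>g1 g2. g1\<^sup>2 + g2\<^sup>2 :: real"
  let ?i = "\<lambda>z. indicator (plane_square R) z :: real"
  have est: "(LINT z|lborel. ?i z * ?V (mollify n P (z$1,z$2)) (mollify n U (z$1,z$2)))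
     \<le> 3 * (LINT z|lborel. ?i z * ?D (mollify n P (z$1,z$2)) (mollify n Q (z$1,z$2)) (mollify n S (z$1,z$2)) (mollify n U (z$1,z$2)))
      + 134 * R\<^sup>2 * (LINT z|lborel. ?i z * ?G (mollify n g1 (z$1,z$2)) (mollify n g2 (z$1,z$2)))" for n
  proof -
    have "integral (square R) (\<lambda>p. ?V (mollify n P p) (mollify n U p))
     \<le> 3 * integral (square R) (\<lambda>p. ?D (mollify n P p) (mollify n Q p) (mollify n S p) (mollify n U p))
      + 134 * R\<^sup>2 * integral (square R) (\<lambda>p. (mollify_dx n P p + mollify_dy n Q p)\<^sup>2 + (mollify_dx n S p + mollify_dy n U p)\<^sup>2)"
      by (rule smooth_trace_estimate[OF R])
         (use r in \<open>auto intro: continuous_on_subset F[THEN box_fun_mollify(2)] F[THEN box_fun_mollify(3)] F[THEN box_fun_mollify(4)]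
           has_field_derivative_at_within F[THEN box_fun_mollify(5)] F[THEN box_fun_mollify(6)] simp: R_def intro!: z\<close>)
    then show ?thesis
      unfolding mollify_divergence[OF F(1,2) w(1)] mollify_divergence[OF F(3,4) w(2)]
      by (subst (asm) (1 2 3) integral_square_plane) (auto intro!: continuous_intros c)
  qed
  have DC: "(\<lambda>n. LINT z|lborel. ?i z * H n z) \<longlonglongrightarrow> (LINT z|lborel. H' z)"
    if Hm: "\<And>n. H n \<in> borel_measurable borel" "H' \<in> borel_measurable borel"
      and Hb: "\<And>n z. \<bar>H n z\<bar> \<le> C" and Hl: "AE z in lborel. (\<lambda>n. H n z) \<longlonglongrightarrow> H' z"
      and H0: "\<And>z. z \<notin> plane_square R \<Longrightarrow> H' z = 0" for H H' C
  proof -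
    have "(\<lambda>n. LINT z|lborel. ?i z * H n z) \<longlonglongrightarrow> (LINT z|lborel. ?i z * H' z)"
    proof (rule integral_dominated_convergence[OF _ _ plane_square_integrable[of R C]])
      have "plane_square R \<in> sets borel" by measurable
      then show "(\<lambda>z. ?i z * H' z) \<in> borel_measurable lborel" "(\<lambda>z. ?i z * H n z) \<in> borel_measurable lborel" for n
        using Hm by auto
      show "AE z in lborel. (\<lambda>n. ?i z * H n z) \<longlonglongrightarrow> ?i z * H' z"
        using Hl by (rule AE_mp) (auto intro!: AE_I2 tendsto_intros)
      show "AE z in lborel. norm (?i z * H n z) \<le> ?i z * C" for n
        using Hb by (intro AE_I2) (auto simp: indicator_def)
    qed
    moreover have "?i z * H' z = H' z" for z using H0[of z] by (cases "z \<in> plane_square R") auto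
    ultimately show ?thesis by simp
  qed
  have out: "h z = 0" if "box_fun r K h" "z \<notin> plane_square R" for h z
  proof -
    have "\<not> (\<bar>z $ 1\<bar> \<le> r \<and> \<bar>z $ 2\<bar> \<le> r)" using that(2) by (auto simp: R_def)
    then show ?thesis using that(1) by (auto simp: box_fun_def)
  qed
  note out' = F[THEN out]
  have sq: "a\<^sup>2 \<le> K\<^sup>2" if "\<bar>a\<bar> \<le> K" for a using that by (simp add: abs_le_square_iff[symmetric] K)
  have Vb: "\<bar>?V a b\<bar> \<le> K\<^sup>2" if "\<bar>a\<bar> \<le> K" "\<bar>b\<bar> \<le> K" for a b
    using sq[of "(a + b) / 2"] that by (simp add: abs_le_iff)
  have prod: "\<bar>a * b\<bar> \<le> K\<^sup>2" if "\<bar>a\<bar> \<le> K" "\<bar>b\<bar> \<le> K" for a b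
    using that K by (auto simp: abs_mult power2_eq_square intro!: mult_mono)
  have "(\<lambda>n. LINT z|lborel. ?i z * ?V (mollify n P (z$1,z$2)) (mollify n U (z$1,z$2)))
      \<longlonglongrightarrow> (LINT z|lborel. ?V (P z) (U z))"
  proof (rule DC[of _ _ "K\<^sup>2"])
    show "AE z in lborel. (\<lambda>n. ?V (mollify n P (z$1,z$2)) (mollify n U (z$1,z$2))) \<longlonglongrightarrow> ?V (P z) (U z)"
      using lim(1) lim(4) by eventually_elim (intro tendsto_intros; simp)
  qed (use m Vb F in \<open>auto simp: out' simp del: abs_power2\<close>)
  moreover have "(\<lambda>n. LINT z|lborel. ?i z * ?D (mollify n P (z$1,z$2)) (mollify n Q (z$1,z$2)) (mollify n S (z$1,z$2)) (mollify n U (z$1,z$2)))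
      \<longlonglongrightarrow> (LINT z|lborel. ?D (P z) (Q z) (S z) (U z))"
  proof (rule DC[of _ _ "3 * K\<^sup>2"])
    show "AE z in lborel. (\<lambda>n. ?D (mollify n P (z$1,z$2)) (mollify n Q (z$1,z$2)) (mollify n S (z$1,z$2)) (mollify n U (z$1,z$2)))
       \<longlonglongrightarrow> ?D (P z) (Q z) (S z) (U z)"
      using lim(1) lim(2) lim(3) lim(4) by eventually_elim (intro tendsto_intros; simp)
    fix n z
    show "\<bar>?D (mollify n P (z$1,z$2)) (mollify n Q (z$1,z$2)) (mollify n S (z$1,z$2)) (mollify n U (z$1,z$2))\<bar> \<le> 3 * K\<^sup>2"
      using Vb[OF m(1) m(4), of n "(z$1,z$2)" n "(z$1,z$2)"] prod[OF m(1) m(4), of n "(z$1,z$2)" n "(z$1,z$2)"]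
        prod[OF m(2) m(3), of n "(z$1,z$2)" n "(z$1,z$2)"] by linarith
  qed (use F in \<open>auto simp: out'\<close>)
  moreover have "(\<lambda>n. LINT z|lborel. ?i z * ?G (mollify n g1 (z$1,z$2)) (mollify n g2 (z$1,z$2)))
      \<longlonglongrightarrow> (LINT z|lborel. ?G (g1 z) (g2 z))"
  proof (rule DC[of _ _ "2 * K\<^sup>2"])
    show "AE z in lborel. (\<lambda>n. ?G (mollify n g1 (z$1,z$2)) (mollify n g2 (z$1,z$2))) \<longlonglongrightarrow> ?G (g1 z) (g2 z)"
      using lim(5) lim(6) by eventually_elim (intro tendsto_intros; simp)
    fix n z
    show "\<bar>?G (mollify n g1 (z$1,z$2)) (mollify n g2 (z$1,z$2))\<bar> \<le> 2 * K\<^sup>2"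
      using sq[OF m(5), of n "(z$1,z$2)"] sq[OF m(6), of n "(z$1,z$2)"] by (simp add: abs_of_nonneg)
  qed (use F in \<open>auto simp: out'\<close>)
  ultimately have l: "(\<lambda>n. LINT z|lborel. ?i z * ?V (mollify n P (z$1,z$2)) (mollify n U (z$1,z$2)))
      \<longlonglongrightarrow> (LINT z|lborel. ?V (P z) (U z))"
    "(\<lambda>n. 3 * (LINT z|lborel. ?i z * ?D (mollify n P (z$1,z$2)) (mollify n Q (z$1,z$2)) (mollify n S (z$1,z$2)) (mollify n U (z$1,z$2)))
      + 134 * R\<^sup>2 * (LINT z|lborel. ?i z * ?G (mollify n g1 (z$1,z$2)) (mollify n g2 (z$1,z$2))))
      \<longlonglongrightarrow> 3 * (LINT z|lborel. ?D (P z) (Q z) (S z) (U z)) + 134 * R\<^sup>2 * (LINT z|lborel. ?G (g1 z) (g2 z))"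
    by (auto intro!: tendsto_intros)
  show ?thesis
    unfolding R_def[symmetric] by (rule LIMSEQ_le[OF l]) (use est in blast)
qed


section \<open>Integrals over a triangle\<close>
definition cross :: "real^2 \<Rightarrow> real^2 \<Rightarrow> real" where
  "cross a b = a $ 1 * b $ 2 - a $ 2 * b $ 1"

lemma collinear_iff_cross: "collinear {p, q, r} \<longleftrightarrow> cross (q - p) (r - p) = 0"
proof
  assume "collinear {p, q, r}"
  then obtain u where "\<forall>x\<in>{p,q,r}. \<forall>y\<in>{p,q,r}. \<exists>c. x - y = c *\<^sub>R u"
    unfolding collinear_def by blast
  then obtain c d where "q - p = c *\<^sub>R u" "r - p = d *\<^sub>R u" by blast
  then show "cross (q - p) (r - p) = 0" by (simp add: cross_def)
next
  assume c: "cross (q - p) (r - p) = 0"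
  show "collinear {p, q, r}"
  proof (cases "q = p")
    case False
    define k where "k = ((r - p) \<bullet> (q - p)) / ((q - p) \<bullet> (q - p))"
    have n: "(q - p) \<bullet> (q - p) \<noteq> 0" using False by simp
    have "((q - p) \<bullet> (q - p)) *\<^sub>R (r - p) = ((r - p) \<bullet> (q - p)) *\<^sub>R (q - p)"
    proof -
      have "(q $ 1 - p $ 1) * (r $ 2 - p $ 2) = (q $ 2 - p $ 2) * (r $ 1 - p $ 1)"
        using c by (simp add: cross_def)
      then show ?thesis
        by (simp add: vec_eq_iff forall_2 inner_vec_def sum_2) algebra
    qed
    then have "(1 / ((q - p) \<bullet> (q - p))) *\<^sub>R (((q - p) \<bullet> (q - p)) *\<^sub>R (r - p)) = k *\<^sub>R (q - p)"
      by (simp add: k_def)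
    then have "r - p = k *\<^sub>R (q - p)" using n by simp
    then have "collinear {0, q - p, r - p}" unfolding collinear_lemma by blast
    then have "collinear {q, p, r}" by (subst (asm) collinear_3[symmetric]) (simp_all add: NO_MATCH_def)
    moreover have "{q, p, r} = {p, q, r}" by auto
    ultimately show ?thesis by simp
  qed simp
qed

text \<open>
  The Duffy map: collapsing one side of the unit square to the vertex \<open>p\<close> turns the square into the triangle.
\<close>

lemma interior_triangle:
  assumes "cross (q - p) (r - p) \<noteq> 0"
  shows "interior (convex hull {p, q, r}) =
    (\<lambda>x::real^2. p + x$1 *\<^sub>R (q - p) + (x$1 * x$2) *\<^sub>R (r - q)) ` box 0 1"
proof -
  have "interior (convex hull {p, q, r}) =
      {v. \<exists>x y z. 0 < x \<and> 0 < y \<and> 0 < z \<and> x + y + z = 1 \<and> x *\<^sub>R p + y *\<^sub>R q + z *\<^sub>R r = v}"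
    using assms by (intro interior_convex_hull_3_minimal) (auto simp: collinear_iff_cross)
  also have "\<dots> = (\<lambda>x::real^2. p + x$1 *\<^sub>R (q - p) + (x$1 * x$2) *\<^sub>R (r - q)) ` box 0 1"
  proof (intro set_eqI iffI)
    fix v assume "v \<in> {v. \<exists>x y z. 0 < x \<and> 0 < y \<and> 0 < z \<and> x + y + z = 1 \<and> x *\<^sub>R p + y *\<^sub>R q + z *\<^sub>R r = v}"
    then obtain x y z where xyz: "0 < x" "0 < y" "0 < z" "x + y + z = 1" "v = x *\<^sub>R p + y *\<^sub>R q + z *\<^sub>R r" by auto
    let ?w = "vector [y + z, z / (y + z)] :: real^2"
    have "?w \<in> box 0 1" using xyz by (auto simp: mem_box_cart forall_2)
    moreover have "v = p + ?w$1 *\<^sub>R (q - p) + (?w$1 * ?w$2) *\<^sub>R (r - q)"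
    proof -
      have x: "x = 1 - (y + z)" using xyz by simp
      have "(y + z) * (z / (y + z)) = z" using xyz(2,3) by simp
      then show ?thesis unfolding vector_2_nth by (simp add: xyz(5) x algebra_simps)
    qed
    ultimately show "v \<in> (\<lambda>x::real^2. p + x$1 *\<^sub>R (q - p) + (x$1 * x$2) *\<^sub>R (r - q)) ` box 0 1" by blast
  next
    fix v assume "v \<in> (\<lambda>x::real^2. p + x$1 *\<^sub>R (q - p) + (x$1 * x$2) *\<^sub>R (r - q)) ` box 0 1"
    then obtain x :: "real^2" where x: "0 < x$1" "x$1 < 1" "0 < x$2" "x$2 < 1"
      "v = p + x$1 *\<^sub>R (q - p) + (x$1 * x$2) *\<^sub>R (r - q)" by (auto simp: mem_box_cart forall_2)
    have "x$1 * x$2 < x$1 * 1" using x by (intro mult_strict_left_mono) auto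
    have "v = (1 - x$1) *\<^sub>R p + (x$1 - x$1 * x$2) *\<^sub>R q + (x$1 * x$2) *\<^sub>R r"
      by (simp add: x(5) algebra_simps)
    show "v \<in> {v. \<exists>x y z. 0 < x \<and> 0 < y \<and> 0 < z \<and> x + y + z = 1 \<and> x *\<^sub>R p + y *\<^sub>R q + z *\<^sub>R r = v}"
    proof (rule CollectI, intro exI conjI)
      show "(1 - x$1) *\<^sub>R p + (x$1 - x$1 * x$2) *\<^sub>R q + (x$1 * x$2) *\<^sub>R r = v"
        using \<open>v = (1 - x$1) *\<^sub>R p + (x$1 - x$1 * x$2) *\<^sub>R q + (x$1 * x$2) *\<^sub>R r\<close> by simp
    qed (use x \<open>x$1 * x$2 < x$1 * 1\<close> in auto)
  qed
  finally show ?thesis .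
qed

lemma cross_eq_imp_eq:
  assumes "cross u v \<noteq> 0" and "a *\<^sub>R u + b *\<^sub>R v = a' *\<^sub>R u + b' *\<^sub>R (v :: real^2)"
  shows "a = a' \<and> b = b'"
proof -
  have 1: "(a - a') * u$1 + (b - b') * v$1 = 0" "(a - a') * u$2 + (b - b') * v$2 = 0"
    using assms(2) by (auto simp: vec_eq_iff forall_2 algebra_simps)
  have "(a - a') * cross u v = ((a - a') * u$1 + (b - b') * v$1) * v$2 - ((a - a') * u$2 + (b - b') * v$2) * v$1"
    by (simp add: cross_def algebra_simps)
  moreover have "(b - b') * cross u v = ((a - a') * u$2 + (b - b') * v$2) * u$1 - ((a - a') * u$1 + (b - b') * v$1) * u$2"
    by (simp add: cross_def algebra_simps)
  ultimately show ?thesis using 1 assms(1) by auto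
qed

text \<open>
  Change of variables along the Duffy map, whose Jacobian is \<open>s\<close> times the cross product: the integral
  is iterated over the segments from \<open>p\<close> to the opposite edge.
\<close>

lemma integral_open_triangle:
  fixes f :: "real^2 \<Rightarrow> real"
  assumes c: "continuous_on UNIV f" and D: "cross (q - p) (r - p) \<noteq> 0"
  shows "set_integrable lborel (interior (convex hull {p, q, r})) f"
    and "(LINT z:interior (convex hull {p, q, r})|lborel. f z) =
      \<bar>cross (q - p) (r - p)\<bar> * integral {0..1} (\<lambda>t. integral {0..1} (\<lambda>s. s * f (p + s *\<^sub>R (q + t *\<^sub>R (r - q) - p))))"
proof -
  let ?T = "interior (convex hull {p, q, r})"
  have bT: "bounded ?T" by (intro bounded_interior bounded_convex_hull) auto
  have fin: "?T \<in> lmeasurable" by (rule lmeasurable_open[OF bT open_interior])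
  obtain B where B: "\<And>z. z \<in> convex hull {p, q, r} \<Longrightarrow> \<bar>f z\<bar> \<le> B"
  proof -
    have "compact (f ` (convex hull {p, q, r}))"
      by (intro compact_continuous_image continuous_on_subset[OF c] compact_convex_hull finite_imp_compact) auto
    then show ?thesis using that compact_imp_bounded by (fastforce simp: bounded_iff)
  qed
  show si: "set_integrable lborel ?T f"
    unfolding set_integrable_def
  proof (rule Bochner_Integration.integrable_bound)
    show "integrable lborel (\<lambda>z. indicat_real ?T z * B)"
      using fin by (auto intro!: integrable_mult_left integrable_real_indicator simp: fmeasurable_def)
    show "(\<lambda>z. indicat_real ?T z *\<^sub>R f z) \<in> borel_measurable lborel"
      using borel_measurable_continuous_onI[OF c] by auto
    show "AE z in lborel. norm (indicat_real ?T z *\<^sub>R f z) \<le> norm (indicat_real ?T z * B)"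
      using B interior_subset[of "convex hull {p, q, r}"]
      by (intro AE_I2) (auto simp: indicator_def subset_iff intro: order_trans[OF _ abs_ge_self])
  qed
  define g where "g x = p + x$1 *\<^sub>R (q - p) + (x$1 * x$2) *\<^sub>R (r - q)" for x :: "real^2"
  define g' where "g' x h = h$1 *\<^sub>R (q - p) + (h$1 * x$2 + x$1 * h$2) *\<^sub>R (r - q)" for x h :: "real^2"
  define S where "S = (box 0 1 :: (real^2) set)"
  have gT: "?T = g ` S" unfolding S_def g_def[abs_def] by (rule interior_triangle[OF D])
  have D2: "cross (q - p) (r - q) = cross (q - p) (r - p)" by (simp add: cross_def algebra_simps)
  have S1: "0 < x$1" if "x \<in> S" for x using that by (auto simp: S_def mem_box_cart)
  have det: "\<bar>det (matrix (g' x))\<bar> = x$1 * \<bar>cross (q - p) (r - p)\<bar>" if "x \<in> S" for x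
  proof -
    have "det (matrix (g' x)) = x$1 * cross (q - p) (r - p)"
      by (simp add: det_2 matrix_def g'_def axis_def cross_def algebra_simps)
    then show ?thesis using S1[OF that] by (simp add: abs_mult)
  qed
  have inj: "inj_on g S"
  proof (rule inj_onI)
    fix x y assume xy: "x \<in> S" "y \<in> S" "g x = g y"
    have "x$1 *\<^sub>R (q - p) + (x$1 * x$2) *\<^sub>R (r - q) = y$1 *\<^sub>R (q - p) + (y$1 * y$2) *\<^sub>R (r - q)"
      using xy(3) by (simp add: g_def)
    from cross_eq_imp_eq[OF _ this] D D2 have "x$1 = y$1" "x$1 * x$2 = y$1 * y$2" by auto
    then show "x = y" using S1[OF xy(1)] by (simp add: vec_eq_iff forall_2)
  qed
  have der: "(g has_derivative g' x) (at x within S)" for x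
    unfolding g_def[abs_def] g'_def[abs_def]
    by (auto intro!: derivative_eq_intros bounded_linear_imp_has_derivative[OF bounded_linear_vec_nth]
        simp: fun_eq_iff algebra_simps)
  have gc: "continuous_on UNIV g" unfolding g_def[abs_def] by (intro continuous_intros)
  let ?k = "\<lambda>x. (x$1 * \<bar>cross (q - p) (r - p)\<bar>) * f (g x)"
  have kc: "continuous_on UNIV ?k"
    by (intro continuous_intros continuous_on_compose2[OF c gc]) auto
  have "compact (cbox 0 1 :: (real^2) set)" by simp
  have kint: "set_integrable lborel (cbox 0 1) ?k"
    unfolding set_integrable_def
    by (intro borel_integrable_compact compact_cbox continuous_on_subset[OF kc]) auto
  then have "?k absolutely_integrable_on cbox 0 1"
    unfolding set_integrable_def by (rule integrable_completion[THEN iffD2, rotated]) (use borel_measurable_continuous_onI[OF kc] in auto)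
  then have kabs: "?k absolutely_integrable_on S"
    by (rule set_integrable_subset) (auto simp: S_def box_subset_cbox)
  let ?F = "\<lambda>x. (\<chi> i. f x) :: real^1"
  have "(\<lambda>x. \<bar>det (matrix (g' x))\<bar> *\<^sub>R ?F (g x)) absolutely_integrable_on S"
  proof -
    have "(\<lambda>x. (\<chi> i. ?k x) :: real^1) absolutely_integrable_on S"
      by (subst absolutely_integrable_componentwise_iff) (use kabs in \<open>auto simp: Basis_vec_def inner_axis\<close>)
    then show ?thesis
      by (rule set_integrable_cong[THEN iffD1, rotated 3]) (auto simp: det vec_eq_iff)
  qed
  then have F: "?F absolutely_integrable_on ?T" "integral ?T ?F = integral S (\<lambda>x. \<bar>det (matrix (g' x))\<bar> *\<^sub>R ?F (g x))"
    using has_absolute_integral_change_of_variables[of S g g' ?F, OF _ der inj] unfolding gT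
    by (auto simp: S_def)
  have "(LINT z:?T|lborel. f z) = integral ?T f"
    by (rule set_borel_integral_eq_integral(2)[OF si])
  also have "\<dots> = integral ?T (\<lambda>x. ?F x $ 1)" by simp
  also have "\<dots> = integral S (\<lambda>x. \<bar>det (matrix (g' x))\<bar> *\<^sub>R ?F (g x)) $ 1"
    unfolding F(2)[symmetric] using F(1) by (intro integral_component_eq_cart) (rule set_lebesgue_integral_eq_integral)
  also have "\<dots> = integral S (\<lambda>x. (\<chi> i. ?k x) :: real^1) $ 1"
    by (intro arg_cong2[where f = "\<lambda>a b. a $ b"] integral_cong) (auto simp: det vec_eq_iff)
  also have "\<dots> = integral S ?k"
  proof -
    have "(\<lambda>x. (\<chi> i. ?k x) :: real^1) absolutely_integrable_on S"
      by (subst absolutely_integrable_componentwise_iff) (use kabs in \<open>auto simp: Basis_vec_def inner_axis\<close>)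
    then have "(\<lambda>x. (\<chi> i. ?k x) :: real^1) integrable_on S" by (rule set_lebesgue_integral_eq_integral)
    from integral_component_eq_cart[OF this, of 1] show ?thesis by simp
  qed
  also have "\<dots> = integral (cbox 0 1) ?k" unfolding S_def by (rule integral_open_interval)
  also have "\<dots> = (LINT z|lborel. indicator (cbox 0 1) z * ?k z)"
    using set_borel_integral_eq_integral(2)[OF kint] by (simp add: set_lebesgue_integral_def)
  also have "\<dots> = (LINT u|lborel. indicator (cbox 0 1) (vector [fst u, snd u] :: real^2) * ?k (vector [fst u, snd u]))"
    by (rule integral_plane(1)) (use borel_measurable_continuous_onI[OF kc] in auto)
  also have "\<dots> = (LINT u:cbox (0,0) (1,1)|lborel. ?k (vector [fst u, snd u]))"
    unfolding set_lebesgue_integral_def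
    by (rule Bochner_Integration.integral_cong) (auto simp: indicator_def mem_box_cart forall_2 cbox_Pair_eq)
  also have "\<dots> = integral (cbox (0,0) (1,1)) (\<lambda>u. ?k (vector [fst u, snd u]))"
  proof (rule set_borel_integral_eq_integral(2))
    have "continuous_on UNIV (\<lambda>u :: real \<times> real. ?k (vector [fst u, snd u]))"
      unfolding vector_2_nth g_def by (intro continuous_intros continuous_on_compose2[OF c]) auto
    then show "set_integrable lborel (cbox (0::real,0::real) (1,1)) (\<lambda>u. ?k (vector [fst u, snd u]))"
      unfolding set_integrable_def
      by (intro borel_integrable_compact compact_cbox) (auto intro: continuous_on_subset)
  qed
  also have "\<dots> = integral (cbox (0,0) (1,1)) (\<lambda>u. \<bar>cross (q - p) (r - p)\<bar> * (fst u * f (p + fst u *\<^sub>R (q + snd u *\<^sub>R (r - q) - p))))"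
    by (intro integral_cong) (simp add: g_def algebra_simps)
  also have "\<dots> = \<bar>cross (q - p) (r - p)\<bar> * integral (cbox (0,0) (1,1)) (\<lambda>u. fst u * f (p + fst u *\<^sub>R (q + snd u *\<^sub>R (r - q) - p)))"
    by simp
  also have "integral (cbox (0,0) (1,1)) (\<lambda>u. fst u * f (p + fst u *\<^sub>R (q + snd u *\<^sub>R (r - q) - p)))
      = integral {0..1} (\<lambda>t. integral {0..1} (\<lambda>s. s * f (p + s *\<^sub>R (q + t *\<^sub>R (r - q) - p))))"
  proof -
    have c2: "continuous_on (cbox (0,0) (1,1)) (\<lambda>u::real\<times>real. fst u * f (p + fst u *\<^sub>R (q + snd u *\<^sub>R (r - q) - p)))"
      by (intro continuous_intros continuous_on_compose2[OF c]) auto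
    show ?thesis
      using integral_prod_continuous[OF c2]
        integral_swap_continuous[of 0 0 1 1 "\<lambda>s t. s * f (p + s *\<^sub>R (q + t *\<^sub>R (r - q) - p))"] c2
      by (simp add: split_beta')
  qed
  finally show "(LINT z:?T|lborel. f z) =
      \<bar>cross (q - p) (r - p)\<bar> * integral {0..1} (\<lambda>t. integral {0..1} (\<lambda>s. s * f (p + s *\<^sub>R (q + t *\<^sub>R (r - q) - p))))" .
qed


text \<open>
  The field \<open>z - p\<close> is tangential on the two edges through \<open>p\<close> and has constant flux density through
  the third edge. Along each ray from \<open>p\<close> the divergence theorem is the derivative of \<open>s\<^sup>2 \<eta>\<close>, so no boundary
  regularity is involved. This is how edge means enter integrals over triangles.
\<close>

lemma radial_flux_open_triangle:
  fixes \<eta> :: "real^2 \<Rightarrow> real"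
  assumes D: "cross (q - p) (r - p) \<noteq> 0"
    and d: "\<And>z. (\<eta> has_derivative (\<lambda>h. \<eta>1 z * h$1 + \<eta>2 z * h$2)) (at z)"
    and c: "continuous_on UNIV \<eta>1" "continuous_on UNIV \<eta>2"
  shows "(LINT z:interior (convex hull {p, q, r})|lborel. (z$1 - p$1) * \<eta>1 z + (z$2 - p$2) * \<eta>2 z + 2 * \<eta> z)
     = \<bar>cross (q - p) (r - p)\<bar> * integral {0..1} (\<lambda>t. \<eta> (q + t *\<^sub>R (r - q)))"
proof -
  have ce: "continuous_on UNIV \<eta>"
    by (intro differentiable_imp_continuous_on) (auto simp: differentiable_on_def differentiable_def intro: d has_derivative_at_withinI)
  let ?f = "\<lambda>z. (z$1 - p$1) * \<eta>1 z + (z$2 - p$2) * \<eta>2 z + 2 * \<eta> z"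
  have cf: "continuous_on UNIV ?f" by (intro continuous_intros c ce)
  have "integral {0..1} (\<lambda>s. s * ?f (p + s *\<^sub>R (w - p))) = \<eta> w" for w
  proof -
    have "((\<lambda>s. s\<^sup>2 * \<eta> (p + s *\<^sub>R (w - p))) has_vector_derivative s * ?f (p + s *\<^sub>R (w - p))) (at s within {0..1})" for s
    proof -
      let ?z = "p + s *\<^sub>R (w - p)"
      have "((\<lambda>s. p + s *\<^sub>R (w - p)) has_vector_derivative (w - p)) (at s within {0..1})"
        by (auto intro!: derivative_eq_intros)
      from vector_derivative_diff_chain_within[OF this has_derivative_at_withinI[OF d[of ?z]]]
      have "((\<lambda>s. \<eta> (p + s *\<^sub>R (w - p))) has_real_derivative \<eta>1 ?z * (w - p)$1 + \<eta>2 ?z * (w - p)$2) (at s within {0..1})"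
        by (simp add: o_def has_real_derivative_iff_has_vector_derivative)
      then have "((\<lambda>s. s\<^sup>2 * \<eta> (p + s *\<^sub>R (w - p))) has_real_derivative
          2 * s * \<eta> ?z + s\<^sup>2 * (\<eta>1 ?z * (w - p)$1 + \<eta>2 ?z * (w - p)$2)) (at s within {0..1})"
        by (auto intro!: derivative_eq_intros)
      then show ?thesis
        by (simp add: has_real_derivative_iff_has_vector_derivative algebra_simps power2_eq_square)
    qed
    then have "((\<lambda>s. s * ?f (p + s *\<^sub>R (w - p))) has_integral (1\<^sup>2 * \<eta> (p + 1 *\<^sub>R (w - p)) - 0\<^sup>2 * \<eta> (p + 0 *\<^sub>R (w - p)))) {0..1}"
      by (intro fundamental_theorem_of_calculus) auto
    then show ?thesis by (simp add: integral_unique)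
  qed
  then show ?thesis
    by (subst integral_open_triangle(2)[OF cf D]) (simp only:)
qed

lemma integral_open_triangle_1:
  assumes D: "cross (q - p) (r - p) \<noteq> 0"
  shows "(LINT z:interior (convex hull {p, q, r})|lborel. (1::real)) = \<bar>cross (q - p) (r - p)\<bar> / 2"
proof -
  have "integral {0..1} (\<lambda>s::real. s) = 1 / 2"
    using integral_unique[OF ident_has_integral[of 0 1]] by simp
  then show ?thesis
    using integral_open_triangle(2)[OF _ D, of "\<lambda>_. 1"] by (simp add: integral_mult_left)
qed

lemma integral_poly2_unit: "integral {0..1} (\<lambda>t::real. a + t * b + t\<^sup>2 * c) = a + b / 2 + c / 3"
proof -
  have "((\<lambda>t::real. a + t * b + t\<^sup>2 * c) has_integral ((a * 1 + 1\<^sup>2 / 2 * b + 1 ^ 3 / 3 * c) - (a * 0 + 0\<^sup>2 / 2 * b + 0 ^ 3 / 3 * c))) {0..1}"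
    by (intro fundamental_theorem_of_calculus)
      (auto intro!: derivative_eq_intros simp: has_real_derivative_iff_has_vector_derivative[symmetric] power2_eq_square)
  then show ?thesis by (simp add: integral_unique)
qed

text \<open>
  The rule with the three edge midpoints is exact for quadratic polynomials, in particular for products of
  affine functions. It makes the Crouzeix--Raviart basis orthogonal in the mean square sense.
\<close>

lemma midpoint_rule_open_triangle:
  fixes A B :: "real^2" and a b :: real
  assumes D: "cross (q - p) (r - p) \<noteq> 0"
  defines "\<alpha> \<equiv> (\<lambda>z. A \<bullet> z + a)" and "\<beta> \<equiv> (\<lambda>z. B \<bullet> z + b)"
  shows "(LINT z:interior (convex hull {p, q, r})|lborel. \<alpha> z * \<beta> z) = \<bar>cross (q - p) (r - p)\<bar> / 6 *
    (\<alpha> (midpoint q r) * \<beta> (midpoint q r) + \<alpha> (midpoint r p) * \<beta> (midpoint r p) + \<alpha> (midpoint p q) * \<beta> (midpoint p q))"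
proof -
  let ?T = "interior (convex hull {p, q, r})" and ?D = "\<bar>cross (q - p) (r - p)\<bar>"
  have c: "continuous_on UNIV \<alpha>" "continuous_on UNIV \<beta>" unfolding \<alpha>_def \<beta>_def by (intro continuous_intros)+
  have i: "set_integrable lborel ?T f" if "continuous_on UNIV f" for f :: "real^2 \<Rightarrow> real"
    by (rule integral_open_triangle(1)[OF that D])
  have one: "(LINT z:?T|lborel. v) = v * (?D / 2)" for v :: real
    using integral_open_triangle_1[OF D] set_integral_mult_right[of lborel ?T v "\<lambda>_. 1"] by simp
  have lin: "(LINT z:?T|lborel. E \<bullet> z + e) = ?D / 6 * ((E \<bullet> p + e) + (E \<bullet> q + e) + (E \<bullet> r + e))" for E e
  proof -
    let ?l = "\<lambda>z. E \<bullet> z + e"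
    have "(LINT z:?T|lborel. (z$1 - p$1) * E$1 + (z$2 - p$2) * E$2 + 2 * ?l z)
        = ?D * integral {0..1} (\<lambda>t. ?l (q + t *\<^sub>R (r - q)))"
      by (rule radial_flux_open_triangle[OF D])
        (auto intro!: derivative_eq_intros bounded_linear_imp_has_derivative[OF bounded_linear_vec_nth]
          simp: inner_vec_def sum_2 mult.commute)
    also have "(\<lambda>z. (z$1 - p$1) * E$1 + (z$2 - p$2) * E$2 + 2 * ?l z) = (\<lambda>z. 3 * ?l z - ?l p)"
      by (auto simp: inner_vec_def sum_2 algebra_simps)
    also have "(LINT z:?T|lborel. 3 * ?l z - ?l p) = 3 * (LINT z:?T|lborel. ?l z) - ?l p * (?D / 2)"
    proof -
      have "(LINT z:?T|lborel. 3 * ?l z - ?l p) = (LINT z:?T|lborel. 3 * ?l z) - (LINT z:?T|lborel. ?l p)"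
        by (intro set_integral_diff(2) i continuous_intros)
      then show ?thesis by (simp only: set_integral_mult_right one)
    qed
    also have "integral {0..1} (\<lambda>t. ?l (q + t *\<^sub>R (r - q))) = (?l q + ?l r) / 2"
    proof -
      have "?l (q + t *\<^sub>R (r - q)) = ?l q + t * (?l r - ?l q) + t\<^sup>2 * 0" for t
        by (simp add: inner_simps algebra_simps)
      then have "integral {0..1} (\<lambda>t. ?l (q + t *\<^sub>R (r - q))) = ?l q + (?l r - ?l q) / 2 + 0 / 3"
        by (simp only: integral_poly2_unit)
      then show ?thesis by (simp add: diff_divide_distrib add_divide_distrib)
    qed
    finally show ?thesis by (simp add: field_simps)
  qed
  have "(LINT z:?T|lborel. (z$1 - p$1) * (A$1 * \<beta> z + B$1 * \<alpha> z) + (z$2 - p$2) * (A$2 * \<beta> z + B$2 * \<alpha> z) + 2 * (\<alpha> z * \<beta> z))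
      = ?D * integral {0..1} (\<lambda>t. \<alpha> (q + t *\<^sub>R (r - q)) * \<beta> (q + t *\<^sub>R (r - q)))"
    by (rule radial_flux_open_triangle[OF D])
      (auto intro!: derivative_eq_intros bounded_linear_imp_has_derivative[OF bounded_linear_vec_nth] continuous_intros c
        simp: \<alpha>_def \<beta>_def inner_vec_def sum_2 algebra_simps)
  also have "(\<lambda>z. (z$1 - p$1) * (A$1 * \<beta> z + B$1 * \<alpha> z) + (z$2 - p$2) * (A$2 * \<beta> z + B$2 * \<alpha> z) + 2 * (\<alpha> z * \<beta> z))
      = (\<lambda>z. 4 * (\<alpha> z * \<beta> z) - (\<alpha> p * \<beta> z + \<beta> p * \<alpha> z))"
    by (auto simp: \<alpha>_def \<beta>_def inner_vec_def sum_2 algebra_simps)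
  also have "(LINT z:?T|lborel. 4 * (\<alpha> z * \<beta> z) - (\<alpha> p * \<beta> z + \<beta> p * \<alpha> z))
      = 4 * (LINT z:?T|lborel. \<alpha> z * \<beta> z) - (\<alpha> p * (LINT z:?T|lborel. \<beta> z) + \<beta> p * (LINT z:?T|lborel. \<alpha> z))"
  proof -
    have "(LINT z:?T|lborel. 4 * (\<alpha> z * \<beta> z) - (\<alpha> p * \<beta> z + \<beta> p * \<alpha> z))
        = (LINT z:?T|lborel. 4 * (\<alpha> z * \<beta> z)) - (LINT z:?T|lborel. \<alpha> p * \<beta> z + \<beta> p * \<alpha> z)"
      by (intro set_integral_diff(2) i continuous_intros c)
    also have "(LINT z:?T|lborel. \<alpha> p * \<beta> z + \<beta> p * \<alpha> z) = (LINT z:?T|lborel. \<alpha> p * \<beta> z) + (LINT z:?T|lborel. \<beta> p * \<alpha> z)"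
      by (intro set_integral_add(2) i continuous_intros c)
    finally show ?thesis by (simp only: set_integral_mult_right)
  qed
  also have "integral {0..1} (\<lambda>t. \<alpha> (q + t *\<^sub>R (r - q)) * \<beta> (q + t *\<^sub>R (r - q)))
      = \<alpha> q * \<beta> q + (\<alpha> q * (\<beta> r - \<beta> q) + \<beta> q * (\<alpha> r - \<alpha> q)) / 2 + (\<alpha> r - \<alpha> q) * (\<beta> r - \<beta> q) / 3"
  proof -
    have "\<alpha> (q + t *\<^sub>R (r - q)) * \<beta> (q + t *\<^sub>R (r - q)) =
       \<alpha> q * \<beta> q + t * (\<alpha> q * (\<beta> r - \<beta> q) + \<beta> q * (\<alpha> r - \<alpha> q)) + t\<^sup>2 * ((\<alpha> r - \<alpha> q) * (\<beta> r - \<beta> q))" for t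
      by (simp add: \<alpha>_def \<beta>_def inner_simps power2_eq_square algebra_simps)
    then show ?thesis by (simp add: integral_poly2_unit)
  qed
  finally have *: "4 * (LINT z:?T|lborel. \<alpha> z * \<beta> z) - (\<alpha> p * (LINT z:?T|lborel. \<beta> z) + \<beta> p * (LINT z:?T|lborel. \<alpha> z))
     = ?D * (\<alpha> q * \<beta> q + (\<alpha> q * (\<beta> r - \<beta> q) + \<beta> q * (\<alpha> r - \<alpha> q)) / 2 + (\<alpha> r - \<alpha> q) * (\<beta> r - \<beta> q) / 3)" .
  have ab: "(LINT z:?T|lborel. \<alpha> z) = ?D / 6 * (\<alpha> p + \<alpha> q + \<alpha> r)" "(LINT z:?T|lborel. \<beta> z) = ?D / 6 * (\<beta> p + \<beta> q + \<beta> r)"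
    unfolding \<alpha>_def \<beta>_def by (rule lin)+
  have mid: "\<alpha> (midpoint x y) = (\<alpha> x + \<alpha> y) / 2" "\<beta> (midpoint x y) = (\<beta> x + \<beta> y) / 2" for x y
    by (simp_all add: \<alpha>_def \<beta>_def midpoint_def inner_simps field_simps)
  define d where "d = ?D"
  from * show ?thesis unfolding ab mid d_def[symmetric] by (simp add: field_simps)
qed


section \<open>Triangles and their edges\<close>
text \<open>
  A triangle with its vertices listed counterclockwise.
\<close>

definition tri :: "(real^2) set \<Rightarrow> real^2 \<Rightarrow> real^2 \<Rightarrow> real^2 \<Rightarrow> bool" where
  "tri T p q r \<longleftrightarrow> T = convex hull {p, q, r} \<and> 0 < cross (q - p) (r - p)"

lemma tri_rotate: "tri T p q r \<Longrightarrow> tri T q r p"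
  by (auto simp: tri_def insert_commute cross_def algebra_simps)

lemma tri_rotate2: "tri T p q r \<Longrightarrow> tri T r p q"
  using tri_rotate tri_rotate by blast

lemma tri_not_collinear: "tri T p q r \<Longrightarrow> \<not> collinear {p, q, r}"
  by (auto simp: tri_def collinear_iff_cross)

lemma tri_neq:
  assumes "tri T p q r" shows "p \<noteq> q" "q \<noteq> r" "r \<noteq> p"
  using tri_not_collinear[OF assms] by (auto simp: insert_commute)

lemma tri_affine_independent: "tri T p q r \<Longrightarrow> \<not> affine_dependent {p, q, r}"
  using tri_not_collinear[of T p q r] tri_neq[of T p q r] collinear_3_eq_affine_dependent[of p q r] by auto

lemma simplex_tri:
  assumes "2 simplex T" obtains p q r where "tri T p q r"
proof -
  obtain C where C: "\<not> affine_dependent C" "int (card C) = 2 + 1" "T = convex hull C"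
    using assms unfolding simplex by auto
  then have "card C = 3" by simp
  then obtain p q r where pqr: "C = {p, q, r}" "p \<noteq> q" "q \<noteq> r" "p \<noteq> r"
    by (auto simp: card_3_iff)
  have "\<not> collinear {p, q, r}" using C(1) pqr collinear_3_eq_affine_dependent[of p q r] by auto
  then have "cross (q - p) (r - p) \<noteq> 0" by (simp add: collinear_iff_cross)
  then consider "0 < cross (q - p) (r - p)" | "0 < cross (r - p) (q - p)" by (auto simp: cross_def algebra_simps) linarith
  then show ?thesis
  proof cases
    case 1 then show ?thesis using that[of p q r] C pqr by (simp add: tri_def)
  next
    case 2 then show ?thesis using that[of p r q] C pqr by (simp add: tri_def insert_commute)
  qed
qed

definition edges :: "(real^2) set \<Rightarrow> (real^2) set set" where
  "edges T = {e. e edge_of T}"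

lemma edges_tri:
  assumes t: "tri T p q r"
  shows "edges T = {closed_segment q r, closed_segment r p, closed_segment p q}"
proof -
  have T: "T = convex hull {p, q, r}" and ai: "\<not> affine_dependent {p, q, r}" using t tri_affine_independent by (auto simp: tri_def)
  note neq = tri_neq[OF t]
  have A: "e edge_of T \<longleftrightarrow> (\<exists>c\<subseteq>{p,q,r}. e = convex hull c \<and> card c = 2)" for e
  proof -
    have "aff_dim (convex hull c) = 1 \<longleftrightarrow> card c = 2" if "c \<subseteq> {p,q,r}" for c
    proof -
      have "\<not> affine_dependent c" using ai that affine_dependent_subset by blast
      then have "aff_dim (convex hull c) = int (card c) - 1" by (simp add: aff_dim_convex_hull aff_dim_affine_independent)
      then show ?thesis by auto
    qed
    then show ?thesis unfolding edge_of_def T face_of_convex_hull_affine_independent[OF ai] by auto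
  qed
  have B: "c \<subseteq> {p,q,r} \<and> card c = 2 \<longleftrightarrow> c = {q, r} \<or> c = {r, p} \<or> c = {p, q}" for c
  proof
    assume c: "c \<subseteq> {p,q,r} \<and> card c = 2"
    then obtain a b where "c = {a, b}" "a \<noteq> b" by (auto simp: card_2_iff)
    then show "c = {q, r} \<or> c = {r, p} \<or> c = {p, q}" using c by auto
  qed (use neq in auto)
  have "edges T = (hull) convex ` {c. c \<subseteq> {p,q,r} \<and> card c = 2}"
    unfolding edges_def A by blast
  also have "{c. c \<subseteq> {p,q,r} \<and> card c = 2} = {{q, r}, {r, p}, {p, q}}"
    unfolding B by blast
  finally show ?thesis by (simp add: segment_convex_hull)
qed

lemma closed_segment_inj: "closed_segment a b = closed_segment c d \<longleftrightarrow> {a, b} = {c, d}"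
  for a :: "real^2" by (rule closed_segment_eq)

lemma edges_tri_distinct:
  assumes t: "tri T p q r"
  shows "closed_segment q r \<noteq> closed_segment r p" "closed_segment r p \<noteq> closed_segment p q" "closed_segment p q \<noteq> closed_segment q r"
  using tri_neq[OF t] by (auto simp: closed_segment_inj doubleton_eq_iff)

lemma sum_edges_tri:
  assumes t: "tri T p q r"
  shows "(\<Sum>e\<in>edges T. f e) = f (closed_segment q r) + f (closed_segment r p) + (f (closed_segment p q) :: 'a :: comm_monoid_add)"
  unfolding edges_tri[OF t] using edges_tri_distinct[OF t] by (simp add: add.assoc)

lemma finite_edges: "2 simplex T \<Longrightarrow> finite (edges T)"
  by (metis simplex_tri edges_tri finite.emptyI finite.insertI)

text \<open>
  An edge is a set of points, so its orientation has to be chosen. The choice is the one made by the arc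
  length integral.
\<close>

definition ends :: "(real^2) set \<Rightarrow> (real^2) \<times> (real^2)" where
  "ends e = (SOME (a, b). e = closed_segment a b)"
definition edge_vec :: "(real^2) set \<Rightarrow> real^2" where "edge_vec e = snd (ends e) - fst (ends e)"
definition edge_mid :: "(real^2) set \<Rightarrow> real^2" where "edge_mid e = midpoint (fst (ends e)) (snd (ends e))"
definition edge_len :: "(real^2) set \<Rightarrow> real" where "edge_len e = norm (edge_vec e)"

lemma ends_segment: "ends (closed_segment a b) = (a, b) \<or> ends (closed_segment a b) = (b, a)"
proof -
  have "(case ends (closed_segment a b) of (c, d) \<Rightarrow> closed_segment a b = closed_segment c d)"
    unfolding ends_def by (rule someI[of _ "(a, b)"]) simp
  then show ?thesis by (cases "ends (closed_segment a b)") (auto simp: closed_segment_inj doubleton_eq_iff)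
qed

lemma edge_data_segment:
  shows edge_mid_segment: "edge_mid (closed_segment a b) = midpoint a b"
    and edge_len_segment: "edge_len (closed_segment a b) = norm (b - a)"
    and edge_vec_segment: "edge_vec (closed_segment a b) = b - a \<or> edge_vec (closed_segment a b) = a - b"
  using ends_segment[of a b] by (auto simp: edge_mid_def edge_len_def edge_vec_def midpoint_sym norm_minus_commute)

lemma diameter_segment: "diameter (closed_segment a b) = norm (b - a)" for a b :: "real^2"
proof (rule antisym)
  show "diameter (closed_segment a b) \<le> norm (b - a)"
  proof (rule diameter_le)
    fix x y assume xy: "x \<in> closed_segment a b" "y \<in> closed_segment a b"
    have "norm (x - a) \<le> norm (b - a)" "norm (x - b) \<le> norm (b - a)"
      using dist_in_closed_segment[OF xy(1)] by (auto simp: dist_norm norm_minus_commute)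
    then show "norm (x - y) \<le> norm (b - a)"
      using segment_furthest_le[OF xy(2), of x] by linarith
  qed simp
  show "norm (b - a) \<le> diameter (closed_segment a b)"
    using diameter_bounded_bound[OF compact_imp_bounded[OF compact_segment], of b a b a] by (simp add: dist_norm)
qed

lemma edge_integral_ends:
  "edge_integral e f = edge_len e *\<^sub>R integral {0..1} (\<lambda>t. f (linepath (fst (ends e)) (snd (ends e)) t))"
  unfolding edge_integral_def ends_def[symmetric] edge_len_def edge_vec_def
  by (simp add: split_beta dist_norm norm_minus_commute)

definition edge_normal :: "(real^2) set \<Rightarrow> (real^2) set \<Rightarrow> real^2" where
  "edge_normal T e = edge_len e *\<^sub>R outward_normal T e"

text \<open>
  Rotation by a right angle clockwise: it takes a counterclockwise tangent to the outward direction.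
\<close>

definition rot :: "real^2 \<Rightarrow> real^2" where "rot d = vector [d $ 2, - d $ 1]"

lemma rot_inner: "rot d \<bullet> y = - cross d y" "y \<bullet> rot d = - cross d y"
  by (simp_all add: rot_def cross_def inner_vec_def sum_2)

lemma norm_rot [simp]: "norm (rot d) = norm d"
  by (simp add: norm_eq_sqrt_inner inner_vec_def sum_2 rot_def)

text \<open>
  Over a nondegenerate triangle the two inequalities at the endpoints force a normal to be orthogonal to the
  edge, and the opposite vertex fixes its sign.
\<close>

lemma outward_normal_tri:
  assumes t: "tri T p q r"
  shows "outward_normal T (closed_segment q r) = (1 / norm (r - q)) *\<^sub>R rot (r - q)"
proof -
  let ?n = "(1 / norm (r - q)) *\<^sub>R rot (r - q)"
  have rq: "r \<noteq> q" using tri_neq[OF t] by auto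
  have T: "T = convex hull {p, q, r}" and D: "0 < cross (q - p) (r - p)" using t by (auto simp: tri_def)
  have D': "cross (r - q) (p - q) = cross (q - p) (r - p)" by (simp add: cross_def algebra_simps)
  have props: "norm ?n = 1" "?n \<bullet> r = ?n \<bullet> q" "?n \<bullet> p \<le> ?n \<bullet> q"
  proof -
    show "norm ?n = 1" using rq by simp
    have "rot (r - q) \<bullet> (r - q) = 0" by (simp add: rot_inner cross_def)
    then show "?n \<bullet> r = ?n \<bullet> q" by (simp add: inner_simps)
    have "rot (r - q) \<bullet> (p - q) \<le> 0" using D D' by (simp add: rot_inner)
    then have "(1 / norm (r - q)) * (rot (r - q) \<bullet> (p - q)) \<le> 0" by (simp add: divide_nonpos_nonneg)
    then show "?n \<bullet> p \<le> ?n \<bullet> q" by (simp add: inner_simps algebra_simps diff_divide_distrib)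
  qed
  show ?thesis
    unfolding outward_normal_def
  proof (rule the_equality)
    have "?n \<bullet> y \<le> ?n \<bullet> q" if "y \<in> T" for y
    proof -
      have "{p, q, r} \<subseteq> {y. ?n \<bullet> y \<le> ?n \<bullet> q}" using props by auto
      then have "convex hull {p, q, r} \<subseteq> {y. ?n \<bullet> y \<le> ?n \<bullet> q}"
        by (rule hull_minimal) (rule convex_halfspace_le)
      then show ?thesis using that T by auto
    qed
    moreover have "?n \<bullet> x = ?n \<bullet> q" if x: "x \<in> closed_segment q r" for x
    proof -
      obtain u where u: "x = (1 - u) *\<^sub>R q + u *\<^sub>R r" using x by (auto simp: in_segment)
      have "?n \<bullet> x = (1 - u) * (?n \<bullet> q) + u * (?n \<bullet> r)"
        unfolding u inner_add_right inner_scaleR_right ..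
      moreover have "(1 - u) * c + u * c = c" for c :: real by (simp add: algebra_simps)
      ultimately show ?thesis by (simp only: props(2))
    qed
    ultimately show "norm ?n = 1 \<and> (\<forall>x\<in>closed_segment q r. \<forall>y\<in>T. ?n \<bullet> y \<le> ?n \<bullet> x)"
      using props(1) by metis
  next
    fix n assume n: "norm n = 1 \<and> (\<forall>x\<in>closed_segment q r. \<forall>y\<in>T. n \<bullet> y \<le> n \<bullet> x)"
    have in': "p \<in> T" "q \<in> T" "r \<in> T" unfolding T by (auto intro: hull_inc)
    have eq: "n \<bullet> q = n \<bullet> r" and le: "n \<bullet> p \<le> n \<bullet> q"
      using n in' by (auto intro: antisym)
    define d where "d = r - q"
    have nd: "n$1 * d$1 + n$2 * d$2 = 0" using eq by (simp add: d_def inner_vec_def sum_2 algebra_simps)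
    have nn: "(n$1)\<^sup>2 + (n$2)\<^sup>2 = 1" using n by (simp add: norm_eq_sqrt_inner inner_vec_def sum_2 power2_eq_square)
    define k where "k = n$1 * d$2 - n$2 * d$1"
    define L where "L = norm d"
    have L: "0 < L" "L\<^sup>2 = (d$1)\<^sup>2 + (d$2)\<^sup>2"
      using rq power2_norm_eq_inner[of d] by (simp_all add: L_def d_def inner_vec_def sum_2 power2_eq_square)
    have k2: "k\<^sup>2 = L\<^sup>2"
    proof -
      have "k\<^sup>2 + (n$1 * d$1 + n$2 * d$2)\<^sup>2 = ((n$1)\<^sup>2 + (n$2)\<^sup>2) * ((d$1)\<^sup>2 + (d$2)\<^sup>2)"
        by (simp add: k_def power2_eq_square algebra_simps)
      then show ?thesis using nd nn L by simp
    qed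
    have kn: "L\<^sup>2 * n$1 = k * d$2" "L\<^sup>2 * n$2 = - (k * d$1)"
    proof -
      have "k * d$2 = n$1 * ((d$1)\<^sup>2 + (d$2)\<^sup>2) - d$1 * (n$1 * d$1 + n$2 * d$2)"
        by (simp add: k_def power2_eq_square algebra_simps)
      then show "L\<^sup>2 * n$1 = k * d$2" using nd L by simp
      have "- (k * d$1) = n$2 * ((d$1)\<^sup>2 + (d$2)\<^sup>2) - d$2 * (n$1 * d$1 + n$2 * d$2)"
        by (simp add: k_def power2_eq_square algebra_simps)
      then show "L\<^sup>2 * n$2 = - (k * d$1)" using nd L by simp
    qed
    have "L\<^sup>2 * (n \<bullet> (p - q)) = - k * cross d (p - q)"
    proof -
      have "L\<^sup>2 * (n \<bullet> (p - q)) = (L\<^sup>2 * n$1) * (p - q)$1 + (L\<^sup>2 * n$2) * (p - q)$2"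
        by (simp add: inner_vec_def sum_2 algebra_simps)
      then show ?thesis unfolding kn by (simp add: cross_def algebra_simps)
    qed
    moreover have "L\<^sup>2 * (n \<bullet> (p - q)) \<le> 0" using le by (simp add: inner_simps mult_nonneg_nonpos)
    ultimately have "0 \<le> k * cross d (p - q)" by simp
    moreover have "0 < cross d (p - q)" using D D' by (simp add: d_def)
    ultimately have "0 \<le> k" by (simp add: zero_le_mult_iff)
    then have k: "k = L" using k2 L(1) by (simp add: power2_eq_iff)
    have "L * (L * n$1 - d$2) = 0" "L * (L * n$2 + d$1) = 0"
      using kn unfolding k by (simp_all add: power2_eq_square algebra_simps)
    then have "L * n$1 = d$2" "L * n$2 = - d$1" using L(1) by (simp_all add: eq_neg_iff_add_eq_0)
    then have "n$1 = d$2 / L" "n$2 = - (d$1 / L)" using L(1) by (simp_all add: field_simps)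
    then show "n = ?n" by (simp add: vec_eq_iff forall_2 rot_def d_def[symmetric] L_def[symmetric])
  qed
qed

lemma edge_normal_tri: "tri T p q r \<Longrightarrow> edge_normal T (closed_segment q r) = rot (r - q)"
  using tri_neq[of T p q r] by (simp add: edge_normal_def outward_normal_tri edge_len_segment)

definition tarea :: "(real^2) set \<Rightarrow> real" where
  "tarea T = (LINT z:interior T|lborel. (1::real))"

lemma tarea_tri: "tri T p q r \<Longrightarrow> tarea T = cross (q - p) (r - p) / 2"
  unfolding tarea_def tri_def using integral_open_triangle_1[of q p r] by auto

text \<open>
  The vertex opposite to the edge, in terms of midpoints and hence without naming the vertices.
\<close>

definition opp :: "(real^2) set \<Rightarrow> (real^2) set \<Rightarrow> real^2" where
  "opp T e = (\<Sum>e'\<in>edges T. edge_mid e') - 2 *\<^sub>R edge_mid e"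

lemma opp_tri: "tri T p q r \<Longrightarrow> opp T (closed_segment q r) = p"
  by (simp add: opp_def sum_edges_tri edge_mid_segment midpoint_def vec_eq_iff field_simps)

text \<open>
  The barycentric coordinate that belongs to the vertex opposite to the edge.
\<close>

definition bary :: "(real^2) set \<Rightarrow> (real^2) set \<Rightarrow> real^2 \<Rightarrow> real" where
  "bary T e x = (edge_normal T e \<bullet> (edge_mid e - x)) / (2 * tarea T)"

lemma bary_tri:
  assumes "tri T p q r" 
  shows "bary T (closed_segment q r) x = cross (r - q) (x - q) / cross (q - p) (r - p)"
proof -
  have "- cross (r - q) (midpoint q r - x) = cross (r - q) (x - q)"
    by (simp add: cross_def midpoint_def field_simps)
  then show ?thesis
    using assms by (simp add: bary_def edge_normal_tri tarea_tri edge_mid_segment rot_inner)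
qed

lemma elem_trace_affine:
  fixes \<tau> f :: "real^2 \<Rightarrow> 'a :: euclidean_space"
  assumes t: "tri T p q r" and x: "x \<in> T" and eq: "\<And>y. y \<in> interior T \<Longrightarrow> \<tau> y = f y" and c: "isCont f x"
  shows "elem_trace \<tau> T x = f x"
proof -
  have T: "T = convex hull {p, q, r}" using t by (simp add: tri_def)
  have "(vector [1/2, 1/2] :: real^2) \<in> box 0 1" by (simp add: mem_box_cart forall_2)
  then have "interior T \<noteq> {}" unfolding T using t by (subst interior_triangle) (auto simp: tri_def)
  then have cl: "closure (interior T) = T"
    unfolding T by (subst convex_closure_interior)
      (auto intro!: closure_closed compact_imp_closed compact_convex_hull finite_imp_compact)
  have lim: "x islimpt interior T"
  proof -
    have "x \<in> closure (interior T)" using x cl by simp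
    then show ?thesis using interior_limit_point[of x "interior T"] by (auto simp: closure_def)
  qed
  have "(f \<longlongrightarrow> f x) (at x within interior T)"
    using c by (simp add: isCont_def tendsto_within_subset[OF _ subset_UNIV])
  then have "(\<tau> \<longlongrightarrow> f x) (at x within interior T)"
    by (rule tendsto_cong[THEN iffD1, rotated]) (auto simp: eventually_at_filter eq)
  then show ?thesis
    unfolding elem_trace_def using lim by (intro tendsto_Lim) (auto simp: trivial_limit_within)
qed


section \<open>Conforming triangulations\<close>

lemma tri_interiorI:
  assumes "tri T p q r" "0 < a" "0 < b" "0 < c" "a + b + c = 1"
  shows "a *\<^sub>R p + b *\<^sub>R q + c *\<^sub>R r \<in> interior T"
proof -
  have "interior T = {v. \<exists>x y z. 0 < x \<and> 0 < y \<and> 0 < z \<and> x + y + z = 1 \<and> x *\<^sub>R p + y *\<^sub>R q + z *\<^sub>R r = v}"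
    using assms(1) tri_not_collinear[OF assms(1)] unfolding tri_def
    by (auto simp: interior_convex_hull_3_minimal)
  then show ?thesis using assms by blast
qed

lemma barycentric_coordinates:
  assumes D: "cross (q - p) (r - p) \<noteq> 0"
  shows "x = (cross (r - q) (x - q) / cross (q - p) (r - p)) *\<^sub>R p
    + (cross (p - r) (x - r) / cross (q - p) (r - p)) *\<^sub>R q + (cross (q - p) (x - p) / cross (q - p) (r - p)) *\<^sub>R r"
    and "cross (r - q) (x - q) / cross (q - p) (r - p) + cross (p - r) (x - r) / cross (q - p) (r - p)
      + cross (q - p) (x - p) / cross (q - p) (r - p) = 1"
proof -
  let ?D = "cross (q - p) (r - p)"
  have "?D *\<^sub>R x = cross (r - q) (x - q) *\<^sub>R p + cross (p - r) (x - r) *\<^sub>R q + cross (q - p) (x - p) *\<^sub>R r"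
    by (simp add: vec_eq_iff forall_2 cross_def algebra_simps)
  then have "(1 / ?D) *\<^sub>R (?D *\<^sub>R x) = (1 / ?D) *\<^sub>R (cross (r - q) (x - q) *\<^sub>R p + cross (p - r) (x - r) *\<^sub>R q + cross (q - p) (x - p) *\<^sub>R r)"
    by simp
  then show "x = (cross (r - q) (x - q) / ?D) *\<^sub>R p + (cross (p - r) (x - r) / ?D) *\<^sub>R q + (cross (q - p) (x - p) / ?D) *\<^sub>R r"
    using D by (simp add: scaleR_add_right)
  have "cross (r - q) (x - q) + cross (p - r) (x - r) + cross (q - p) (x - p) = ?D"
    by (simp add: cross_def algebra_simps)
  then show "cross (r - q) (x - q) / ?D + cross (p - r) (x - r) / ?D + cross (q - p) (x - p) / ?D = 1"
    using D by (simp add: add_divide_distrib[symmetric])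
qed

lemma tri_edge_label:
  assumes "tri T p q r" "e \<in> edges T"
  obtains p' q' r' where "tri T p' q' r'" "e = closed_segment q' r'"
  using assms edges_tri[OF assms(1)] tri_rotate[OF assms(1)] tri_rotate2[OF assms(1)] by blast

locale mesh =
  fixes \<T> :: "(real^2) set set"
  assumes triangulation: "triangulation \<T>" and simplices: "\<And>T. T \<in> \<T> \<Longrightarrow> 2 simplex T"
begin

lemma finite_mesh: "finite \<T>"
  using triangulation by (simp add: triangulation_def)

lemma mesh_tri:
  assumes "T \<in> \<T>" obtains p q r where "tri T p q r"
  using simplex_tri[OF simplices[OF assms]] by blast

lemma edge_label:
  assumes "T \<in> \<T>" "e \<in> edges T" obtains p q r where "tri T p q r" "e = closed_segment q r"
  using mesh_tri[OF assms(1)] tri_edge_label[OF _ assms(2)] by metis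

lemma interiors_disjoint:
  assumes "T \<in> \<T>" "T' \<in> \<T>" "T \<noteq> T'" shows "interior T \<inter> interior T' = {}"
proof (rule ccontr)
  assume "interior T \<inter> interior T' \<noteq> {}"
  then obtain x where x: "x \<in> interior T" "x \<in> interior T'" by auto
  have f: "(T \<inter> T') face_of T" "(T' \<inter> T) face_of T'" using triangulation assms by (auto simp: triangulation_def)
  have "x \<in> T" "x \<in> T'" using x interior_subset by auto
  then have "T \<inter> T' = T" "T' \<inter> T = T'"
    using face_of_disjoint_interior[OF f(1)] face_of_disjoint_interior[OF f(2)] x by blast+
  then show False using assms by blast
qed

text \<open>
  Were the third vertices on the same side of the common edge, a point near the midpoint of the edge would be
  interior to both triangles. So the edge is traversed in opposite directions.
\<close>

lemma shared_edge_normals: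
  assumes T: "T \<in> \<T>" "T' \<in> \<T>" "T \<noteq> T'" and e: "e \<in> edges T" "e \<in> edges T'"
  shows "outward_normal T' e = - outward_normal T e"
proof -
  obtain p q r where t: "tri T p q r" "e = closed_segment q r" using edge_label[OF T(1) e(1)] .
  obtain p' q' r' where t': "tri T' p' q' r'" "e = closed_segment q' r'" using edge_label[OF T(2) e(2)] .
  have "{q, r} = {q', r'}" using t(2) t'(2) by (simp add: closed_segment_inj)
  then consider "q' = q" "r' = r" | "q' = r" "r' = q" by (auto simp: doubleton_eq_iff)
  then show ?thesis
  proof cases
    case 1
    let ?D = "cross (q - p) (r - p)"
    have D: "0 < ?D" "0 < cross (q - p') (r - p')" using t(1) t'(1) 1 by (auto simp: tri_def)
    define \<alpha> \<beta> \<gamma> where "\<alpha> = cross (r - q) (p' - q) / ?D" and "\<beta> = cross (p - r) (p' - r) / ?D" and "\<gamma> = cross (q - p) (p' - p) / ?D"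
    have p': "p' = \<alpha> *\<^sub>R p + \<beta> *\<^sub>R q + \<gamma> *\<^sub>R r" "\<alpha> + \<beta> + \<gamma> = 1"
      unfolding \<alpha>_def \<beta>_def \<gamma>_def using D by (intro barycentric_coordinates; simp)+
    have "cross (r - q) (p' - q) = cross (q - p') (r - p')" by (simp add: cross_def algebra_simps)
    then have \<alpha>: "0 < \<alpha>" using D by (simp add: \<alpha>_def)
    \<comment> \<open>For small \<open>s\<close> the convex combination of \<open>p'\<close> and the midpoint of the edge is
        interior to both triangles.\<close>
    define s where "s = 1 / (2 + 2 * \<bar>\<beta>\<bar> + 2 * \<bar>\<gamma>\<bar>)"
    have den: "0 < 2 + 2 * \<bar>\<beta>\<bar> + 2 * \<bar>\<gamma>\<bar>" by linarith
    have s: "0 < s" "s * (2 + 2 * \<bar>\<beta>\<bar> + 2 * \<bar>\<gamma>\<bar>) = 1" using den by (simp_all add: s_def)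
    have sb: "s * (1 + 2 * \<bar>\<beta>\<bar>) < 1" "s * (1 + 2 * \<bar>\<gamma>\<bar>) < 1" "s < 1"
    proof -
      have "0 \<le> s * \<bar>\<beta>\<bar>" "0 \<le> s * \<bar>\<gamma>\<bar>" using s by simp_all
      then show "s * (1 + 2 * \<bar>\<beta>\<bar>) < 1" "s * (1 + 2 * \<bar>\<gamma>\<bar>) < 1" "s < 1"
        using s unfolding distrib_left mult.left_commute[of s 2] by linarith+
    qed
    have neg: "- (s * \<bar>\<beta>\<bar>) \<le> s * \<beta>" "- (s * \<bar>\<gamma>\<bar>) \<le> s * \<gamma>"
      using s(1) abs_ge_minus_self[of "s * \<beta>"] abs_ge_minus_self[of "s * \<gamma>"] by (auto simp: abs_mult)
    have pos: "0 < (1 - s) / 2 + s * \<beta>" "0 < (1 - s) / 2 + s * \<gamma>"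
    proof -
      have "0 < (1 - s) / 2 + y" if "- b \<le> y" "s * 1 + 2 * b < 1" for b y :: real
        using that by (simp add: field_simps)
      then show "0 < (1 - s) / 2 + s * \<beta>" "0 < (1 - s) / 2 + s * \<gamma>"
        using sb neg
        unfolding distrib_left mult.left_commute[of s 2] by blast+
    qed
    define x where "x = (s * \<alpha>) *\<^sub>R p + ((1 - s) / 2 + s * \<beta>) *\<^sub>R q + ((1 - s) / 2 + s * \<gamma>) *\<^sub>R r"
    have "s * \<alpha> + s * \<beta> + s * \<gamma> = s" using p'(2) by (metis distrib_left mult.right_neutral)
    then have "x \<in> interior T"
      unfolding x_def using s \<alpha> pos by (intro tri_interiorI[OF t(1)]) auto
    moreover have "x = s *\<^sub>R p' + ((1 - s) / 2) *\<^sub>R q + ((1 - s) / 2) *\<^sub>R r"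
      unfolding x_def by (subst p'(1)) (simp add: algebra_simps)
    then have "x \<in> interior T'"
      using tri_interiorI[OF t'(1), of s "(1 - s) / 2" "(1 - s) / 2"] s sb 1 by simp
    ultimately show ?thesis using interiors_disjoint[OF T] by blast
  next
    case 2
    then have "outward_normal T' e = (1 / norm (q - r)) *\<^sub>R rot (q - r)"
      using outward_normal_tri[OF t'(1)] t'(2) by simp
    moreover have "rot (q - r) = - rot (r - q)" by (simp add: rot_def vec_eq_iff forall_2)
    ultimately show ?thesis using outward_normal_tri[OF t(1)] t(2) by (simp add: norm_minus_commute)
  qed
qed

lemma norm_outward_normal:
  assumes "T \<in> \<T>" "e \<in> edges T" shows "norm (outward_normal T e) = 1"
proof -
  obtain p q r where t: "tri T p q r" "e = closed_segment q r" using edge_label[OF assms] .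
  then show ?thesis using tri_neq[OF t(1)] by (simp add: outward_normal_tri)
qed

text \<open>
  Of three triangles at an edge the normals would be opposite in pairs.
\<close>

lemma at_most_two:
  assumes "T \<in> \<T>" "T' \<in> \<T>" "T \<noteq> T'" "e \<in> edges T" "e \<in> edges T'" "T'' \<in> \<T>" "e \<in> edges T''"
  shows "T'' = T \<or> T'' = T'"
proof (rule ccontr)
  assume "\<not> ?thesis"
  then have n: "outward_normal T'' e = - outward_normal T e" "outward_normal T'' e = - outward_normal T' e"
    "outward_normal T' e = - outward_normal T e"
    using assms by (auto intro: shared_edge_normals)
  then have "outward_normal T e = - outward_normal T e" by simp
  then have "outward_normal T e = 0" by (simp add: vec_eq_iff)
  then show False using norm_outward_normal[OF assms(1,4)] by simp
qed

lemma interior_edge_pair: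
  assumes "e \<in> interior_edges \<T>"
  obtains T T' where "T \<in> \<T>" "T' \<in> \<T>" "T \<noteq> T'" "{T \<in> \<T>. e edge_of T} = {T, T'}"
    "outward_normal T' e = - outward_normal T e"
proof -
  obtain T T' where T: "T \<in> \<T>" "T' \<in> \<T>" "T \<noteq> T'" "e \<in> edges T" "e \<in> edges T'"
    using assms by (auto simp: interior_edges_def edges_def)
  show ?thesis
  proof (rule that[OF T(1-3)])
    show "{T \<in> \<T>. e edge_of T} = {T, T'}"
      using T at_most_two[OF T] by (auto simp: edges_def)
    show "outward_normal T' e = - outward_normal T e" using shared_edge_normals T by blast
  qed
qed

lemma finite_interior_edges: "finite (interior_edges \<T>)"
proof (rule finite_subset)
  show "interior_edges \<T> \<subseteq> (\<Union>T\<in>\<T>. edges T)" by (auto simp: interior_edges_def edges_def)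
  show "finite (\<Union>T\<in>\<T>. edges T)" using finite_mesh finite_edges simplices by auto
qed

end



section \<open>Representation in a finite-dimensional semi-inner product\<close>

text \<open>
  Functionals that vanish on the null vectors of a positive semidefinite form on \<open>I \<rightarrow> \<real>\<close> are
  represented by it. Induction on the index set: the new coordinate vector minus the representer of its functional on the
  old ones is orthogonal to them, which leaves one scalar equation. That equation is solvable even if the new vector is
  null, because then both sides vanish.
\<close>

lemma psd_representer:
  fixes Q :: "('i \<Rightarrow> real) \<Rightarrow> ('i \<Rightarrow> real) \<Rightarrow> real"
  assumes "finite I"
    and lin: "\<And>c d e t. Q (\<lambda>i. c i + t * d i) e = Q c e + t * Q d e"
    and sym: "\<And>c d. Q c d = Q d c" and pos: "\<And>c. 0 \<le> Q c c"
  shows "(\<And>c d t. L (\<lambda>i. c i + t * d i) = L c + t * L d) \<Longrightarrow> (\<And>c. Q c c = 0 \<Longrightarrow> L c = 0) \<Longrightarrow>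
    \<exists>c. (\<forall>i. i \<notin> I \<longrightarrow> c i = 0) \<and> (\<forall>d. (\<forall>i. i \<notin> I \<longrightarrow> d i = 0) \<longrightarrow> Q c d = L d)"
  using assms(1)
proof (induction I arbitrary: L rule: finite_induct)
  case empty
  have "L (\<lambda>_. 0) = 0" using empty.prems(1)[of "\<lambda>_. 0" 1 "\<lambda>_. 0"] by simp
  moreover have "Q (\<lambda>_. 0) (\<lambda>_. 0) = 0" using lin[of "\<lambda>_. 0" 1 "\<lambda>_. 0" "\<lambda>_. 0"] by simp
  moreover have "(\<forall>i. d i = 0) \<longleftrightarrow> d = (\<lambda>_. 0)" for d :: "'i \<Rightarrow> real" by auto
  ultimately show ?case by (intro exI[of _ "\<lambda>_. 0"]) auto
next
  case (insert k I)
  have lin2: "Q e (\<lambda>i. c i + t * d i) = Q e c + t * Q e d" for c d e t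
    using lin[of c t d e] by (simp add: sym)
  have null: "Q c d = 0" if "Q d d = 0" for c d
  proof (rule ccontr)
    assume n: "Q c d \<noteq> 0"
    define t where "t = - (Q c c + 1) / (2 * Q c d)"
    have "0 \<le> Q (\<lambda>i. c i + t * d i) (\<lambda>i. c i + t * d i)" by (rule pos)
    also have "\<dots> = Q c c + 2 * t * Q c d" using that by (simp add: lin lin2 sym[of d c])
    also have "\<dots> = -1" using n by (simp add: t_def field_simps)
    finally show False by simp
  qed
  define \<delta> where "\<delta> = (\<lambda>i. if i = k then 1 else 0 :: real)"
  obtain p where p: "\<forall>i. i \<notin> I \<longrightarrow> p i = 0" "\<And>d. (\<forall>i. i \<notin> I \<longrightarrow> d i = 0) \<Longrightarrow> Q p d = Q \<delta> d"
    using insert.IH[of "Q \<delta>"] lin2 null by blast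
  obtain c where c: "\<forall>i. i \<notin> I \<longrightarrow> c i = 0" "\<And>d. (\<forall>i. i \<notin> I \<longrightarrow> d i = 0) \<Longrightarrow> Q c d = L d"
    using insert.IH[of L] insert.prems by blast
  define w where "w = (\<lambda>i. \<delta> i + (-1) * p i)"
  have wd: "Q w d = 0" if "\<forall>i. i \<notin> I \<longrightarrow> d i = 0" for d
    unfolding w_def lin using p(2)[OF that] by simp
  have split: "d = (\<lambda>i. (d i - d k * w i) + d k * w i)" for d by auto
  have sd: "\<forall>i. i \<notin> I \<longrightarrow> d i - d k * w i = 0" if "\<forall>i. i \<notin> insert k I \<longrightarrow> d i = 0" for d
    using that p(1) insert.hyps by (auto simp: w_def \<delta>_def)
  define t where "t = (if Q w w = 0 then 0 else (L w - Q c w) / Q w w)"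
  have tw: "t * Q w w = L w - Q c w"
    using insert.prems(2)[of w] null[of w c] by (auto simp: t_def)
  define c' where "c' = (\<lambda>i. c i + t * w i)"
  have "Q c' d = L d" if d: "\<forall>i. i \<notin> insert k I \<longrightarrow> d i = 0" for d
  proof -
    let ?d = "\<lambda>i. d i - d k * w i"
    have "Q c' d = Q c' ?d + d k * Q c' w" using lin2[of c' ?d "d k" w] by simp
    also have "\<dots> = Q c ?d + d k * (Q c w + t * Q w w)"
      unfolding c'_def lin using wd[OF sd[OF d]] by simp
    also have "\<dots> = L ?d + d k * L w" using c(2)[OF sd[OF d]] tw by simp
    also have "\<dots> = L d" using insert.prems(1)[of ?d "d k" w] by simp
    finally show ?thesis .
  qed
  moreover have "\<forall>i. i \<notin> insert k I \<longrightarrow> c' i = 0" using c(1) p(1) by (auto simp: c'_def w_def \<delta>_def)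
  ultimately show ?case by blast
qed

section \<open>Integrals over a triangulation\<close>

context mesh
begin

lemma bounded_interior_mesh: "T \<in> \<T> \<Longrightarrow> bounded T" "T \<in> \<T> \<Longrightarrow> compact T" "T \<in> \<T> \<Longrightarrow> convex T"
  by (metis mesh_tri tri_def bounded_convex_hull finite.emptyI finite.insertI finite_imp_bounded,
      metis mesh_tri tri_def compact_convex_hull finite.emptyI finite.insertI finite_imp_compact,
      metis mesh_tri tri_def convex_convex_hull)

lemma set_integrable_mesh:
  assumes "T \<in> \<T>" "continuous_on UNIV f"
  shows "set_integrable lborel (interior T) (f :: real^2 \<Rightarrow> real)"
proof -
  obtain p q r where t: "tri T p q r" using mesh_tri[OF assms(1)] .
  then show ?thesis using integral_open_triangle(1)[OF assms(2), of q p r] by (auto simp: tri_def)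
qed

lemma integral_mesh_sum:
  fixes G :: "(real^2) set \<Rightarrow> real^2 \<Rightarrow> real"
  assumes c: "\<And>T. T \<in> \<T> \<Longrightarrow> continuous_on UNIV (G T)"
  shows "integrable lborel (\<lambda>z. \<Sum>T\<in>\<T>. indicator (interior T) z * G T z)"
    and "(LINT z|lborel. (\<Sum>T\<in>\<T>. indicator (interior T) z * G T z)) = (\<Sum>T\<in>\<T>. LINT z:interior T|lborel. G T z)"
proof -
  have i: "integrable lborel (\<lambda>z. indicator (interior T) z * G T z)" if "T \<in> \<T>" for T
    using set_integrable_mesh[OF that c[OF that]] by (simp add: set_integrable_def)
  then show "integrable lborel (\<lambda>z. \<Sum>T\<in>\<T>. indicator (interior T) z * G T z)"
    by (intro Bochner_Integration.integrable_sum)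
  show "(LINT z|lborel. (\<Sum>T\<in>\<T>. indicator (interior T) z * G T z)) = (\<Sum>T\<in>\<T>. LINT z:interior T|lborel. G T z)"
    using i by (subst Bochner_Integration.integral_sum) (auto simp: set_lebesgue_integral_def)
qed

lemma sum_indicator_mesh:
  fixes G :: "(real^2) set \<Rightarrow> 'a :: real_vector"
  assumes "T \<in> \<T>" "z \<in> interior T"
  shows "(\<Sum>T\<in>\<T>. indicator (interior T) z *\<^sub>R G T) = G T"
proof -
  have "(\<Sum>T'\<in>\<T>. indicator (interior T') z *\<^sub>R G T') = (\<Sum>T'\<in>\<T>. if T' = T then G T else 0)"
    using interiors_disjoint[OF assms(1)] assms by (intro sum.cong) (auto simp: indicator_def)
  then show ?thesis using assms finite_mesh by simp
qed

lemma negligible_skeleton: "negligible (\<Union>T\<in>\<T>. frontier T)"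
  using finite_mesh bounded_interior_mesh by (intro negligible_Union) (auto intro: negligible_convex_frontier)

text \<open>
  Off the union of the edges, a null set, the domain is the disjoint union of the open triangles. Functions
  are prescribed on these only, so measurability comes from completeness of Lebesgue measure.
\<close>

lemma integral_lebesgue_mesh:
  fixes F :: "real^2 \<Rightarrow> real"
  assumes \<Omega>: "open \<Omega>" "interior (closure \<Omega>) = \<Omega>" "\<Union>\<T> = closure \<Omega>"
    and F: "\<And>T x. T \<in> \<T> \<Longrightarrow> x \<in> interior T \<Longrightarrow> F x = G T x"
    and c: "\<And>T. T \<in> \<T> \<Longrightarrow> continuous_on UNIV (G T)"
  shows "integrable (lebesgue_on \<Omega>) F"
    and "(LINT x|lebesgue_on \<Omega>. F x) = (\<Sum>T\<in>\<T>. LINT z:interior T|lborel. G T z)"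
proof -
  let ?G = "\<lambda>z. \<Sum>T\<in>\<T>. indicator (interior T) z * G T z"
  have S: "\<Omega> \<in> sets lebesgue" using \<Omega>(1) by (simp add: borel_open)
  have sub: "interior T \<subseteq> \<Omega>" if "T \<in> \<T>" for T
    using that \<Omega> interior_mono[of T "closure \<Omega>"] by auto
  have eq: "indicator \<Omega> x * F x = ?G x" if x: "x \<notin> (\<Union>T\<in>\<T>. frontier T)" for x
  proof (cases "\<exists>T\<in>\<T>. x \<in> interior T")
    case True
    then obtain T where T: "T \<in> \<T>" "x \<in> interior T" by auto
    then show ?thesis using sum_indicator_mesh[OF T, of "\<lambda>T. G T x"] F[OF T] subsetD[OF sub[OF T(1)] T(2)] by auto
  next
    case False
    have "x \<notin> closure \<Omega>"
    proof
      assume "x \<in> closure \<Omega>"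
      then obtain T where T: "T \<in> \<T>" "x \<in> T" using \<Omega>(3) by blast
      have "closed T" using bounded_interior_mesh(2)[OF T(1)] by (rule compact_imp_closed)
      then have "x \<in> frontier T \<or> x \<in> interior T" using T by (auto simp: frontier_def)
      then show False using x False T by auto
    qed
    then have "x \<notin> \<Omega>" using closure_subset by blast
    moreover have "?G x = 0" using False by (intro sum.neutral) auto
    ultimately show ?thesis by simp
  qed
  have ae: "AE x in lebesgue. ?G x = indicator \<Omega> x * F x"
  proof (rule AE_I')
    show "(\<Union>T\<in>\<T>. frontier T) \<in> null_sets lebesgue"
      using negligible_skeleton by (simp add: negligible_iff_null_sets)
    show "{x \<in> space lebesgue. ?G x \<noteq> indicator \<Omega> x * F x} \<subseteq> (\<Union>T\<in>\<T>. frontier T)"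
      using eq by force
  qed
  have i: "integrable lebesgue ?G" using integral_mesh_sum(1)[OF c] by (rule integrable_completion[THEN iffD2, rotated]) (use integral_mesh_sum(1)[OF c] in auto)
  have mG: "?G \<in> borel_measurable lebesgue" using i by auto
  have mF: "(\<lambda>x. indicator \<Omega> x * F x) \<in> borel_measurable lebesgue"
    by (rule borel_measurable_AE[OF mG ae])
  have "integrable lebesgue (\<lambda>x. indicator \<Omega> x * F x)"
    using i ae mF mG by (subst integrable_cong_AE[of _ _ ?G]) auto
  then show "integrable (lebesgue_on \<Omega>) F"
    using S by (simp add: integrable_restrict_space)
  have "(LINT x|lebesgue_on \<Omega>. F x) = (LINT x|lebesgue. indicator \<Omega> x * F x)"
    using S by (simp add: integral_restrict_space)
  also have "\<dots> = (LINT x|lebesgue. ?G x)"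
    using ae mF mG by (intro integral_cong_AE) auto
  also have "\<dots> = (LINT x|lborel. ?G x)"
    using integral_mesh_sum(1)[OF c] by (intro integral_completion) auto
  finally show "(LINT x|lebesgue_on \<Omega>. F x) = (\<Sum>T\<in>\<T>. LINT z:interior T|lborel. G T z)"
    using integral_mesh_sum(2)[OF c] by simp
qed

end

definition edge_avg :: "(real^2) set \<Rightarrow> (real^2 \<Rightarrow> real) \<Rightarrow> real" where
  "edge_avg e f = integral {0..1} (\<lambda>t. f (fst (ends e) + t *\<^sub>R edge_vec e))"

lemma edge_avg_segment: "edge_avg (closed_segment a b) f = integral {0..1} (\<lambda>t. f (a + t *\<^sub>R (b - a)))"
proof -
  have "integral {0..1} (\<lambda>t. f (b + t *\<^sub>R (a - b))) = integral {0..1} (\<lambda>t. f (a + t *\<^sub>R (b - a)))"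
  proof -
    have "integral {0..1} (\<lambda>t. f (b + t *\<^sub>R (a - b))) = integral {-1..0} (\<lambda>t. f (b + (- t) *\<^sub>R (a - b)))"
      using Henstock_Kurzweil_Integration.integral_reflect_real[of 1 0 "\<lambda>t. f (b + t *\<^sub>R (a - b))"] by simp
    also have "\<dots> = integral {0..1} ((\<lambda>t. f (b + (- t) *\<^sub>R (a - b))) \<circ> (+) (-1))"
      using integral_shift_Icc_real[of 0 1 "\<lambda>t. f (b + (- t) *\<^sub>R (a - b))" "-1"] by simp
    also have "\<dots> = integral {0..1} (\<lambda>t. f (a + t *\<^sub>R (b - a)))"
      by (intro integral_cong) (simp add: algebra_simps)
    finally show ?thesis by simp
  qed
  then show ?thesis using ends_segment[of a b] by (auto simp: edge_avg_def edge_vec_def)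
qed

text \<open>
  The field on the left is affine with divergence \<open>- (1/3) \<Sum> k\<close>. It is a combination of the three radial fields
  from the vertices, since \<open>m\<close> is a combination of them too; the radial flux identity then evaluates it by edge means.
\<close>

lemma tri_flux:
  fixes \<eta> :: "real^2 \<Rightarrow> real"
  assumes t: "tri T p q r"
    and d: "\<And>z. (\<eta> has_derivative (\<lambda>h. \<eta>1 z * h$1 + \<eta>2 z * h$2)) (at z)"
    and c: "continuous_on UNIV \<eta>1" "continuous_on UNIV \<eta>2"
  shows "(LINT z:interior T|lborel.
      (m$1 - (1/6) * (\<Sum>e\<in>edges T. k e * (z - opp T e)$1)) * \<eta>1 z + (m$2 - (1/6) * (\<Sum>e\<in>edges T. k e * (z - opp T e)$2)) * \<eta>2 z)
    = (\<Sum>e\<in>edges T. (m \<bullet> edge_normal T e - tarea T / 3 * k e) * edge_avg e \<eta>)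
      + (1/3) * (\<Sum>e\<in>edges T. k e) * (LINT z:interior T|lborel. \<eta> z)"
proof -
  let ?D = "cross (q - p) (r - p)"
  have D: "0 < ?D" and T: "T = convex hull {p, q, r}" using t by (auto simp: tri_def)
  have ce: "continuous_on UNIV \<eta>"
    by (intro differentiable_imp_continuous_on) (auto simp: differentiable_on_def differentiable_def intro: d has_derivative_at_withinI)
  define A where "A p z = (z$1 - p$1) * \<eta>1 z + (z$2 - p$2) * \<eta>2 z + 2 * \<eta> z" for p z :: "real^2"
  have Ac: "continuous_on UNIV (A p)" for p unfolding A_def by (intro continuous_intros c ce)
  have si: "set_integrable lborel (interior T) f" if "continuous_on UNIV f" for f :: "real^2 \<Rightarrow> real"
    using integral_open_triangle(1)[OF that, of q p r] D T by auto
  have flux: "(LINT z:interior T|lborel. A p z) = cross (q - p) (r - p) * edge_avg (closed_segment q r) \<eta>"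
    if "tri T p q r" for p q r
    using radial_flux_open_triangle[of q p r \<eta> \<eta>1 \<eta>2, OF _ d c] that
    unfolding A_def edge_avg_segment by (auto simp: tri_def)
  note t2 = tri_rotate[OF t] and t3 = tri_rotate2[OF t]
  have D2: "cross (r - q) (p - q) = ?D" "cross (p - r) (q - r) = ?D" by (simp_all add: cross_def algebra_simps)
  define e1 e2 e3 where "e1 = closed_segment q r" and "e2 = closed_segment r p" and "e3 = closed_segment p q"
  note N = edge_normal_tri[OF t] edge_normal_tri[OF t2] edge_normal_tri[OF t3]
  note O = opp_tri[OF t] opp_tri[OF t2] opp_tri[OF t3]
  have se: "(\<Sum>e\<in>edges T. f e) = f e1 + f e2 + f e3" for f :: "_ \<Rightarrow> real"
    unfolding e1_def e2_def e3_def by (rule sum_edges_tri[OF t])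
  let ?a1 = "(m \<bullet> rot (r - q)) / ?D - k e1 / 6" and ?a2 = "(m \<bullet> rot (p - r)) / ?D - k e2 / 6"
    and ?a3 = "(m \<bullet> rot (q - p)) / ?D - k e3 / 6"
  have pw: "(m$1 - (1/6) * (\<Sum>e\<in>edges T. k e * (z - opp T e)$1)) * \<eta>1 z + (m$2 - (1/6) * (\<Sum>e\<in>edges T. k e * (z - opp T e)$2)) * \<eta>2 z
     = (?a1 * A p z + ?a2 * A q z + ?a3 * A r z) + ((1/3) * (k e1 + k e2 + k e3)) * \<eta> z" for z
  proof -
    have m: "(m \<bullet> rot (r - q)) * A p z + (m \<bullet> rot (p - r)) * A q z + (m \<bullet> rot (q - p)) * A r z = ?D * (m$1 * \<eta>1 z + m$2 * \<eta>2 z)"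
      by (simp add: A_def rot_def inner_vec_def sum_2 cross_def algebra_simps)
    have "m$1 * \<eta>1 z + m$2 * \<eta>2 z = ((m \<bullet> rot (r - q)) * A p z + (m \<bullet> rot (p - r)) * A q z + (m \<bullet> rot (q - p)) * A r z) / ?D"
      unfolding m using D by simp
    also have "\<dots> = (m \<bullet> rot (r - q)) / ?D * A p z + (m \<bullet> rot (p - r)) / ?D * A q z + (m \<bullet> rot (q - p)) / ?D * A r z"
      by (simp add: add_divide_distrib)
    finally have m': "m$1 * \<eta>1 z + m$2 * \<eta>2 z = \<dots>" .
    have Ap: "A p z - 2 * \<eta> z = (z - p)$1 * \<eta>1 z + (z - p)$2 * \<eta>2 z" for p by (simp add: A_def)
    have "(m$1 - (1/6) * (\<Sum>e\<in>edges T. k e * (z - opp T e)$1)) * \<eta>1 z + (m$2 - (1/6) * (\<Sum>e\<in>edges T. k e * (z - opp T e)$2)) * \<eta>2 z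
      = (m$1 * \<eta>1 z + m$2 * \<eta>2 z) - (k e1 / 6 * (A p z - 2 * \<eta> z) + k e2 / 6 * (A q z - 2 * \<eta> z) + k e3 / 6 * (A r z - 2 * \<eta> z))"
      unfolding se O[folded e1_def e2_def e3_def] Ap
      by (simp add: algebra_simps del: vector_minus_component)
    also have "\<dots> = (?a1 * A p z + ?a2 * A q z + ?a3 * A r z) + ((1/3) * (k e1 + k e2 + k e3)) * \<eta> z"
      unfolding m' by (simp add: algebra_simps)
    finally show ?thesis .
  qed
  have "(LINT z:interior T|lborel. (?a1 * A p z + ?a2 * A q z + ?a3 * A r z) + ((1/3) * (k e1 + k e2 + k e3)) * \<eta> z)
      = (LINT z:interior T|lborel. ?a1 * A p z + ?a2 * A q z + ?a3 * A r z) + (LINT z:interior T|lborel. ((1/3) * (k e1 + k e2 + k e3)) * \<eta> z)"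
    by (intro set_integral_add(2) si continuous_intros Ac ce)
  also have "(LINT z:interior T|lborel. ?a1 * A p z + ?a2 * A q z + ?a3 * A r z)
      = (LINT z:interior T|lborel. ?a1 * A p z + ?a2 * A q z) + (LINT z:interior T|lborel. ?a3 * A r z)"
    by (intro set_integral_add(2) si continuous_intros Ac ce)
  also have "(LINT z:interior T|lborel. ?a1 * A p z + ?a2 * A q z)
      = (LINT z:interior T|lborel. ?a1 * A p z) + (LINT z:interior T|lborel. ?a2 * A q z)"
    by (intro set_integral_add(2) si continuous_intros Ac ce)
  finally have I: "(LINT z:interior T|lborel. (?a1 * A p z + ?a2 * A q z + ?a3 * A r z) + ((1/3) * (k e1 + k e2 + k e3)) * \<eta> z)
    = ?a1 * (?D * edge_avg e1 \<eta>) + ?a2 * (?D * edge_avg e2 \<eta>) + ?a3 * (?D * edge_avg e3 \<eta>)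
      + (1/3) * (k e1 + k e2 + k e3) * (LINT z:interior T|lborel. \<eta> z)"
    unfolding set_integral_mult_right flux[OF t] flux[OF t2] flux[OF t3] D2 e1_def[symmetric] e2_def[symmetric] e3_def[symmetric] .
  have a: "(x / ?D - l / 6) * (?D * E) = (x - ?D / 2 / 3 * l) * E" for x l E
    using D by (simp add: field_simps)
  show ?thesis
    unfolding pw I unfolding se N[folded e1_def e2_def e3_def] tarea_tri[OF t] a ..
qed


section \<open>Algebra of the stress on one triangle\<close>
text \<open>
  Row \<open>k\<close> of the constant part \<open>w I + S\<close> of the tensor. The factor \<open>1/12\<close> is the variance of the
  uniform distribution on an edge of unit length, with which jumps enter the stabilization.
\<close>

definition mean_stress ::
  "real \<Rightarrow> ((real^2) set \<Rightarrow> real) \<Rightarrow> (real^2) set \<Rightarrow> 2 \<Rightarrow> real^2" where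
  "mean_stress w j T k =
     w *\<^sub>R axis k 1 - (\<Sum>e\<in>edges T. (j e * outward_normal T e $ k / (12 * tarea T)) *\<^sub>R edge_vec e)"

text \<open>
  Row \<open>k\<close> of the whole tensor \<open>X = w I + S + E\<close>.
\<close>

definition stress ::
  "((real^2) set \<Rightarrow> real^2) \<Rightarrow> real \<Rightarrow> ((real^2) set \<Rightarrow> real) \<Rightarrow> (real^2) set \<Rightarrow> 2 \<Rightarrow> real^2 \<Rightarrow> real^2" where
  "stress C w j T k z = mean_stress w j T k - (1/6) *\<^sub>R (\<Sum>e\<in>edges T. C e $ k *\<^sub>R (z - opp T e))"

lemma triangle_cross_bounds:
  assumes t: "tri T p q r" and z: "z \<in> T"
  shows "0 \<le> cross (r - q) (z - q)" "cross (r - q) (z - q) \<le> cross (q - p) (r - p)"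
proof -
  obtain u v w where z: "0 \<le> u" "0 \<le> v" "0 \<le> w" "u + v + w = 1" "z = u *\<^sub>R p + v *\<^sub>R q + w *\<^sub>R r"
    using t z unfolding tri_def convex_hull_3 by auto
  have v: "v = 1 - u - w" using z(4) by simp
  have "cross (r - q) (z - q) = u * cross (q - p) (r - p)"
    unfolding z(5) v by (simp add: cross_def algebra_simps)
  moreover have "0 < cross (q - p) (r - p)" using t by (simp add: tri_def)
  moreover have "u \<le> 1" using z by simp
  ultimately show "0 \<le> cross (r - q) (z - q)" "cross (r - q) (z - q) \<le> cross (q - p) (r - p)"
    using z by (auto simp: mult_left_le_one_le)
qed

lemma cross_le_norm: "\<bar>cross a b\<bar> \<le> norm a * norm b"
  using Cauchy_Schwarz_ineq2[of "rot a" b] by (simp add: rot_inner)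

text \<open>
  The sign that depends on the orientation of the edge is absorbed into \<open>s\<close>.
\<close>

lemma edge_dyad:
  assumes "tri T p q r"
  obtains s where "\<bar>s\<bar> * norm (r - q) = \<bar>x\<bar>"
    "\<And>k l. x * outward_normal T (closed_segment q r) $ k * edge_vec (closed_segment q r) $ l = s * rot (r - q) $ k * (r - q) $ l"
proof -
  have n: "0 < norm (r - q)" using tri_neq[OF assms] by auto
  note N = outward_normal_tri[OF assms]
  from edge_vec_segment[of q r] show ?thesis
  proof
    assume v: "edge_vec (closed_segment q r) = r - q"
    show ?thesis by (rule that[of "x / norm (r - q)"]) (use n in \<open>simp_all add: N v abs_divide\<close>)
  next
    assume v: "edge_vec (closed_segment q r) = q - r"
    have "(q - r) $ l = - ((r - q) $ l)" for l by simp
    then show ?thesis by (intro that[of "- x / norm (r - q)"]) (use n in \<open>simp_all only: N v, simp_all add: abs_divide right_diff_distrib diff_divide_distrib\<close>)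
  qed
qed

lemma sum3_squares: "(a + b + c)\<^sup>2 \<le> 3 * (a\<^sup>2 + b\<^sup>2 + c\<^sup>2)" for a b c :: real
proof -
  have "0 \<le> (a - b)\<^sup>2 + (b - c)\<^sup>2 + (c - a)\<^sup>2" by simp
  then show ?thesis by (simp add: power2_eq_square algebra_simps)
qed

text \<open>
  Since \<open>S\<close> is traceless, the deviation \<open>det X - (tr X / 2)\<^sup>2\<close> is \<open>det S + (det E - (tr E / 2)\<^sup>2) - tr (S E)\<close>
  and does not contain \<open>w\<close>. The terms are bounded as follows, with \<open>\<Delta> = 2 |T|\<close>: \<open>36 det S\<close> is the sum of the
  products \<open>s_i s_k\<close>, and \<open>\<Delta> \<le> |d_i| |d_k|\<close>; the entries of \<open>E\<close> are bounded by the size of the square;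
  \<open>tr (S E)\<close> contains the positions only through cross products of edges with \<open>z - p\<close>, \<open>z - q\<close>, \<open>z - r\<close>, and
  these are at most \<open>\<Delta>\<close>, which cancels the \<open>1 / \<Delta>\<close> in \<open>S\<close>.
  Within the proof the tensors are scaled by \<open>- 6 \<Delta>\<close> and by \<open>- 6\<close>.
\<close>

lemma local_stress_bounds:
  fixes \<rho> w :: real and C :: "(real^2) set \<Rightarrow> real^2" and j :: "(real^2) set \<Rightarrow> real"
  assumes t: "tri T p q r" and sq: "T \<subseteq> plane_square \<rho>" and z: "z \<in> T"
  defines "X \<equiv> \<lambda>k l. stress C w j T k z $ l"
  shows "tarea T * \<bar>X 1 1 * X 2 2 - X 1 2 * X 2 1 - ((X 1 1 + X 2 2) / 2)\<^sup>2\<bar>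
      \<le> (1/18) * (\<Sum>e\<in>edges T. (j e)\<^sup>2) + (7/2) * \<rho>\<^sup>2 * (tarea T / 3 * (\<Sum>e\<in>edges T. (norm (C e))\<^sup>2))"
    and "w\<^sup>2 \<le> 2 * ((X 1 1 + X 2 2) / 2)\<^sup>2 + 2 * \<rho>\<^sup>2 * ((1/3) * (\<Sum>e\<in>edges T. (norm (C e))\<^sup>2))"
proof -
  define e1 e2 e3 where "e1 = closed_segment q r" and "e2 = closed_segment r p" and "e3 = closed_segment p q"
  have se: "(\<Sum>e\<in>edges T. f e) = f e1 + f e2 + f e3" for f :: "_ \<Rightarrow> 'x :: comm_monoid_add"
    unfolding e1_def e2_def e3_def by (rule sum_edges_tri[OF t])
  note t2 = tri_rotate[OF t] and t3 = tri_rotate2[OF t]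
  define \<Delta> where "\<Delta> = cross (q - p) (r - p)"
  have \<Delta>: "0 < \<Delta>" using t by (simp add: tri_def \<Delta>_def)
  have rotD: "cross (r - q) (p - q) = \<Delta>" "cross (p - r) (q - r) = \<Delta>" by (simp_all add: \<Delta>_def cross_def algebra_simps)
  have ta: "tarea T = \<Delta> / 2" using tarea_tri[OF t] by (simp add: \<Delta>_def)
  define d1 d2 d3 where "d1 = r - q" and "d2 = p - r" and "d3 = q - p"
  obtain s1 where s1: "\<bar>s1\<bar> * norm d1 = \<bar>j e1\<bar>" "\<And>k l. j e1 * outward_normal T e1 $ k * edge_vec e1 $ l = s1 * rot d1 $ k * d1 $ l"
    using edge_dyad[OF t, of "j e1"] unfolding e1_def d1_def by metis
  obtain s2 where s2: "\<bar>s2\<bar> * norm d2 = \<bar>j e2\<bar>" "\<And>k l. j e2 * outward_normal T e2 $ k * edge_vec e2 $ l = s2 * rot d2 $ k * d2 $ l"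
    using edge_dyad[OF t2, of "j e2"] unfolding e2_def d2_def by metis
  obtain s3 where s3: "\<bar>s3\<bar> * norm d3 = \<bar>j e3\<bar>" "\<And>k l. j e3 * outward_normal T e3 $ k * edge_vec e3 $ l = s3 * rot d3 $ k * d3 $ l"
    using edge_dyad[OF t3, of "j e3"] unfolding e3_def d3_def by metis
  have cr: "cross d1 d2 = \<Delta>" "cross d2 d3 = \<Delta>" "cross d3 d1 = \<Delta>"
    by (simp_all add: d1_def d2_def d3_def \<Delta>_def cross_def algebra_simps)
  define y1 y2 y3 where "y1 = z - p" and "y2 = z - q" and "y3 = z - r"
  have op: "opp T e1 = p" "opp T e2 = q" "opp T e3 = r"
    using opp_tri[OF t] opp_tri[OF t2] opp_tri[OF t3] by (simp_all add: e1_def e2_def e3_def)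
  define S where "S k l = s1 * rot d1 $ k * d1 $ l + s2 * rot d2 $ k * d2 $ l + s3 * rot d3 $ k * d3 $ l" for k l
  define E where "E k l = C e1 $ k * y1 $ l + C e2 $ k * y2 $ l + C e3 $ k * y3 $ l" for k l
  have X: "X k l = w * axis k 1 $ l - S k l / (6 * \<Delta>) - E k l / 6" for k l
    unfolding X_def stress_def mean_stress_def se op S_def s1(2)[symmetric] s2(2)[symmetric] s3(2)[symmetric] ta E_def y1_def y2_def y3_def
    by (simp add: add_divide_distrib)
  have trS: "S 1 1 + S 2 2 = 0" by (simp add: S_def rot_def)
  then have S22: "S 2 2 = - S 1 1" by simp
  have detS: "S 1 1 * S 2 2 - S 1 2 * S 2 1 = \<Delta>\<^sup>2 * (s1 * s2 + s2 * s3 + s3 * s1)"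
  proof -
    have "S 1 1 * S 2 2 - S 1 2 * S 2 1 = s1 * s2 * (cross d1 d2)\<^sup>2 + s2 * s3 * (cross d2 d3)\<^sup>2 + s3 * s1 * (cross d3 d1)\<^sup>2"
      by (simp add: S_def rot_def cross_def power2_eq_square algebra_simps)
    then show ?thesis unfolding cr by (simp add: algebra_simps)
  qed
  let ?tr = "S 1 1 * E 1 1 + S 1 2 * E 2 1 + S 2 1 * E 1 2 + S 2 2 * E 2 2"
  have D: "X 1 1 * X 2 2 - X 1 2 * X 2 1 - ((X 1 1 + X 2 2) / 2)\<^sup>2 =
      (s1 * s2 + s2 * s3 + s3 * s1) / 36 + (E 1 1 * E 2 2 - E 1 2 * E 2 1 - ((E 1 1 + E 2 2) / 2)\<^sup>2) / 36 - ?tr / (36 * \<Delta>)"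
  proof -
    define A where "A k l = S k l / \<Delta>" for k l
    have A22: "A 2 2 = - A 1 1" by (simp add: A_def S22)
    have A: "A 1 1 * A 2 2 - A 1 2 * A 2 1 = s1 * s2 + s2 * s3 + s3 * s1"
      using \<Delta> detS by (simp add: A_def diff_divide_distrib[symmetric] power2_eq_square)
    have tr: "?tr / (36 * \<Delta>) = (A 1 1 * E 1 1 + A 1 2 * E 2 1 + A 2 1 * E 1 2 + A 2 2 * E 2 2) / 36"
      by (simp add: A_def add_divide_distrib)
    have X': "X k l = w * axis k 1 $ l - A k l / 6 - E k l / 6" for k l
      unfolding X A_def by simp
    show ?thesis unfolding tr A[symmetric] X' A22
      by (simp add: axis_def power2_eq_square field_simps)
  qed
  have in': "p \<in> T" "q \<in> T" "r \<in> T" using t by (auto simp: tri_def intro: hull_inc)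
  have bd: "\<bar>x $ k\<bar> \<le> \<rho>" if "x \<in> T" for x k
    using subsetD[OF sq that] exhaust_2[of k] by auto
  have \<rho>: "0 \<le> \<rho>" using bd[OF z, of 1] by linarith
  have diff: "\<bar>(x - y) $ k\<bar> \<le> 2 * \<rho>" if "x \<in> T" "y \<in> T" for x y k
    using bd[OF that(1), of k] bd[OF that(2), of k] by simp
  have area: "tarea T \<le> 4 * \<rho>\<^sup>2"
  proof -
    have "\<bar>(q - p)$1 * (r - p)$2\<bar> \<le> (2 * \<rho>) * (2 * \<rho>)" "\<bar>(q - p)$2 * (r - p)$1\<bar> \<le> (2 * \<rho>) * (2 * \<rho>)"
      unfolding abs_mult by (intro mult_mono diff in' abs_ge_zero; use \<rho> in simp)+
    then have "\<Delta> \<le> 8 * \<rho>\<^sup>2" unfolding \<Delta>_def cross_def power2_eq_square by linarith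
    then show ?thesis by (simp add: ta)
  qed
  let ?s = "norm (C e1) + norm (C e2) + norm (C e3)" and ?c = "(norm (C e1))\<^sup>2 + (norm (C e2))\<^sup>2 + (norm (C e3))\<^sup>2"
  let ?J = "\<bar>j e1\<bar> + \<bar>j e2\<bar> + \<bar>j e3\<bar>" and ?j = "(j e1)\<^sup>2 + (j e2)\<^sup>2 + (j e3)\<^sup>2"
  have s: "?s\<^sup>2 \<le> 3 * ?c" by (rule sum3_squares)
  have J: "?J\<^sup>2 \<le> 3 * ?j" using sum3_squares[of "\<bar>j e1\<bar>" "\<bar>j e2\<bar>" "\<bar>j e3\<bar>"] by simp
  have Eb: "\<bar>E k l\<bar> \<le> 2 * \<rho> * ?s" for k l
  proof -
    have "\<bar>C e $ k * (z - x) $ l\<bar> \<le> norm (C e) * (2 * \<rho>)" if "x \<in> T" for e x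
      unfolding abs_mult by (intro mult_mono component_le_norm_cart diff z that norm_ge_zero abs_ge_zero)
    from this[OF in'(1), of e1] this[OF in'(2), of e2] this[OF in'(3), of e3]
    show ?thesis unfolding E_def y1_def y2_def y3_def by (simp add: algebra_simps)
  qed
  have m2: "(2 * \<rho> * ?s)\<^sup>2 \<le> 36 * \<rho>\<^sup>2 * (?c / 3)"
  proof -
    have "(2 * \<rho> * ?s)\<^sup>2 = 4 * \<rho>\<^sup>2 * ?s\<^sup>2" unfolding power_mult_distrib by simp
    also have "\<dots> \<le> 4 * \<rho>\<^sup>2 * (3 * ?c)" by (intro mult_left_mono s) simp
    finally show ?thesis by (simp add: algebra_simps)
  qed
  have Ep: "\<bar>E k l * E k' l'\<bar> \<le> 36 * \<rho>\<^sup>2 * (?c / 3)" for k l k' l'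
  proof -
    have "\<bar>E k l * E k' l'\<bar> \<le> (2 * \<rho> * ?s) * (2 * \<rho> * ?s)"
      unfolding abs_mult by (intro mult_mono Eb) (use \<rho> in auto)
    then show ?thesis using m2 unfolding power2_eq_square[of "2 * \<rho> * ?s"] by (rule order_trans)
  qed
  have trE: "((E 1 1 + E 2 2) / 2)\<^sup>2 \<le> 36 * \<rho>\<^sup>2 * (?c / 3)"
  proof -
    have "\<bar>(a + b) / 2\<bar> \<le> m" if "\<bar>a\<bar> \<le> m" "\<bar>b\<bar> \<le> m" for a b m :: real using that by (auto simp: abs_le_iff field_simps)
    then have "\<bar>(E 1 1 + E 2 2) / 2\<bar> \<le> 2 * \<rho> * ?s" using Eb by blast
    then have "((E 1 1 + E 2 2) / 2)\<^sup>2 \<le> (2 * \<rho> * ?s)\<^sup>2" by (rule power2_le_iff_abs_le[THEN iffD2, rotated]) (use \<rho> in simp)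
    then show ?thesis using m2 by (rule order_trans)
  qed
  have b1: "\<Delta> / 2 * \<bar>(s1 * s2 + s2 * s3 + s3 * s1) / 36\<bar> \<le> ?j / 72"
  proof -
    have p: "\<bar>\<Delta> * (s * s')\<bar> \<le> ((j e)\<^sup>2 + (j e')\<^sup>2) / 2"
      if "\<bar>s\<bar> * norm d = \<bar>j e\<bar>" "\<bar>s'\<bar> * norm d' = \<bar>j e'\<bar>" "cross d d' = \<Delta>" for s s' d d' e e'
    proof -
      have "\<bar>\<Delta> * (s * s')\<bar> = \<bar>cross d d'\<bar> * (\<bar>s\<bar> * \<bar>s'\<bar>)" by (simp add: that(3) abs_mult)
      also have "\<dots> \<le> (norm d * norm d') * (\<bar>s\<bar> * \<bar>s'\<bar>)" by (intro mult_right_mono cross_le_norm) simp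
      also have "\<dots> = \<bar>j e\<bar> * \<bar>j e'\<bar>" unfolding that(1,2)[symmetric] by simp
      also have "\<dots> \<le> ((j e)\<^sup>2 + (j e')\<^sup>2) / 2"
        using sum_squares_bound[of "\<bar>j e\<bar>" "\<bar>j e'\<bar>"] by simp
      finally show ?thesis .
    qed
    have "\<Delta> / 2 * \<bar>(s1 * s2 + s2 * s3 + s3 * s1) / 36\<bar> = \<bar>\<Delta> * (s1 * s2) + \<Delta> * (s2 * s3) + \<Delta> * (s3 * s1)\<bar> / 72"
      using \<Delta> by (simp add: abs_mult distrib_left[symmetric])
    also have "\<dots> \<le> ?j / 72"
    proof (rule divide_right_mono)
      have "\<bar>a + b + c\<bar> \<le> x + y + z" if "\<bar>a\<bar> \<le> (x + y) / 2" "\<bar>b\<bar> \<le> (y + z) / 2" "\<bar>c\<bar> \<le> (z + x) / 2"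
        for a b c x y z :: real
        using that abs_triangle_ineq[of "a + b" c] abs_triangle_ineq[of a b] by (simp add: field_simps)
      then show "\<bar>\<Delta> * (s1 * s2) + \<Delta> * (s2 * s3) + \<Delta> * (s3 * s1)\<bar> \<le> ?j"
        using p[OF s1(1) s2(1) cr(1)] p[OF s2(1) s3(1) cr(2)] p[OF s3(1) s1(1) cr(3)] by blast
    qed simp
    finally show ?thesis .
  qed
  have cb: "\<bar>cross d y\<bar> \<le> \<Delta>" if "d \<in> {d1, d2, d3}" "y \<in> {y1, y2, y3}" for d y
  proof -
    have a: "0 \<le> cross d1 y2" "cross d1 y2 \<le> \<Delta>" "0 \<le> cross d2 y3" "cross d2 y3 \<le> \<Delta>" "0 \<le> cross d3 y1" "cross d3 y1 \<le> \<Delta>"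
      using triangle_cross_bounds[OF t z] triangle_cross_bounds[OF t2 z] triangle_cross_bounds[OF t3 z]
      unfolding rotD by (simp_all add: d1_def d2_def d3_def y1_def y2_def y3_def \<Delta>_def)
    have b: "cross d1 y3 = cross d1 y2" "cross d1 y1 = cross d1 y2 - \<Delta>" "cross d2 y1 = cross d2 y3" "cross d2 y2 = cross d2 y3 - \<Delta>"
        "cross d3 y2 = cross d3 y1" "cross d3 y3 = cross d3 y1 - \<Delta>"
      by (simp_all add: d1_def d2_def d3_def y1_def y2_def y3_def \<Delta>_def cross_def algebra_simps)
    show ?thesis using that a \<Delta> by (auto simp: b)
  qed
  have b2: "\<bar>?tr\<bar> \<le> \<Delta> * (?J * ?s)"
  proof -
    let ?B = "\<lambda>s d c y. s * (d \<bullet> c) * (rot d \<bullet> y)"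
    have B: "\<bar>?B s d c y\<bar> \<le> \<bar>j e\<bar> * norm c * \<Delta>"
      if "\<bar>s\<bar> * norm d = \<bar>j e\<bar>" "d \<in> {d1, d2, d3}" "y \<in> {y1, y2, y3}" for s d c y e
    proof -
      have "\<bar>?B s d c y\<bar> = \<bar>s\<bar> * \<bar>d \<bullet> c\<bar> * \<bar>cross d y\<bar>" by (simp add: abs_mult rot_inner)
      also have "\<dots> \<le> \<bar>s\<bar> * (norm d * norm c) * \<Delta>"
        by (intro mult_mono Cauchy_Schwarz_ineq2 cb that order_refl) auto
      also have "\<dots> = \<bar>j e\<bar> * norm c * \<Delta>" unfolding that(1)[symmetric] by simp
      finally show ?thesis .
    qed
    have trB: "?tr = (?B s1 d1 (C e1) y1 + ?B s1 d1 (C e2) y2 + ?B s1 d1 (C e3) y3)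
      + (?B s2 d2 (C e1) y1 + ?B s2 d2 (C e2) y2 + ?B s2 d2 (C e3) y3)
      + (?B s3 d3 (C e1) y1 + ?B s3 d3 (C e2) y2 + ?B s3 d3 (C e3) y3)"
      by (simp add: S_def E_def inner_vec_def sum_2 algebra_simps)
    have JB: "\<Delta> * (?J * ?s) = (\<bar>j e1\<bar> * norm (C e1) * \<Delta> + \<bar>j e1\<bar> * norm (C e2) * \<Delta> + \<bar>j e1\<bar> * norm (C e3) * \<Delta>)
      + (\<bar>j e2\<bar> * norm (C e1) * \<Delta> + \<bar>j e2\<bar> * norm (C e2) * \<Delta> + \<bar>j e2\<bar> * norm (C e3) * \<Delta>)
      + (\<bar>j e3\<bar> * norm (C e1) * \<Delta> + \<bar>j e3\<bar> * norm (C e2) * \<Delta> + \<bar>j e3\<bar> * norm (C e3) * \<Delta>)"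
      by (simp add: algebra_simps)
    have three: "\<bar>a + b + c\<bar> \<le> x + y + z" if "\<bar>a\<bar> \<le> x" "\<bar>b\<bar> \<le> y" "\<bar>c\<bar> \<le> z" for a b c x y z :: real
      using that by linarith
    show ?thesis
      unfolding trB JB by (rule three; rule three; rule B) (use s1(1) s2(1) s3(1) in auto)
  qed
  have b3: "\<Delta> / 2 * \<bar>?tr / (36 * \<Delta>)\<bar> \<le> ?j / 24 + \<rho>\<^sup>2 / 2 * (\<Delta> / 2 * (?c / 3))"
  proof -
    have "\<Delta> / 2 * \<bar>?tr / (36 * \<Delta>)\<bar> = \<bar>?tr\<bar> / 72" using \<Delta> by (simp add: abs_mult abs_divide)
    also have "\<dots> \<le> \<Delta> * (?J * ?s) / 72" using b2 by (rule divide_right_mono) simp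
    also have "\<dots> = 2 * ?J * (\<Delta> / 2 * ?s) / 72" by simp
    also have "\<dots> \<le> (?J\<^sup>2 + (\<Delta> / 2 * ?s)\<^sup>2) / 72" by (intro divide_right_mono sum_squares_bound) simp
    also have "(\<Delta> / 2 * ?s)\<^sup>2 = \<Delta> / 2 * (\<Delta> / 2 * ?s\<^sup>2)" by (simp add: power2_eq_square)
    also have "(?J\<^sup>2 + \<dots>) / 72 \<le> (3 * ?j + \<Delta> / 2 * (4 * \<rho>\<^sup>2 * (3 * ?c))) / 72"
      using area \<Delta> \<rho> by (intro divide_right_mono add_mono J mult_left_mono mult_mono s) (auto simp: ta)
    also have "\<dots> = ?j / 24 + \<rho>\<^sup>2 / 2 * (\<Delta> / 2 * (?c / 3))" by (simp add: field_simps)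
    finally show ?thesis .
  qed
  have b4: "\<bar>(E 1 1 * E 2 2 - E 1 2 * E 2 1 - ((E 1 1 + E 2 2) / 2)\<^sup>2) / 36\<bar> \<le> 3 * \<rho>\<^sup>2 * (?c / 3)"
  proof -
    have "\<bar>(a - b - c) / 36\<bar> \<le> 3 * m" if "\<bar>a\<bar> \<le> 36 * m" "\<bar>b\<bar> \<le> 36 * m" "c \<le> 36 * m" "0 \<le> c" for a b c m :: real
      using that by (auto simp: abs_le_iff field_simps)
    from this[of "E 1 1 * E 2 2" "\<rho>\<^sup>2 * (?c / 3)" "E 1 2 * E 2 1" "((E 1 1 + E 2 2) / 2)\<^sup>2"] Ep trE
    show ?thesis by (simp add: mult.assoc)
  qed
  have "tarea T * \<bar>X 1 1 * X 2 2 - X 1 2 * X 2 1 - ((X 1 1 + X 2 2) / 2)\<^sup>2\<bar>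
      \<le> \<Delta> / 2 * \<bar>(s1 * s2 + s2 * s3 + s3 * s1) / 36\<bar> + \<Delta> / 2 * (3 * \<rho>\<^sup>2 * (?c / 3)) + \<Delta> / 2 * \<bar>?tr / (36 * \<Delta>)\<bar>"
    unfolding D ta distrib_left[symmetric]
  proof (rule mult_left_mono)
    have "\<bar>a + b - c\<bar> \<le> \<bar>a\<bar> + m + \<bar>c\<bar>" if "\<bar>b\<bar> \<le> m" for a b c m :: real using that by linarith
    then show "\<bar>(s1 * s2 + s2 * s3 + s3 * s1) / 36 + (E 1 1 * E 2 2 - E 1 2 * E 2 1 - ((E 1 1 + E 2 2) / 2)\<^sup>2) / 36 - ?tr / (36 * \<Delta>)\<bar>
      \<le> \<bar>(s1 * s2 + s2 * s3 + s3 * s1) / 36\<bar> + 3 * \<rho>\<^sup>2 * (?c / 3) + \<bar>?tr / (36 * \<Delta>)\<bar>" using b4 by blast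
  qed (use \<Delta> in simp)
  also have "\<dots> \<le> ?j / 72 + \<Delta> / 2 * (3 * \<rho>\<^sup>2 * (?c / 3)) + (?j / 24 + \<rho>\<^sup>2 / 2 * (\<Delta> / 2 * (?c / 3)))"
    using b1 b3 by linarith
  also have "\<dots> = (1/18) * ?j + (7/2) * \<rho>\<^sup>2 * (\<Delta> / 2 / 3 * ?c)" by (simp add: field_simps)
  finally show "tarea T * \<bar>X 1 1 * X 2 2 - X 1 2 * X 2 1 - ((X 1 1 + X 2 2) / 2)\<^sup>2\<bar>
      \<le> (1/18) * (\<Sum>e\<in>edges T. (j e)\<^sup>2) + (7/2) * \<rho>\<^sup>2 * (tarea T / 3 * (\<Sum>e\<in>edges T. (norm (C e))\<^sup>2))"
    unfolding se ta .
  have v: "(X 1 1 + X 2 2) / 2 = w - ((E 1 1 + E 2 2) / 2) / 6"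
    unfolding X S22 by (simp add: axis_def field_simps)
  have "w\<^sup>2 = ((X 1 1 + X 2 2) / 2 + ((E 1 1 + E 2 2) / 2) / 6)\<^sup>2" unfolding v by simp
  also have "\<dots> \<le> 2 * ((X 1 1 + X 2 2) / 2)\<^sup>2 + 2 * (((E 1 1 + E 2 2) / 2) / 6)\<^sup>2"
    unfolding power2_sum using sum_squares_bound[of "(X 1 1 + X 2 2) / 2" "((E 1 1 + E 2 2) / 2) / 6"] by linarith
  also have "(((E 1 1 + E 2 2) / 2) / 6)\<^sup>2 = ((E 1 1 + E 2 2) / 2)\<^sup>2 / 36"
    unfolding power_divide[of "(E 1 1 + E 2 2) / 2" 6] by simp
  also have "2 * ((X 1 1 + X 2 2) / 2)\<^sup>2 + 2 * (((E 1 1 + E 2 2) / 2)\<^sup>2 / 36) \<le> 2 * ((X 1 1 + X 2 2) / 2)\<^sup>2 + 2 * \<rho>\<^sup>2 * ((1/3) * ?c)"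
    using trE by simp
  finally show "w\<^sup>2 \<le> 2 * ((X 1 1 + X 2 2) / 2)\<^sup>2 + 2 * \<rho>\<^sup>2 * ((1/3) * (\<Sum>e\<in>edges T. (norm (C e))\<^sup>2))"
    unfolding se .
qed


section \<open>The trace estimate on a triangulation\<close>
lemma product_has_derivative:
  assumes f: "\<And>t. (f has_real_derivative f' t) (at t)" and h: "\<And>t. (h has_real_derivative h' t) (at t)"
  shows "((\<lambda>z::real^2. f (z$1) * h (z$2)) has_derivative (\<lambda>v. (f' (z$1) * h (z$2)) * v$1 + (f (z$1) * h' (z$2)) * v$2)) (at z)"
proof -
  have n: "((\<lambda>z::real^2. z $ i) has_derivative (\<lambda>v. v $ i)) (at z)" for i
    by (rule bounded_linear_imp_has_derivative[OF bounded_linear_vec_nth])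
  show ?thesis
    by (rule has_derivative_eq_rhs[OF has_derivative_mult[OF DERIV_compose_FDERIV[OF f n] DERIV_compose_FDERIV[OF h n]]])
      (simp add: fun_eq_iff algebra_simps)
qed

context mesh
begin

definition mesh_fun :: "((real^2) set \<Rightarrow> real^2 \<Rightarrow> real) \<Rightarrow> real^2 \<Rightarrow> real" where
  "mesh_fun G z = (\<Sum>T\<in>\<T>. indicator (interior T) z * G T z)"

lemma mesh_fun_interior: "T \<in> \<T> \<Longrightarrow> z \<in> interior T \<Longrightarrow> mesh_fun G z = G T z"
  using sum_indicator_mesh[of T z "\<lambda>T. G T z"] by (simp add: mesh_fun_def)

lemma mesh_fun_outside: "(\<And>T. T \<in> \<T> \<Longrightarrow> z \<notin> interior T) \<Longrightarrow> mesh_fun G z = 0"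
  by (simp add: mesh_fun_def)

lemma mesh_fun_cases:
  obtains T where "T \<in> \<T>" "\<And>G. mesh_fun G z = G T z" | "\<And>G. mesh_fun G z = 0"
  by (cases "\<exists>T\<in>\<T>. z \<in> interior T") (metis mesh_fun_interior, metis mesh_fun_outside)

lemma integral_mesh_fun:
  assumes "\<And>T. T \<in> \<T> \<Longrightarrow> continuous_on UNIV (G T)"
  shows "(LINT z|lborel. mesh_fun G z) = (\<Sum>T\<in>\<T>. LINT z:interior T|lborel. G T z)"
  unfolding mesh_fun_def by (rule integral_mesh_sum(2)[OF assms])

text \<open>
  The exceptional set for continuity is the union of the edges.
\<close>

lemma box_fun_mesh_fun:
  assumes c: "\<And>T. T \<in> \<T> \<Longrightarrow> continuous_on UNIV (G T)" and sq: "\<And>T. T \<in> \<T> \<Longrightarrow> T \<subseteq> plane_square r"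
  obtains K0 where "\<And>K. K0 \<le> K \<Longrightarrow> box_fun r K (mesh_fun G)"
proof -
  have "\<exists>B\<ge>0. \<forall>z\<in>T. \<bar>G T z\<bar> \<le> B" if "T \<in> \<T>" for T
  proof -
    have "compact (G T ` T)"
      using c[OF that] bounded_interior_mesh(2)[OF that] by (intro compact_continuous_image) (auto intro: continuous_on_subset)
    then obtain B where "0 < B" "\<forall>x\<in>G T ` T. norm x \<le> B" using compact_imp_bounded bounded_pos by metis
    then show ?thesis by (intro exI[of _ B]) auto
  qed
  then obtain B where B: "\<And>T. T \<in> \<T> \<Longrightarrow> 0 \<le> B T" "\<And>T z. T \<in> \<T> \<Longrightarrow> z \<in> T \<Longrightarrow> \<bar>G T z\<bar> \<le> B T"
    by metis
  have m: "mesh_fun G \<in> borel_measurable borel"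
    unfolding mesh_fun_def using c by (intro borel_measurable_sum borel_measurable_times borel_measurable_indicator)
      (auto intro: borel_measurable_continuous_onI)
  have bd: "\<bar>mesh_fun G z\<bar> \<le> (\<Sum>T\<in>\<T>. B T)" for z
  proof (cases "\<exists>T\<in>\<T>. z \<in> interior T")
    case True
    then obtain T where T: "T \<in> \<T>" "z \<in> interior T" by blast
    have "\<bar>mesh_fun G z\<bar> \<le> B T" using B(2)[OF T(1)] T interior_subset by (auto simp: mesh_fun_interior)
    also have "B T \<le> (\<Sum>T\<in>\<T>. B T)" using T(1) B(1) finite_mesh by (intro member_le_sum) auto
    finally show ?thesis .
  next
    case False
    then show ?thesis using B(1) by (simp add: mesh_fun_outside sum_nonneg)
  qed
  have z0: "mesh_fun G z = 0" if "\<not> (\<bar>z $ 1\<bar> \<le> r \<and> \<bar>z $ 2\<bar> \<le> r)" for z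
    using that sq interior_subset by (intro mesh_fun_outside) blast
  have ct: "isCont (mesh_fun G) z" if z: "z \<notin> (\<Union>T\<in>\<T>. frontier T)" for z
  proof (cases "\<exists>T\<in>\<T>. z \<in> interior T")
    case True
    then obtain T where T: "T \<in> \<T>" "z \<in> interior T" by blast
    have "isCont (G T) z" using c[OF T(1)] by (simp add: continuous_on_eq_continuous_at)
    moreover have "eventually (\<lambda>x. mesh_fun G x = G T x) (nhds z)"
      using eventually_nhds_in_open[of "interior T" z] T by (auto elim!: eventually_mono simp: mesh_fun_interior)
    ultimately show ?thesis by (simp add: isCont_cong)
  next
    case False
    have cl: "closed T" if "T \<in> \<T>" for T using bounded_interior_mesh(2)[OF that] by (rule compact_imp_closed)
    have "z \<notin> T" if "T \<in> \<T>" for T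
      using False z that cl[OF that] by (auto simp: frontier_def)
    then have "z \<in> - \<Union>\<T>" by auto
    moreover have "open (- \<Union>\<T>)" using finite_mesh cl by (intro open_Compl closed_Union) auto
    ultimately have "eventually (\<lambda>x. mesh_fun G x = 0) (nhds z)"
      using eventually_nhds_in_open[of "- \<Union>\<T>" z] interior_subset
      by (auto elim!: eventually_mono intro!: mesh_fun_outside)
    then show ?thesis by (simp add: isCont_cong)
  qed
  have "(\<Union>T\<in>\<T>. frontier T) \<in> null_sets lborel"
  proof -
    have "(\<Union>T\<in>\<T>. frontier T) \<in> sets lborel"
      using finite_mesh by (simp add: borel_closed closed_UN)
    then show ?thesis
      using negligible_skeleton by (simp add: negligible_iff_null_sets null_sets_completion_iff)
  qed
  then have ae: "AE z in lborel. isCont (mesh_fun G) z"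
    by (rule AE_I') (use ct in auto)
  show ?thesis
    using m bd z0 ae by (intro that[of "\<Sum>T\<in>\<T>. B T"]) (auto simp: box_fun_def intro: order_trans)
qed

lemma continuous_stress: "continuous_on UNIV (\<lambda>z. stress C w j T k z $ l)"
  unfolding stress_def by (intro continuous_intros)

text \<open>
  Summing the flux identities over the triangles, the edge means of the test function are multiplied by the
  sums in the hypothesis. Boundary edges are included, so the extension by zero is in equilibrium as well.
\<close>

lemma stress_weak_divergence:
  assumes EQ: "\<And>e. e \<in> (\<Union>T\<in>\<T>. edges T) \<Longrightarrow>
      (\<Sum>T\<in>{T\<in>\<T>. e \<in> edges T}. mean_stress (w T) j T k \<bullet> edge_normal T e - tarea T / 3 * C e $ k) = 0"
  shows "weak_divergence (mesh_fun (\<lambda>T z. stress C (w T) j T k z $ 1)) (mesh_fun (\<lambda>T z. stress C (w T) j T k z $ 2))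
    (mesh_fun (\<lambda>T z. - (1/3) * (\<Sum>e\<in>edges T. C e $ k)))"
  unfolding weak_divergence_def
proof (intro allI impI)
  fix f f' h h' :: "real \<Rightarrow> real"
  assume f: "\<forall>t. (f has_real_derivative f' t) (at t)" "continuous_on UNIV f'"
    and h: "\<forall>t. (h has_real_derivative h' t) (at t)" "continuous_on UNIV h'"
  let ?\<eta> = "\<lambda>z::real^2. f (z$1) * h (z$2)" and ?\<eta>1 = "\<lambda>z::real^2. f' (z$1) * h (z$2)" and ?\<eta>2 = "\<lambda>z::real^2. f (z$1) * h' (z$2)"
  have fh: "continuous_on UNIV f" "continuous_on UNIV h"
    using f(1) h(1) by (meson DERIV_continuous_on has_field_derivative_at_within)+
  have comp: "continuous_on UNIV (\<lambda>z::real^2. u (z $ i))" if "continuous_on UNIV u" for u :: "real \<Rightarrow> real" and i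
    by (rule continuous_on_compose2[OF that]) (auto intro: continuous_intros)
  note c = continuous_on_mult[OF comp[OF fh(1), of 1] comp[OF fh(2), of 2]]
    continuous_on_mult[OF comp[OF f(2), of 1] comp[OF fh(2), of 2]]
    continuous_on_mult[OF comp[OF fh(1), of 1] comp[OF h(2), of 2]]
  have d: "(?\<eta> has_derivative (\<lambda>v. ?\<eta>1 z * v$1 + ?\<eta>2 z * v$2)) (at z)" for z
    using f h by (intro product_has_derivative) auto
  let ?a = "\<lambda>T e. mean_stress (w T) j T k \<bullet> edge_normal T e - tarea T / 3 * C e $ k"
  let ?I = "\<lambda>T. (1/3) * (\<Sum>e\<in>edges T. C e $ k) * (LINT z:interior T|lborel. ?\<eta> z)"
  have loc: "(LINT z:interior T|lborel. stress C (w T) j T k z $ 1 * ?\<eta>1 z + stress C (w T) j T k z $ 2 * ?\<eta>2 z)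
      = (\<Sum>e\<in>edges T. ?a T e * edge_avg e ?\<eta>) + ?I T" if "T \<in> \<T>" for T
  proof -
    obtain p q r where t: "tri T p q r" using mesh_tri[OF \<open>T \<in> \<T>\<close>] .
    have "stress C (w T) j T k z $ l = mean_stress (w T) j T k $ l - (1/6) * (\<Sum>e\<in>edges T. C e $ k * (z - opp T e) $ l)" for z l
      by (simp add: stress_def sum_component)
    then show ?thesis
      using tri_flux[OF t d c(2,3), of "mean_stress (w T) j T k" "\<lambda>e. C e $ k"] by simp
  qed
  have "(\<Sum>T\<in>\<T>. \<Sum>e\<in>edges T. ?a T e * edge_avg e ?\<eta>)
      = (\<Sum>T\<in>\<T>. \<Sum>e\<in>{e\<in>(\<Union>T\<in>\<T>. edges T). e \<in> edges T}. ?a T e * edge_avg e ?\<eta>)"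
    by (intro sum.cong) auto
  also have "\<dots> = (\<Sum>e\<in>(\<Union>T\<in>\<T>. edges T). \<Sum>T\<in>{T\<in>\<T>. e \<in> edges T}. ?a T e * edge_avg e ?\<eta>)"
    using finite_mesh finite_edges simplices by (intro sum.swap_restrict) auto
  also have "\<dots> = (\<Sum>e\<in>(\<Union>T\<in>\<T>. edges T). (\<Sum>T\<in>{T\<in>\<T>. e \<in> edges T}. ?a T e) * edge_avg e ?\<eta>)"
    by (simp add: sum_distrib_right)
  also have "\<dots> = 0" using EQ by (intro sum.neutral) auto
  finally have z: "(\<Sum>T\<in>\<T>. \<Sum>e\<in>edges T. ?a T e * edge_avg e ?\<eta>) = 0" .
  let ?X = "\<lambda>l. mesh_fun (\<lambda>T z. stress C (w T) j T k z $ l)"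
  have e1: "?X 1 z * ?\<eta>1 z + ?X 2 z * ?\<eta>2 z
      = mesh_fun (\<lambda>T z. stress C (w T) j T k z $ 1 * ?\<eta>1 z + stress C (w T) j T k z $ 2 * ?\<eta>2 z) z"
    and e2: "mesh_fun (\<lambda>T z. (- (1/3) * (\<Sum>e\<in>edges T. C e $ k)) * ?\<eta> z) z
      = mesh_fun (\<lambda>T z. - (1/3) * (\<Sum>e\<in>edges T. C e $ k)) z * ?\<eta> z" for z
    by (rule mesh_fun_cases[of z]; simp)+
  have "(LINT z|lborel. ?X 1 z * ?\<eta>1 z + ?X 2 z * ?\<eta>2 z)
      = (LINT z|lborel. mesh_fun (\<lambda>T z. stress C (w T) j T k z $ 1 * ?\<eta>1 z + stress C (w T) j T k z $ 2 * ?\<eta>2 z) z)"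
    unfolding e1 ..
  also have "\<dots> = (\<Sum>T\<in>\<T>. LINT z:interior T|lborel. stress C (w T) j T k z $ 1 * ?\<eta>1 z + stress C (w T) j T k z $ 2 * ?\<eta>2 z)"
    by (intro integral_mesh_fun continuous_on_add continuous_on_mult continuous_stress c)
  also have "\<dots> = (\<Sum>T\<in>\<T>. ?I T)" using z by (simp add: loc sum.distrib)
  also have "\<dots> = - (\<Sum>T\<in>\<T>. LINT z:interior T|lborel. (- (1/3) * (\<Sum>e\<in>edges T. C e $ k)) * ?\<eta> z)"
    unfolding set_integral_mult_right by (simp add: sum_negf[symmetric])
  also have "\<dots> = - (LINT z|lborel. mesh_fun (\<lambda>T z. (- (1/3) * (\<Sum>e\<in>edges T. C e $ k)) * ?\<eta> z) z)"
    by (subst integral_mesh_fun) (intro continuous_on_mult continuous_on_const c, simp)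
  also have "\<dots> = - (LINT z|lborel. mesh_fun (\<lambda>T z. - (1/3) * (\<Sum>e\<in>edges T. C e $ k)) z * ?\<eta> z)"
    unfolding e2 ..
  finally show "(LINT z|lborel. ?X 1 z * ?\<eta>1 z + ?X 2 z * ?\<eta>2 z)
    = - (LINT z|lborel. mesh_fun (\<lambda>T z. - (1/3) * (\<Sum>e\<in>edges T. C e $ k)) z * ?\<eta> z)" .
qed

lemma set_integral_const_tarea: "(LINT z:interior T|lborel. (c::real)) = c * tarea T"
  unfolding tarea_def set_integral_mult_right[symmetric] by simp

lemma tarea_pos: "T \<in> \<T> \<Longrightarrow> 0 < tarea T"
  by (metis mesh_tri tarea_tri tri_def half_gt_zero)

text \<open>
  The general trace estimate with the local bounds inserted. The right-hand side counts every interior edge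
  twice, which is why \<open>24\<close> appears instead of \<open>12\<close>.
\<close>

lemma stress_estimate:
  assumes r: "0 \<le> r" and sq: "\<And>T. T \<in> \<T> \<Longrightarrow> T \<subseteq> plane_square r"
    and EQ: "\<And>e k. e \<in> (\<Union>T\<in>\<T>. edges T) \<Longrightarrow>
      (\<Sum>T\<in>{T\<in>\<T>. e \<in> edges T}. mean_stress (w T) j T k \<bullet> edge_normal T e - tarea T / 3 * C e $ k) = 0"
  shows "(\<Sum>T\<in>\<T>. tarea T * (w T)\<^sup>2) \<le> 300 * (r + 1)\<^sup>2 *
    ((\<Sum>T\<in>\<T>. tarea T / 3 * (\<Sum>e\<in>edges T. (norm (C e))\<^sup>2)) + (\<Sum>T\<in>\<T>. \<Sum>e\<in>edges T. (j e)\<^sup>2) / 24)"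
proof -
  let ?x = "\<lambda>k l T z. stress C (w T) j T k z $ l" and ?g = "\<lambda>k T (z::real^2). - (1/3) * (\<Sum>e\<in>edges T. C e $ k)"
  have cx: "continuous_on UNIV (?x k l T)" for k l T by (rule continuous_stress)
  have cg: "continuous_on UNIV (?g k T)" for k T by (rule continuous_on_const)
  obtain K where K: "box_fun r K (mesh_fun (?x 1 1))" "box_fun r K (mesh_fun (?x 1 2))" "box_fun r K (mesh_fun (?x 2 1))"
    "box_fun r K (mesh_fun (?x 2 2))" "box_fun r K (mesh_fun (?g 1))" "box_fun r K (mesh_fun (?g 2))"
  proof -
    obtain K1 where K1: "\<And>K. K1 \<le> K \<Longrightarrow> box_fun r K (mesh_fun (?x 1 1))" using box_fun_mesh_fun[of "?x 1 1", OF cx sq] by blast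
    obtain K2 where K2: "\<And>K. K2 \<le> K \<Longrightarrow> box_fun r K (mesh_fun (?x 1 2))" using box_fun_mesh_fun[of "?x 1 2", OF cx sq] by blast
    obtain K3 where K3: "\<And>K. K3 \<le> K \<Longrightarrow> box_fun r K (mesh_fun (?x 2 1))" using box_fun_mesh_fun[of "?x 2 1", OF cx sq] by blast
    obtain K4 where K4: "\<And>K. K4 \<le> K \<Longrightarrow> box_fun r K (mesh_fun (?x 2 2))" using box_fun_mesh_fun[of "?x 2 2", OF cx sq] by blast
    obtain K5 where K5: "\<And>K. K5 \<le> K \<Longrightarrow> box_fun r K (mesh_fun (?g 1))" using box_fun_mesh_fun[of "?g 1", OF cg sq] by blast
    obtain K6 where K6: "\<And>K. K6 \<le> K \<Longrightarrow> box_fun r K (mesh_fun (?g 2))" using box_fun_mesh_fun[of "?g 2", OF cg sq] by blast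
    let ?K = "max K1 (max K2 (max K3 (max K4 (max K5 K6))))"
    show ?thesis by (rule that[of ?K]; (rule K1 K2 K3 K4 K5 K6), simp)
  qed
  let ?v = "\<lambda>T z. ((?x 1 1 T z + ?x 2 2 T z) / 2)\<^sup>2"
  let ?d = "\<lambda>T z. \<bar>?x 1 1 T z * ?x 2 2 T z - ?x 1 2 T z * ?x 2 1 T z - ?v T z\<bar>"
  let ?G = "\<lambda>T z. (?g 1 T z)\<^sup>2 + (?g 2 T z)\<^sup>2"
  have cv: "continuous_on UNIV (?v T)" and cd: "continuous_on UNIV (?d T)" and cG: "continuous_on UNIV (?G T)" for T
    by (intro continuous_intros cx; simp)+
  have eqs: "((mesh_fun (?x 1 1) z + mesh_fun (?x 2 2) z) / 2)\<^sup>2 = mesh_fun ?v z"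
     "\<bar>mesh_fun (?x 1 1) z * mesh_fun (?x 2 2) z - mesh_fun (?x 1 2) z * mesh_fun (?x 2 1) z - mesh_fun ?v z\<bar> = mesh_fun ?d z"
     "(mesh_fun (?g 1) z)\<^sup>2 + (mesh_fun (?g 2) z)\<^sup>2 = mesh_fun ?G z" for z
    by (rule mesh_fun_cases[of z]; simp)+
  have main: "(\<Sum>T\<in>\<T>. LINT z:interior T|lborel. ?v T z) \<le> 3 * (\<Sum>T\<in>\<T>. LINT z:interior T|lborel. ?d T z)
      + 134 * (r + 1)\<^sup>2 * (\<Sum>T\<in>\<T>. LINT z:interior T|lborel. ?G T z)"
    using weak_trace_estimate[OF r K stress_weak_divergence[OF EQ] stress_weak_divergence[OF EQ]]
    unfolding eqs integral_mesh_fun[of ?v, OF cv] integral_mesh_fun[of ?d, OF cd] integral_mesh_fun[of ?G, OF cG] by simp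
  define c where "c T = tarea T / 3 * (\<Sum>e\<in>edges T. (norm (C e))\<^sup>2)" for T
  define J where "J T = (\<Sum>e\<in>edges T. (j e)\<^sup>2)" for T
  have bd: "(LINT z:interior T|lborel. ?d T z) \<le> (1/18) * J T + (7/2) * r\<^sup>2 * c T" (is ?A)
     "tarea T * (w T)\<^sup>2 \<le> 2 * (LINT z:interior T|lborel. ?v T z) + 2 * r\<^sup>2 * c T" (is ?B)
     "(LINT z:interior T|lborel. ?G T z) \<le> c T" (is ?C) if T: "T \<in> \<T>" for T
  proof -
    obtain p q s where t: "tri T p q s" using mesh_tri[OF T] .
    note a = tarea_pos[OF T]
    note si = set_integrable_mesh[OF T]
    note loc = local_stress_bounds[OF t sq[OF T], where C = C and w = "w T" and j = j]
    let ?b = "(1/18) * J T + (7/2) * r\<^sup>2 * c T"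
    have "(LINT z:interior T|lborel. ?d T z) \<le> (LINT z:interior T|lborel. ?b / tarea T)"
    proof (rule set_integral_mono)
      fix z assume "z \<in> interior T"
      then have z: "z \<in> T" using interior_subset by blast
      show "?d T z \<le> ?b / tarea T"
        using loc(1)[OF z] a unfolding c_def J_def by (simp add: pos_le_divide_eq mult.commute)
    qed (intro si cd continuous_on_const)+
    then show ?A unfolding set_integral_const_tarea using a by simp
    have "(LINT z:interior T|lborel. (w T)\<^sup>2) \<le> (LINT z:interior T|lborel. 2 * ?v T z + 2 * r\<^sup>2 * (c T / tarea T))"
    proof (rule set_integral_mono)
      fix z assume "z \<in> interior T"
      then have z: "z \<in> T" using interior_subset by blast
      show "(w T)\<^sup>2 \<le> 2 * ?v T z + 2 * r\<^sup>2 * (c T / tarea T)"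
        using loc(2)[OF z] a unfolding c_def by simp
    qed (intro si cv continuous_on_const continuous_on_add continuous_on_mult)+
    also have "\<dots> = 2 * (LINT z:interior T|lborel. ?v T z) + 2 * r\<^sup>2 * (c T / tarea T) * tarea T"
      by (subst set_integral_add(2)) (intro si cv continuous_on_const continuous_on_mult, intro si continuous_on_const,
        simp only: set_integral_mult_right set_integral_const_tarea)
    finally show ?B unfolding set_integral_const_tarea using a by (simp add: mult.commute)
    have "(\<Sum>e\<in>edges T. C e $ k)\<^sup>2 \<le> 3 * (\<Sum>e\<in>edges T. (C e $ k)\<^sup>2)" for k
      using sum3_squares by (simp add: sum_edges_tri[OF t])
    from this[of 1] this[of 2]
    have "(1/9) * ((\<Sum>e\<in>edges T. C e $ 1)\<^sup>2 + (\<Sum>e\<in>edges T. C e $ 2)\<^sup>2) \<le> (1/3) * ((\<Sum>e\<in>edges T. (C e $ 1)\<^sup>2) + (\<Sum>e\<in>edges T. (C e $ 2)\<^sup>2))"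
      by simp
    moreover have "(\<Sum>e\<in>edges T. (C e $ 1)\<^sup>2) + (\<Sum>e\<in>edges T. (C e $ 2)\<^sup>2) = (\<Sum>e\<in>edges T. (norm (C e))\<^sup>2)"
      by (simp add: sum.distrib[symmetric] norm_eq_sqrt_inner inner_vec_def sum_2 power2_eq_square)
    ultimately have "?G T 0 \<le> (1/3) * (\<Sum>e\<in>edges T. (norm (C e))\<^sup>2)"
      by (simp add: power_divide power_mult_distrib)
    then show ?C unfolding set_integral_const_tarea c_def using a by (simp add: mult.commute)
  qed
  have cnn: "0 \<le> c T" and Jnn: "0 \<le> J T" if "T \<in> \<T>" for T
    using tarea_pos[OF that] by (auto simp: c_def J_def intro!: mult_nonneg_nonneg sum_nonneg)
  have S: "0 \<le> sum c \<T>" "0 \<le> sum J \<T>" using cnn Jnn by (auto intro: sum_nonneg)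
  have "(\<Sum>T\<in>\<T>. tarea T * (w T)\<^sup>2) \<le> (\<Sum>T\<in>\<T>. 2 * (LINT z:interior T|lborel. ?v T z) + 2 * r\<^sup>2 * c T)"
    by (intro sum_mono bd)
  also have "\<dots> = 2 * (\<Sum>T\<in>\<T>. LINT z:interior T|lborel. ?v T z) + 2 * r\<^sup>2 * sum c \<T>"
    by (simp add: sum.distrib sum_distrib_left)
  also have "(\<Sum>T\<in>\<T>. LINT z:interior T|lborel. ?v T z) \<le> 3 * (\<Sum>T\<in>\<T>. (1/18) * J T + (7/2) * r\<^sup>2 * c T) + 134 * (r + 1)\<^sup>2 * sum c \<T>"
    by (rule order_trans[OF main]) (intro add_mono mult_left_mono sum_mono bd; simp)
  also have "(\<Sum>T\<in>\<T>. (1/18) * J T + (7/2) * r\<^sup>2 * c T) = (1/18) * sum J \<T> + (7/2) * r\<^sup>2 * sum c \<T>"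
    by (simp add: sum.distrib sum_distrib_left)
  also have "2 * (3 * \<dots> + 134 * (r + 1)\<^sup>2 * sum c \<T>) + 2 * r\<^sup>2 * sum c \<T>
      = (1/3) * sum J \<T> + (23 * r\<^sup>2 + 268 * (r + 1)\<^sup>2) * sum c \<T>"
    by (simp add: algebra_simps)
  also have "\<dots> \<le> 300 * (r + 1)\<^sup>2 * (sum J \<T> / 24) + 300 * (r + 1)\<^sup>2 * sum c \<T>"
  proof (intro add_mono mult_right_mono)
    have 1: "1 \<le> (r + 1)\<^sup>2" using r by simp
    have "r\<^sup>2 \<le> (r + 1)\<^sup>2" using r by (intro power_mono) auto
    then show "23 * r\<^sup>2 + 268 * (r + 1)\<^sup>2 \<le> 300 * (r + 1)\<^sup>2" using 1 by simp
    have "8 * (sum J \<T> / 24) \<le> 300 * (r + 1)\<^sup>2 * (sum J \<T> / 24)" using 1 S by (intro mult_right_mono) auto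
    then show "(1/3) * sum J \<T> \<le> 300 * (r + 1)\<^sup>2 * (sum J \<T> / 24)" by simp
  qed (rule S)
  finally show ?thesis unfolding c_def J_def by (simp add: algebra_simps)
qed

end


section \<open>Crouzeix--Raviart fields in terms of edge values\<close>
lemma edge_integral_mid:
  "edge_integral e f = edge_len e *\<^sub>R integral {0..1} (\<lambda>t. f (edge_mid e + (t - 1/2) *\<^sub>R edge_vec e))"
proof -
  have "linepath (fst (ends e)) (snd (ends e)) t = edge_mid e + (t - 1/2) *\<^sub>R edge_vec e" for t
    by (simp add: vec_eq_iff linepath_def edge_mid_def edge_vec_def midpoint_def algebra_simps)
  then show ?thesis by (simp add: edge_integral_ends)
qed

lemma integral_centred_unit:
  "((\<lambda>t. t - 1/2) has_integral 0) {0..1::real}" "((\<lambda>t. (t - 1/2)\<^sup>2) has_integral 1/12) {0..1::real}"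
proof -
  have "((\<lambda>t. t - 1/2) has_integral ((1 - 1/2)\<^sup>2 / 2 - (0 - 1/2)\<^sup>2 / 2)) {0..1::real}"
    by (rule fundamental_theorem_of_calculus[where f = "\<lambda>t. (t - 1/2)\<^sup>2 / 2"])
      (auto simp flip: has_real_derivative_iff_has_vector_derivative intro!: derivative_eq_intros)
  then show "((\<lambda>t. t - 1/2) has_integral 0) {0..1::real}" by (simp add: power2_eq_square)
  have "((\<lambda>t. (t - 1/2)\<^sup>2) has_integral ((1 - 1/2)^3 / 3 - (0 - 1/2)^3 / 3)) {0..1::real}"
    by (rule fundamental_theorem_of_calculus[where f = "\<lambda>t. (t - 1/2)^3 / 3"])
      (auto simp flip: has_real_derivative_iff_has_vector_derivative intro!: derivative_eq_intros)
  then show "((\<lambda>t. (t - 1/2)\<^sup>2) has_integral 1/12) {0..1::real}" by (simp add: power3_eq_cube)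
qed

text \<open>
  The affine field on \<open>T\<close> with the values \<open>C\<close> at the midpoints of the edges. One assignment \<open>C\<close> of
  vectors to all edges describes a field of the global space: continuity of the edge means is built in.
\<close>

definition cr :: "((real^2) set \<Rightarrow> real^2) \<Rightarrow> (real^2) set \<Rightarrow> real^2 \<Rightarrow> real^2" where
  "cr C T x = (\<Sum>e\<in>edges T. (1 - 2 * bary T e x) *\<^sub>R C e)"

definition cr_grad :: "((real^2) set \<Rightarrow> real^2) \<Rightarrow> (real^2) set \<Rightarrow> real^2 \<Rightarrow> real^2" where
  "cr_grad C T h = (\<Sum>e\<in>edges T. (edge_normal T e \<bullet> h / tarea T) *\<^sub>R C e)"

definition cdiv :: "((real^2) set \<Rightarrow> real^2) \<Rightarrow> (real^2) set \<Rightarrow> real" where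
  "cdiv C T = (\<Sum>e\<in>edges T. C e \<bullet> edge_normal T e) / tarea T"

lemma tri_tarea_pos: "tri T p q r \<Longrightarrow> 0 < tarea T"
  using tarea_tri[of T p q r] by (auto simp: tri_def)

lemma cr_mid:
  assumes t: "tri T p q r" and e: "e \<in> edges T"
  shows "cr C T (edge_mid e) = C e"
proof -
  obtain p q r where t: "tri T p q r" and e: "e = closed_segment q r" using tri_edge_label[OF t e] .
  note t2 = tri_rotate[OF t] and t3 = tri_rotate2[OF t]
  have D: "cross (q - p) (r - p) \<noteq> 0" using t by (simp add: tri_def)
  have r: "cross (r - q) (p - q) = cross (q - p) (r - p)" "cross (p - r) (q - r) = cross (q - p) (r - p)" by (simp_all add: cross_def algebra_simps)
  have "cross (r - q) (midpoint q r - q) = 0" "cross (p - r) (midpoint q r - r) = cross (q - p) (r - p) / 2"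
    "cross (q - p) (midpoint q r - p) = cross (q - p) (r - p) / 2"
    by (simp_all add: cross_def midpoint_def field_simps)
  then have "cross (r - q) (midpoint q r - q) / cross (q - p) (r - p) = 0"
    "cross (p - r) (midpoint q r - r) / cross (q - p) (r - p) = 1 / 2" "cross (q - p) (midpoint q r - p) / cross (q - p) (r - p) = 1 / 2"
    using D by simp_all
  then show ?thesis
    unfolding cr_def sum_edges_tri[OF t] e edge_mid_segment bary_tri[OF t] bary_tri[OF t2] bary_tri[OF t3] r by simp
qed

lemma cr_step: "0 < tarea T \<Longrightarrow> cr C T (x + h) = cr C T x + cr_grad C T h"
proof -
  assume a: "0 < tarea T"
  have "bary T e (x + h) = bary T e x - edge_normal T e \<bullet> h / (2 * tarea T)" for e
    by (simp add: bary_def inner_simps diff_divide_distrib add_divide_distrib)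
  then show ?thesis
    using a unfolding cr_def cr_grad_def sum.distrib[symmetric] scaleR_add_left[symmetric]
    by (intro sum.cong arg_cong2[where f = scaleR]) (auto simp: field_simps)
qed

lemma linear_cr_grad: "linear (cr_grad C T)"
  unfolding cr_grad_def
  by (rule linearI) (simp_all add: inner_simps add_divide_distrib scaleR_add_left sum.distrib scaleR_sum_right)

lemma cr_affine: "0 < tarea T \<Longrightarrow> cr C T x = cr C T 0 + cr_grad C T x"
  using cr_step[of T C 0 x] by simp

lemma cr_component: "0 < tarea T \<Longrightarrow> cr C T x $ i = (\<Sum>e\<in>edges T. (C e $ i / tarea T) *\<^sub>R edge_normal T e) \<bullet> x + cr C T 0 $ i"
  by (subst cr_affine) (auto simp: cr_grad_def inner_sum_left intro!: sum.cong)

lemma continuous_cr: "0 < tarea T \<Longrightarrow> continuous_on UNIV (cr C T)"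
  unfolding cr_def bary_def by (intro continuous_intros) auto

text \<open>
  In barycentric coordinates both sides have the same coefficient at each vertex.
\<close>

lemma affine_cr:
  fixes a :: "real^2"
  assumes t: "tri T p q r"
  shows "a \<bullet> x + c = (\<Sum>e\<in>edges T. (1 - 2 * bary T e x) * (a \<bullet> edge_mid e + c))"
proof -
  note t2 = tri_rotate[OF t] and t3 = tri_rotate2[OF t]
  let ?D = "cross (q - p) (r - p)"
  have D: "?D \<noteq> 0" using t by (simp add: tri_def)
  have rr: "cross (r - q) (p - q) = ?D" "cross (p - r) (q - r) = ?D" by (simp_all add: cross_def algebra_simps)
  define u v w where "u = cross (r - q) (x - q) / ?D" and "v = cross (p - r) (x - r) / ?D" and "w = cross (q - p) (x - p) / ?D"
  have x: "x = u *\<^sub>R p + v *\<^sub>R q + w *\<^sub>R r" and s: "u + v + w = 1"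
    unfolding u_def v_def w_def by (rule barycentric_coordinates[OF D])+
  have w: "w = 1 - u - v" using s by simp
  have "a \<bullet> x = u * (a \<bullet> p) + v * (a \<bullet> q) + w * (a \<bullet> r)" by (simp add: x inner_simps)
  moreover have mid: "a \<bullet> midpoint y z = (a \<bullet> y + a \<bullet> z) / 2" for y z by (simp add: midpoint_def inner_simps)
  ultimately show ?thesis
    unfolding sum_edges_tri[OF t] edge_mid_segment bary_tri[OF t] bary_tri[OF t2] bary_tri[OF t3] rr u_def[symmetric] v_def[symmetric] w_def[symmetric]
    unfolding w mid by (simp add: field_simps)
qed

lemma integral_cr_product:
  assumes t: "tri T p q r"
  shows "(LINT z:interior T|lborel. cr C T z \<bullet> cr D T z) = tarea T / 3 * (\<Sum>e\<in>edges T. C e \<bullet> D e)"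
proof -
  have a: "0 < tarea T" using tri_tarea_pos[OF t] .
  have D: "cross (q - p) (r - p) \<noteq> 0" "0 < cross (q - p) (r - p)" and T: "T = convex hull {p, q, r}" using t by (auto simp: tri_def)
  have i: "(LINT z:interior T|lborel. cr C T z $ i * cr D T z $ i) = tarea T / 3 * (\<Sum>e\<in>edges T. C e $ i * D e $ i)" for i
  proof -
    define A where "A E = (\<Sum>e\<in>edges T. (E e $ i / tarea T) *\<^sub>R edge_normal T e)" for E :: "(real^2) set \<Rightarrow> real^2"
    define B where "B E = cr E T 0 $ i" for E
    have AB: "cr E T z $ i = A E \<bullet> z + B E" for E z
      unfolding A_def B_def by (rule cr_component[OF a])
    have "(LINT z:interior T|lborel. cr C T z $ i * cr D T z $ i) = \<bar>cross (q - p) (r - p)\<bar> / 6 *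
      (cr C T (midpoint q r) $ i * cr D T (midpoint q r) $ i + cr C T (midpoint r p) $ i * cr D T (midpoint r p) $ i
        + cr C T (midpoint p q) $ i * cr D T (midpoint p q) $ i)"
      unfolding AB using midpoint_rule_open_triangle[OF D(1), of "A C" "B C" "A D" "B D"] T by simp
    also have "\<dots> = tarea T / 3 * (\<Sum>e\<in>edges T. cr C T (edge_mid e) $ i * cr D T (edge_mid e) $ i)"
      using D by (simp add: sum_edges_tri[OF t] edge_mid_segment tarea_tri[OF t])
    also have "(\<Sum>e\<in>edges T. cr C T (edge_mid e) $ i * cr D T (edge_mid e) $ i) = (\<Sum>e\<in>edges T. C e $ i * D e $ i)"
      by (intro sum.cong) (simp_all add: cr_mid[OF t])
    finally show ?thesis .
  qed
  have si: "set_integrable lborel (interior T) f" if "continuous_on UNIV f" for f :: "real^2 \<Rightarrow> real"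
    using integral_open_triangle(1)[OF that D(1)] T by simp
  have c: "continuous_on UNIV (\<lambda>z. cr C T z $ i * cr D T z $ i)" for i
    by (intro continuous_intros continuous_cr a)
  have "(LINT z:interior T|lborel. cr C T z \<bullet> cr D T z)
      = (LINT z:interior T|lborel. cr C T z $ 1 * cr D T z $ 1 + cr C T z $ 2 * cr D T z $ 2)"
    by (simp add: inner_vec_def sum_2)
  also have "\<dots> = tarea T / 3 * (\<Sum>e\<in>edges T. C e $ 1 * D e $ 1) + tarea T / 3 * (\<Sum>e\<in>edges T. C e $ 2 * D e $ 2)"
    unfolding i[symmetric] by (intro set_integral_add(2) si c)
  finally show ?thesis by (simp add: inner_vec_def sum_2 sum.distrib distrib_left)
qed

locale domain_mesh = mesh +
  fixes \<Omega> :: "(real^2) set"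
  assumes open_domain: "open \<Omega>" and regular_domain: "interior (closure \<Omega>) = \<Omega>" and covers: "\<Union>\<T> = closure \<Omega>"
begin

definition cr_rep :: "(real^2 \<Rightarrow> real^2) \<Rightarrow> ((real^2) set \<Rightarrow> real^2) \<Rightarrow> bool" where
  "cr_rep \<tau> C \<longleftrightarrow> (\<forall>T\<in>\<T>. \<forall>x\<in>interior T. \<tau> x = cr C T x)"

definition const_rep :: "(real^2 \<Rightarrow> real) \<Rightarrow> ((real^2) set \<Rightarrow> real) \<Rightarrow> bool" where
  "const_rep u v \<longleftrightarrow> (\<forall>T\<in>\<T>. \<forall>x\<in>interior T. u x = v T)"

definition mass :: "((real^2) set \<Rightarrow> real^2) \<Rightarrow> ((real^2) set \<Rightarrow> real^2) \<Rightarrow> real" where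
  "mass C D = (\<Sum>T\<in>\<T>. tarea T / 3 * (\<Sum>e\<in>edges T. C e \<bullet> D e))"

text \<open>
  The difference of the normal jump between the two ends of the edge. As the jump has mean zero, it is
  determined by this number.
\<close>

definition cjump :: "((real^2) set \<Rightarrow> real^2) \<Rightarrow> (real^2) set \<Rightarrow> real" where
  "cjump C e = (\<Sum>T\<in>{T\<in>\<T>. e \<in> edges T}. outward_normal T e \<bullet> cr_grad C T (edge_vec e))"

text \<open>
  The stabilization in terms of these differences: the weight cancels the length of the edge, and
  the mean of \<open>(t - 1/2)\<^sup>2\<close> over the unit interval is \<open>1/12\<close>.
\<close>

definition stab :: "((real^2) set \<Rightarrow> real^2) \<Rightarrow> ((real^2) set \<Rightarrow> real^2) \<Rightarrow> real" where
  "stab C D = (\<Sum>e\<in>interior_edges \<T>. cjump C e * cjump D e) / 12"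

definition pair :: "((real^2) set \<Rightarrow> real) \<Rightarrow> ((real^2) set \<Rightarrow> real) \<Rightarrow> real" where
  "pair v w = (\<Sum>T\<in>\<T>. tarea T * (v T * w T))"

lemmas lebesgue_mesh = integral_lebesgue_mesh[OF open_domain regular_domain covers]

lemma edge_point:
  assumes "T \<in> \<T>" "e \<in> edges T" "t \<in> {0..1}"
  shows "edge_mid e + (t - 1/2) *\<^sub>R edge_vec e \<in> e" "edge_mid e + (t - 1/2) *\<^sub>R edge_vec e \<in> T"
proof -
  obtain p q r where t: "tri T p q r" "e = closed_segment q r" using edge_label[OF assms(1,2)] .
  have "edge_mid e + (t - 1/2) *\<^sub>R edge_vec e = linepath (fst (ends e)) (snd (ends e)) t"
    by (simp add: vec_eq_iff linepath_def edge_mid_def edge_vec_def midpoint_def algebra_simps)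
  moreover have "e = closed_segment (fst (ends e)) (snd (ends e))"
    using ends_segment[of q r] t(2) by (auto simp: closed_segment_commute)
  ultimately show e: "edge_mid e + (t - 1/2) *\<^sub>R edge_vec e \<in> e"
    using assms(3) linepath_in_path[of t] by metis
  have "e \<subseteq> T" using assms(2) by (auto simp: edges_def edge_of_def dest: face_of_imp_subset)
  then show "edge_mid e + (t - 1/2) *\<^sub>R edge_vec e \<in> T" using e by blast
qed

lemma edge_len_pos: "T \<in> \<T> \<Longrightarrow> e \<in> edges T \<Longrightarrow> 0 < edge_len e"
  by (metis edge_label edge_len_segment tri_neq(2) zero_less_norm_iff right_minus_eq)

lemma edge_weight_len: "T \<in> \<T> \<Longrightarrow> e \<in> edges T \<Longrightarrow> edge_weight e = 1 / edge_len e"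
  unfolding edge_weight_def by (metis edge_label edge_len_segment diameter_segment)

lemma trace_cr:
  assumes "cr_rep \<tau> C" "T \<in> \<T>" "x \<in> T"
  shows "elem_trace \<tau> T x = cr C T x"
proof -
  obtain p q r where t: "tri T p q r" using mesh_tri[OF assms(2)] .
  show ?thesis
    by (rule elem_trace_affine[OF t assms(3)])
      (use assms continuous_cr[OF tri_tarea_pos[OF t], of C] in \<open>auto simp: cr_rep_def continuous_on_eq_continuous_at\<close>)
qed

text \<open>
  At the midpoint the two traces agree and the normals cancel; what is left is linear along the edge.
\<close>

lemma normal_jump_cr:
  assumes \<tau>: "cr_rep \<tau> C" and e: "e \<in> interior_edges \<T>" and t: "t \<in> {0..1}"
  shows "normal_jump \<T> \<tau> e (edge_mid e + (t - 1/2) *\<^sub>R edge_vec e) = (t - 1/2) * cjump C e"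
proof -
  obtain T T' where T: "T \<in> \<T>" "T' \<in> \<T>" "T \<noteq> T'" "{T \<in> \<T>. e edge_of T} = {T, T'}" "outward_normal T' e = - outward_normal T e"
    using interior_edge_pair[OF e] .
  have eT: "e \<in> edges T" "e \<in> edges T'" and S: "{T \<in> \<T>. e \<in> edges T} = {T, T'}" using T(4) by (auto simp: edges_def)
  have tr: "elem_trace \<tau> T (edge_mid e + (t - 1/2) *\<^sub>R edge_vec e) = C e + (t - 1/2) *\<^sub>R cr_grad C T (edge_vec e)"
    if TT: "T \<in> \<T>" and eT: "e \<in> edges T" for T
  proof -
    obtain p q r where t': "tri T p q r" using mesh_tri[OF TT] .
    show ?thesis
      unfolding trace_cr[OF \<tau> TT edge_point(2)[OF TT eT t]] cr_step[OF tri_tarea_pos[OF t']] cr_mid[OF t' eT]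
      by (simp add: linear_scale[OF linear_cr_grad])
  qed
  have n: "a \<notin> {b}" if "a \<noteq> b" for a b :: "(real^2) set" using that by simp
  have sum_single: "(\<Sum>x\<in>{b}. g x) = g b" for g :: "(real^2) set \<Rightarrow> real" and b by simp
  show ?thesis
    unfolding normal_jump_def T(4) cjump_def S sum.insert[OF finite.emptyI[THEN finite.insertI] T(3)[THEN n]] sum_single
      tr[OF T(1) eT(1)] tr[OF T(2) eT(2)] T(5)
    by (simp add: inner_add_left inner_commute algebra_simps)
qed

lemma div_cr:
  assumes \<tau>: "cr_rep \<tau> C" and T: "T \<in> \<T>" and x: "x \<in> interior T"
  shows "div_h \<T> \<tau> x = cdiv C T"
proof -
  obtain p q r where t: "tri T p q r" using mesh_tri[OF T] .
  note a = tri_tarea_pos[OF t]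
  have "(cr C T has_derivative cr_grad C T) (at x)"
  proof -
    have "(cr_grad C T has_derivative cr_grad C T) (at x)"
      using linear_cr_grad by (intro bounded_linear_imp_has_derivative) (simp add: linear_conv_bounded_linear)
    then have "((\<lambda>y. cr C T 0 + cr_grad C T y) has_derivative cr_grad C T) (at x)"
      by (auto intro!: derivative_eq_intros)
    moreover have "cr C T = (\<lambda>y. cr C T 0 + cr_grad C T y)" using cr_affine[OF a] by (rule ext)
    ultimately show ?thesis by metis
  qed
  then have "(\<tau> has_derivative cr_grad C T) (at x)"
    by (rule has_derivative_transform_within_open[of _ _ _ _ "interior T"]) (use \<tau> T x in \<open>auto simp: cr_rep_def\<close>)
  then have "frechet_derivative \<tau> (at x) = cr_grad C T" by (rule frechet_derivative_at[symmetric])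
  then have "divergence \<tau> x = (\<Sum>i\<in>UNIV. cr_grad C T (axis i 1) $ i)" by (simp add: divergence_def)
  also have "\<dots> = cdiv C T"
    by (simp add: cr_grad_def cdiv_def sum_2 inner_axis inner_vec_def[of "C _"] sum_divide_distrib sum.distrib[symmetric] add_divide_distrib mult.commute)
  finally show ?thesis using T x by (auto simp: div_h_def)
qed

lemma integral_product_cr:
  assumes "cr_rep \<sigma> C" "cr_rep \<tau> D"
  shows "(LINT x|lebesgue_on \<Omega>. \<sigma> x \<bullet> \<tau> x) = mass C D"
proof -
  have "(LINT x|lebesgue_on \<Omega>. \<sigma> x \<bullet> \<tau> x) = (\<Sum>T\<in>\<T>. LINT z:interior T|lborel. cr C T z \<bullet> cr D T z)"
    by (rule lebesgue_mesh(2)) (use assms in \<open>auto simp: cr_rep_def intro!: continuous_intros continuous_cr tarea_pos\<close>)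
  also have "\<dots> = mass C D"
    unfolding mass_def by (intro sum.cong refl) (metis mesh_tri integral_cr_product)
  finally show ?thesis .
qed

lemma integral_product_const:
  assumes "const_rep u v" "const_rep u' v'"
  shows "(LINT x|lebesgue_on \<Omega>. u x * u' x) = pair v v'"
proof -
  have "(LINT x|lebesgue_on \<Omega>. u x * u' x) = (\<Sum>T\<in>\<T>. LINT z:interior T|lborel. v T * v' T)"
    by (rule lebesgue_mesh(2)) (use assms in \<open>auto simp: const_rep_def\<close>)
  then show ?thesis unfolding pair_def set_integral_const_tarea by (simp add: mult.commute)
qed

lemma const_rep_div: "cr_rep \<tau> C \<Longrightarrow> const_rep (div_h \<T> \<tau>) (cdiv C)"
  by (simp add: const_rep_def div_cr)

lemma edge_integral_normal_jump:
  assumes "cr_rep \<sigma> C" "cr_rep \<tau> D" and e: "e \<in> interior_edges \<T>"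
  shows "edge_integral e (\<lambda>x. edge_weight e * normal_jump \<T> \<sigma> e x * normal_jump \<T> \<tau> e x) = cjump C e * cjump D e / 12"
proof -
  obtain T where T: "T \<in> \<T>" "e \<in> edges T" using e by (auto simp: interior_edges_def edges_def)
  note l = edge_len_pos[OF T]
  have "edge_integral e (\<lambda>x. edge_weight e * normal_jump \<T> \<sigma> e x * normal_jump \<T> \<tau> e x)
      = edge_len e * integral {0..1} (\<lambda>t. (t - 1/2)\<^sup>2 * (cjump C e * cjump D e / edge_len e))"
    unfolding edge_integral_mid real_scaleR_def edge_weight_len[OF T]
    by (intro arg_cong[where f = "(*) (edge_len e)"] integral_cong)
      (simp only: normal_jump_cr[OF assms(1) e] normal_jump_cr[OF assms(2) e], simp add: power2_eq_square)
  also have "\<dots> = cjump C e * cjump D e / 12"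
    using l integral_unique[OF integral_centred_unit(2)] by (simp add: integral_mult_left)
  finally show ?thesis .
qed

lemma a_s_cr:
  assumes "cr_rep \<sigma> C" "cr_rep \<tau> D"
  shows "a_s \<Omega> \<T> \<sigma> \<tau> = mass C D + stab C D"
  unfolding a_s_def stab_def integral_product_cr[OF assms]
  by (simp add: edge_integral_normal_jump[OF assms] sum_divide_distrib)

lemma b_form_cr:
  assumes "cr_rep \<tau> C" "const_rep u v"
  shows "b_form \<Omega> \<T> \<tau> u = pair v (cdiv C)"
  unfolding b_form_def by (rule integral_product_const[OF assms(2) const_rep_div[OF assms(1)]])

lemma mass_nonneg: "0 \<le> mass C C"
  unfolding mass_def using tarea_pos by (intro sum_nonneg mult_nonneg_nonneg) (auto simp: less_imp_le)

lemma pair_nonneg: "0 \<le> pair v v"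
  unfolding pair_def using tarea_pos by (intro sum_nonneg mult_nonneg_nonneg[OF _ zero_le_square]) (simp add: less_imp_le)

lemma stab_nonneg: "0 \<le> stab C C"
  unfolding stab_def by (auto intro: sum_nonneg)

lemma nc_norm_cr:
  assumes "cr_rep \<tau> C" "const_rep u v"
  shows "nc_norm \<Omega> \<T> (\<tau>, u) = sqrt (mass C C + stab C C + pair (cdiv C) (cdiv C) + pair v v)"
proof -
  have 1: "(L2_norm \<Omega> \<tau>)\<^sup>2 = mass C C"
    unfolding L2_norm_def using integral_product_cr[OF assms(1,1)] mass_nonneg[of C] by (simp add: power2_norm_eq_inner)
  have p: "(L2_norm \<Omega> u)\<^sup>2 = pair v v" if "const_rep u v" for u :: "real^2 \<Rightarrow> real" and v
    unfolding L2_norm_def using integral_product_const[OF that that] pair_nonneg[of v] by (simp add: power2_eq_square)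
  have e: "(edge_L2_norm e (\<lambda>x. sqrt (edge_weight e) * normal_jump \<T> \<tau> e x))\<^sup>2 = cjump C e * cjump C e / 12"
    if e: "e \<in> interior_edges \<T>" for e
  proof -
    obtain T where T: "T \<in> \<T>" "e \<in> edges T" using e by (auto simp: interior_edges_def edges_def)
    have "0 \<le> edge_weight e" using edge_weight_len[OF T] edge_len_pos[OF T] by simp
    then have "(norm (sqrt (edge_weight e) * normal_jump \<T> \<tau> e x))\<^sup>2 = edge_weight e * normal_jump \<T> \<tau> e x * normal_jump \<T> \<tau> e x" for x
      by (simp add: power_mult_distrib) (simp add: power2_eq_square)
    then show ?thesis
      unfolding edge_L2_norm_def by (simp add: edge_integral_normal_jump[OF assms(1,1) e])
  qed
  show ?thesis
    unfolding nc_norm_def by (simp add: 1 p[OF assms(2)] p[OF const_rep_div[OF assms(1)]] e stab_def sum_divide_distrib)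
qed

end


section \<open>The discrete spaces in terms of edge values\<close>
context domain_mesh
begin

lemma V_h_const_rep:
  assumes "u \<in> V_h \<T>" obtains v where "const_rep u v"
  using assms unfolding V_h_def const_rep_def mem_Collect_eq by (metis that[unfolded const_rep_def])

lemma mesh_fun_V_h: "mesh_fun (\<lambda>T x. v T) \<in> V_h \<T>" "const_rep (mesh_fun (\<lambda>T x. v T)) v"
  unfolding V_h_def const_rep_def using mesh_fun_interior by blast+

text \<open>
  The linear part of the jump has mean zero along the edge, so only the difference at the midpoint is left.
\<close>

lemma edge_integral_jump:
  assumes v: "\<And>T x. T \<in> \<T> \<Longrightarrow> x \<in> interior T \<Longrightarrow> v x = a T \<bullet> x + c T"
    and T: "T \<in> \<T>" "T' \<in> \<T>" "T \<noteq> T'" "{T \<in> \<T>. e edge_of T} = {T, T'}" "outward_normal T' e = - outward_normal T e"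
  shows "edge_integral e (jump \<T> v e) =
    (edge_len e * ((a T \<bullet> edge_mid e + c T) - (a T' \<bullet> edge_mid e + c T'))) *\<^sub>R outward_normal T e"
proof -
  have eT: "e \<in> edges T" "e \<in> edges T'" using T(4) by (auto simp: edges_def)
  have tr: "elem_trace v S x = a S \<bullet> x + c S" if S: "S \<in> \<T>" "x \<in> S" for S x
  proof -
    obtain p q r where t: "tri S p q r" using mesh_tri[OF S(1)] .
    show ?thesis by (rule elem_trace_affine[OF t S(2)]) (use v S in \<open>auto intro!: continuous_intros\<close>)
  qed
  let ?d = "(a T \<bullet> edge_mid e + c T) - (a T' \<bullet> edge_mid e + c T')" and ?k = "a T \<bullet> edge_vec e - a T' \<bullet> edge_vec e"
  have n: "S \<notin> {S'}" if "S \<noteq> S'" for S S' :: "(real^2) set" using that by simp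
  have sum_single: "(\<Sum>x\<in>{b}. g x) = g b" for g :: "(real^2) set \<Rightarrow> real^2" and b by simp
  have j: "jump \<T> v e (edge_mid e + (t - 1/2) *\<^sub>R edge_vec e) = ?d *\<^sub>R outward_normal T e + (t - 1/2) *\<^sub>R (?k *\<^sub>R outward_normal T e)"
    if "t \<in> {0..1}" for t
    unfolding jump_def T(4) sum.insert[OF finite.emptyI[THEN finite.insertI] T(3)[THEN n]] sum_single
      tr[OF T(1) edge_point(2)[OF T(1) eT(1) that]] tr[OF T(2) edge_point(2)[OF T(2) eT(2) that]] T(5)
    by (simp add: inner_simps algebra_simps)
  have "((\<lambda>t. ?d *\<^sub>R outward_normal T e + (t - 1/2) *\<^sub>R (?k *\<^sub>R outward_normal T e)) has_integral
      ((1 - 0) *\<^sub>R (?d *\<^sub>R outward_normal T e) + 0 *\<^sub>R (?k *\<^sub>R outward_normal T e))) {0..1::real}"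
    by (intro has_integral_add has_integral_const_real[of _ 0 "1::real", simplified content_real[OF zero_le_one]] has_integral_scaleR_left integral_centred_unit(1))
  then have "((\<lambda>t. jump \<T> v e (edge_mid e + (t - 1/2) *\<^sub>R edge_vec e)) has_integral (?d *\<^sub>R outward_normal T e)) {0..1::real}"
    by (subst has_integral_cong[OF j]) simp_all
  then show ?thesis unfolding edge_integral_mid by (simp add: integral_unique)
qed

text \<open>
  The jump condition makes the midpoint values of the two neighbours agree, so that either one defines the
  value of \<open>C\<close> on the edge.
\<close>

lemma Sigma_h_cr_rep:
  assumes \<tau>: "\<tau> \<in> Sigma_h \<Omega> \<T>" obtains C where "cr_rep \<tau> C"
proof -
  have "\<forall>i. \<forall>T. \<exists>a c. T \<in> \<T> \<longrightarrow> (\<forall>x\<in>interior T. \<tau> x $ i = a \<bullet> x + c)"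
    using \<tau> unfolding Sigma_h_def CR_h_def by blast
  then obtain a c where ac: "\<And>i T x. T \<in> \<T> \<Longrightarrow> x \<in> interior T \<Longrightarrow> \<tau> x $ i = a i T \<bullet> x + c i T"
    unfolding choice_iff by blast
  define U where "U e = (SOME T. T \<in> \<T> \<and> e \<in> edges T)" for e
  define C where "C e = (\<chi> i. a i (U e) \<bullet> edge_mid e + c i (U e))" for e
  have C: "C e $ i = a i T \<bullet> edge_mid e + c i T" if T: "T \<in> \<T>" "e \<in> edges T" for T e i
  proof (cases "U e = T")
    case True then show ?thesis by (simp add: C_def)
  next
    case False
    have U: "U e \<in> \<T>" "e \<in> edges (U e)" unfolding U_def using someI[of "\<lambda>T. T \<in> \<T> \<and> e \<in> edges T" T] T by auto
    have S: "{T \<in> \<T>. e edge_of T} = {U e, T}"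
      using at_most_two[OF U(1) T(1) False U(2) T(2)] U T by (auto simp: edges_def)
    have I: "e \<in> interior_edges \<T>" using U T False by (auto simp: interior_edges_def edges_def)
    have "edge_integral e (jump \<T> (\<lambda>x. \<tau> x $ i) e) = 0"
      using \<tau> I unfolding Sigma_h_def CR_h_def by blast
    then have "(edge_len e * ((a i (U e) \<bullet> edge_mid e + c i (U e)) - (a i T \<bullet> edge_mid e + c i T))) *\<^sub>R outward_normal (U e) e = 0"
      using edge_integral_jump[of "\<lambda>x. \<tau> x $ i" "a i" "c i", OF ac U(1) T(1) False S shared_edge_normals[OF U(1) T(1) False U(2) T(2)]] by simp
    then show ?thesis using edge_len_pos[OF T] norm_outward_normal[OF U] by (auto simp: C_def)
  qed
  have "\<tau> x = cr C T x" if T: "T \<in> \<T>" "x \<in> interior T" for T x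
  proof -
    obtain p q r where t: "tri T p q r" using mesh_tri[OF T(1)] .
    have "\<tau> x $ i = cr C T x $ i" for i
    proof -
      have "\<tau> x $ i = (\<Sum>e\<in>edges T. (1 - 2 * bary T e x) * (a i T \<bullet> edge_mid e + c i T))"
        unfolding ac[OF T] by (rule affine_cr[OF t])
      also have "\<dots> = cr C T x $ i" unfolding cr_def sum_component by (intro sum.cong) (simp_all add: C[OF T(1)])
      finally show ?thesis .
    qed
    then show ?thesis by (simp add: vec_eq_iff)
  qed
  then show ?thesis by (intro that[of C]) (simp add: cr_rep_def)
qed

text \<open>
  The components vanish on the union of the edges, which is a null set.
\<close>

definition cr_fun :: "((real^2) set \<Rightarrow> real^2) \<Rightarrow> real^2 \<Rightarrow> real^2" where
  "cr_fun C x = (\<chi> i. mesh_fun (\<lambda>T x. cr C T x $ i) x)"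

lemma cr_rep_cr_fun: "cr_rep (cr_fun C) C"
  by (simp add: cr_rep_def cr_fun_def mesh_fun_interior vec_eq_iff)

lemma cr_fun_Sigma_h: "cr_fun C \<in> Sigma_h \<Omega> \<T>"
proof -
  have "(\<lambda>x. cr_fun C x $ i) \<in> CR_h \<Omega> \<T>" for i
  proof -
    define v where "v = mesh_fun (\<lambda>T x. cr C T x $ i)"
    have vT: "v x = cr C T x $ i" if "T \<in> \<T>" "x \<in> interior T" for T x
      using that by (simp add: v_def mesh_fun_interior)
    have c: "continuous_on UNIV (\<lambda>x. cr C T x $ i)" if "T \<in> \<T>" for T
      by (intro continuous_intros continuous_cr tarea_pos that)
    have "v \<in> borel_measurable borel"
      unfolding v_def mesh_fun_def using c by (intro borel_measurable_sum borel_measurable_times borel_measurable_indicator)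
        (auto intro: borel_measurable_continuous_onI)
    then have m: "v \<in> borel_measurable (lebesgue_on \<Omega>)"
      by (intro measurable_restrict_space1) (simp add: measurable_completion)
    have i: "integrable (lebesgue_on \<Omega>) (\<lambda>x. (v x)\<^sup>2)"
      by (rule lebesgue_mesh(1)[where G = "\<lambda>T x. (cr C T x $ i)\<^sup>2"]) (auto simp: vT intro!: continuous_intros continuous_cr tarea_pos)
    define a where "a T = (\<Sum>e\<in>edges T. (C e $ i / tarea T) *\<^sub>R edge_normal T e)" for T
    define b where "b T = cr C T 0 $ i" for T
    have ab: "cr C T x $ i = a T \<bullet> x + b T" if "T \<in> \<T>" for T x
      unfolding a_def b_def by (rule cr_component[OF tarea_pos[OF that]])
    have mid: "a T \<bullet> edge_mid e + b T = C e $ i" if T: "T \<in> \<T>" "e \<in> edges T" for T e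
      using mesh_tri[OF T(1)] cr_mid[OF _ T(2)] by (metis ab[OF T(1)])
    have "edge_integral e (jump \<T> v e) = 0" if e: "e \<in> interior_edges \<T>" for e
    proof -
      obtain T T' where T: "T \<in> \<T>" "T' \<in> \<T>" "T \<noteq> T'" "{T \<in> \<T>. e edge_of T} = {T, T'}" "outward_normal T' e = - outward_normal T e"
        using interior_edge_pair[OF e] .
      have eT: "e \<in> edges T" "e \<in> edges T'" using T(4) by (auto simp: edges_def)
      show ?thesis using edge_integral_jump[of v a b, OF _ T] vT ab mid[OF T(1) eT(1)] mid[OF T(2) eT(2)] by simp
    qed
    have "v \<in> CR_h \<Omega> \<T>"
    proof -
      have "\<exists>a c. \<forall>x\<in>interior T. v x = a \<bullet> x + c" if "T \<in> \<T>" for T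
        using vT[OF that] ab[OF that] by metis
      then show ?thesis
        using m i \<open>\<And>e. e \<in> interior_edges \<T> \<Longrightarrow> edge_integral e (jump \<T> v e) = 0\<close> by (simp add: CR_h_def L2_def)
    qed
    then show ?thesis by (simp add: v_def cr_fun_def)
  qed
  then show ?thesis by (simp add: Sigma_h_def)
qed

section \<open>Bilinearity of the discrete forms\<close>

lemma cr_grad_add_scale: "cr_grad (\<lambda>e. C e + t *\<^sub>R D e) T h = cr_grad C T h + t *\<^sub>R cr_grad D T h"
  by (simp add: cr_grad_def scaleR_add_right sum.distrib scaleR_sum_right mult.commute)

lemma cjump_add_scale: "cjump (\<lambda>e. C e + t *\<^sub>R D e) e = cjump C e + t * cjump D e"
  by (simp add: cjump_def cr_grad_add_scale inner_simps sum.distrib sum_distrib_left)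

lemma cdiv_add_scale: "cdiv (\<lambda>e. C e + t *\<^sub>R D e) = (\<lambda>T. cdiv C T + t * cdiv D T)"
  by (simp add: cdiv_def inner_simps sum.distrib sum_distrib_left[symmetric] add_divide_distrib fun_eq_iff)

definition energy :: "((real^2) set \<Rightarrow> real^2) \<Rightarrow> ((real^2) set \<Rightarrow> real^2) \<Rightarrow> real" where
  "energy C D = mass C D + stab C D"

lemma energy_add_scale: "energy (\<lambda>e. C e + t *\<^sub>R D e) E = energy C E + t * energy D E"
proof -
  have "mass (\<lambda>e. C e + t *\<^sub>R D e) E = mass C E + t * mass D E"
    by (simp add: mass_def inner_simps sum.distrib sum_distrib_left sum_divide_distrib algebra_simps)
  moreover have "stab (\<lambda>e. C e + t *\<^sub>R D e) E = stab C E + t * stab D E"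
    by (simp add: stab_def cjump_add_scale distrib_right sum.distrib add_divide_distrib sum_distrib_left mult.assoc)
  ultimately show ?thesis by (simp add: energy_def algebra_simps)
qed

lemma energy_commute: "energy C D = energy D C"
  by (simp add: energy_def mass_def stab_def inner_commute mult.commute)

lemma energy_nonneg: "0 \<le> energy C C"
  using mass_nonneg stab_nonneg by (simp add: energy_def)

lemma energy_square: "energy (\<lambda>e. C e + t *\<^sub>R D e) (\<lambda>e. C e + t *\<^sub>R D e) = energy C C + 2 * t * energy C D + t\<^sup>2 * energy D D"
  unfolding energy_add_scale energy_commute[of _ "\<lambda>e. C e + t *\<^sub>R D e"]
  by (simp add: energy_add_scale energy_commute[of D C] power2_eq_square algebra_simps)

lemma pair_add_scale: "pair (\<lambda>T. v T + t * w T) x = pair v x + t * pair w x"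
  by (simp add: pair_def distrib_right distrib_left sum.distrib sum_distrib_left mult.left_commute mult.assoc)

lemma pair_commute: "pair v w = pair w v"
  by (simp add: pair_def mult.commute)

lemma pair_square: "pair (\<lambda>T. v T + t * w T) (\<lambda>T. v T + t * w T) = pair v v + 2 * t * pair v w + t\<^sup>2 * pair w w"
  unfolding pair_add_scale pair_commute[of _ "\<lambda>T. v T + t * w T"]
  by (simp add: pair_add_scale pair_commute[of w v] power2_eq_square algebra_simps)

section \<open>The dual estimate\<close>

lemma finite_mesh_edges: "finite (\<Union>T\<in>\<T>. edges T)"
  using finite_mesh finite_edges simplices by auto

lemma pair_zero: "pair w w = 0 \<Longrightarrow> T \<in> \<T> \<Longrightarrow> w T = 0"
proof -
  assume a: "pair w w = 0" "T \<in> \<T>"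
  have nn: "0 \<le> tarea S * (w S * w S)" if "S \<in> \<T>" for S using tarea_pos[OF that] by simp
  have "(\<Sum>S\<in>\<T>. tarea S * (w S * w S)) = 0" using a(1) by (simp only: pair_def)
  then have "\<forall>S\<in>\<T>. tarea S * (w S * w S) = 0" by (rule iffD1[OF sum_nonneg_eq_0_iff[OF finite_mesh], rotated]) (rule nn)
  then have "tarea T * (w T * w T) = 0" using a(2) by (rule bspec)
  then show ?thesis using tarea_pos[OF a(2)] by simp
qed

text \<open>
  The form and the functional depend on coefficients of finitely many edges. A null vector of the form has
  zero divergence, so the functional vanishes on it.
\<close>

lemma riesz_representer:
  obtains C where "\<And>e. e \<notin> (\<Union>T\<in>\<T>. edges T) \<Longrightarrow> C e = 0"
    "\<And>D. (\<And>e. e \<notin> (\<Union>T\<in>\<T>. edges T) \<Longrightarrow> D e = 0) \<Longrightarrow> energy C D + pair (cdiv C) (cdiv D) = pair v (cdiv D)"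
proof -
  let ?E = "\<Union>T\<in>\<T>. edges T"
  define coef :: "((real^2) set \<times> 2 \<Rightarrow> real) \<Rightarrow> (real^2) set \<Rightarrow> real^2" where "coef c = (\<lambda>e. \<chi> k. c (e, k))" for c
  have coef: "coef (\<lambda>i. c i + t * d i) = (\<lambda>e. coef c e + t *\<^sub>R coef d e)" for c d t
    by (simp add: coef_def fun_eq_iff vec_eq_iff)
  let ?Q = "\<lambda>c d. energy (coef c) (coef d) + pair (cdiv (coef c)) (cdiv (coef d))"
  let ?L = "\<lambda>c. pair v (cdiv (coef c))"
  have "\<exists>c. (\<forall>i. i \<notin> ?E \<times> UNIV \<longrightarrow> c i = 0) \<and> (\<forall>d. (\<forall>i. i \<notin> ?E \<times> UNIV \<longrightarrow> d i = 0) \<longrightarrow> ?Q c d = ?L d)"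
  proof (rule psd_representer[where Q = ?Q and L = ?L])
    show "finite (?E \<times> (UNIV :: 2 set))" using finite_mesh_edges by simp
    show "?Q (\<lambda>i. c i + t * d i) e = ?Q c e + t * ?Q d e" for c d e t
      by (simp only: coef energy_add_scale cdiv_add_scale pair_add_scale distrib_left add_ac)
    show "?Q c d = ?Q d c" for c d by (simp only: energy_commute[of "coef c"] pair_commute[of "cdiv (coef c)"])
    show "0 \<le> ?Q c c" for c using energy_nonneg pair_nonneg by simp
    show "?L (\<lambda>i. c i + t * d i) = ?L c + t * ?L d" for c d t
      using pair_add_scale[of "cdiv (coef c)" t "cdiv (coef d)" v] by (simp only: coef cdiv_add_scale pair_commute[where w = v])
    fix c assume "?Q c c = 0"
    then have "pair (cdiv (coef c)) (cdiv (coef c)) = 0" using energy_nonneg[of "coef c"] pair_nonneg[of "cdiv (coef c)"] by linarith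
    then have "cdiv (coef c) T = 0" if "T \<in> \<T>" for T using pair_zero that by blast
    then show "?L c = 0" by (simp add: pair_def)
  qed
  then obtain c where c: "\<forall>i. i \<notin> ?E \<times> UNIV \<longrightarrow> c i = 0" "\<forall>d. (\<forall>i. i \<notin> ?E \<times> UNIV \<longrightarrow> d i = 0) \<longrightarrow> ?Q c d = ?L d"
    by (elim exE conjE)
  show ?thesis
  proof (rule that[of "coef c"])
    show "coef c e = 0" if "e \<notin> ?E" for e using c(1) that by (simp add: coef_def vec_eq_iff)
    fix D assume D: "\<And>e. e \<notin> ?E \<Longrightarrow> D e = (0 :: real^2)"
    have "coef (\<lambda>(e, k). D e $ k) = D" by (simp add: coef_def fun_eq_iff vec_eq_iff)
    moreover have "\<forall>i. i \<notin> ?E \<times> UNIV \<longrightarrow> (\<lambda>(e, k). D e $ k) i = 0" using D by auto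
    ultimately show "energy (coef c) D + pair (cdiv (coef c)) (cdiv D) = pair v (cdiv D)"
      using c(2)[THEN spec, of "\<lambda>(e, k). D e $ k", THEN mp] by metis
  qed
qed

text \<open>
  Collecting the coefficients of the edge values of \<open>D\<close> shows that the residual is the force balance of the
  constant part of the stress: the normal force through an edge against a third of the area times the value of \<open>C\<close>.
\<close>

lemma residual_identity:
  defines "j \<equiv> \<lambda>C e. if e \<in> interior_edges \<T> then cjump C e else 0"
  shows "pair v (cdiv D) - (energy C D + pair (cdiv C) (cdiv D)) =
    (\<Sum>T\<in>\<T>. \<Sum>e\<in>edges T. \<Sum>k\<in>UNIV.
      (mean_stress (v T - cdiv C T) (j C) T k \<bullet> edge_normal T e - tarea T / 3 * C e $ k) * D e $ k)"
proof -
  have st: "stab C D = (\<Sum>T\<in>\<T>. \<Sum>e\<in>edges T. j C e / 12 * (outward_normal T e \<bullet> cr_grad D T (edge_vec e)))"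
  proof -
    have "(\<Sum>T\<in>\<T>. \<Sum>e\<in>edges T. j C e / 12 * (outward_normal T e \<bullet> cr_grad D T (edge_vec e)))
        = (\<Sum>T\<in>\<T>. \<Sum>e\<in>{e\<in>interior_edges \<T>. e \<in> edges T}. cjump C e / 12 * (outward_normal T e \<bullet> cr_grad D T (edge_vec e)))"
    proof (rule sum.cong[OF refl])
      fix T assume T: "T \<in> \<T>"
      have "(\<Sum>e\<in>edges T. j C e / 12 * (outward_normal T e \<bullet> cr_grad D T (edge_vec e)))
          = (\<Sum>e\<in>edges T. if e \<in> interior_edges \<T> then cjump C e / 12 * (outward_normal T e \<bullet> cr_grad D T (edge_vec e)) else 0)"
        by (intro sum.cong) (auto simp: j_def)
      also have "\<dots> = (\<Sum>e\<in>{e\<in>edges T. e \<in> interior_edges \<T>}. cjump C e / 12 * (outward_normal T e \<bullet> cr_grad D T (edge_vec e)))"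
        using finite_edges[OF simplices[OF T]] by (rule sum.inter_filter[symmetric])
      also have "{e\<in>edges T. e \<in> interior_edges \<T>} = {e\<in>interior_edges \<T>. e \<in> edges T}" by auto
      finally show "(\<Sum>e\<in>edges T. j C e / 12 * (outward_normal T e \<bullet> cr_grad D T (edge_vec e)))
          = (\<Sum>e\<in>{e\<in>interior_edges \<T>. e \<in> edges T}. cjump C e / 12 * (outward_normal T e \<bullet> cr_grad D T (edge_vec e)))" .
    qed
    also have "\<dots> = (\<Sum>e\<in>interior_edges \<T>. \<Sum>T\<in>{T\<in>\<T>. e \<in> edges T}. cjump C e / 12 * (outward_normal T e \<bullet> cr_grad D T (edge_vec e)))"
      using finite_mesh finite_interior_edges by (rule sum.swap_restrict)
    also have "\<dots> = stab C D"
      by (simp add: stab_def cjump_def[of D] sum_distrib_left sum_divide_distrib)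
    finally show ?thesis by simp
  qed
  have loc: "(\<Sum>e\<in>edges T. \<Sum>k\<in>UNIV. (mean_stress (v T - cdiv C T) (j C) T k \<bullet> edge_normal T e - tarea T / 3 * C e $ k) * D e $ k)
      = tarea T * (v T * cdiv D T) - tarea T * (cdiv C T * cdiv D T) - tarea T / 3 * (\<Sum>e\<in>edges T. C e \<bullet> D e)
        - (\<Sum>e\<in>edges T. j C e / 12 * (outward_normal T e \<bullet> cr_grad D T (edge_vec e)))" if T: "T \<in> \<T>" for T
  proof -
    note a = tarea_pos[OF T]
    define w where "w = v T - cdiv C T"
    let ?n = "outward_normal T" and ?N = "edge_normal T"
    have ms: "mean_stress w (j C) T k \<bullet> ?N e = w * ?N e $ k - (\<Sum>e'\<in>edges T. j C e' / 12 * (?N e \<bullet> edge_vec e' / tarea T) * ?n e' $ k)" for k e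
      unfolding inner_commute[of "mean_stress w (j C) T k"]
      by (simp add: mean_stress_def inner_diff_right inner_sum_right inner_axis mult_ac)
    have dyad: "(\<Sum>k\<in>UNIV. (\<Sum>e'\<in>edges T. g e' * ?n e' $ k) * y $ k) = (\<Sum>e'\<in>edges T. g e' * (?n e' \<bullet> y))" for g and y :: "real^2"
      unfolding sum_2 inner_vec_def inner_real_def sum_distrib_right distrib_left sum.distrib by (simp add: mult.assoc)
    have "(\<Sum>e\<in>edges T. \<Sum>k\<in>UNIV. (mean_stress w (j C) T k \<bullet> ?N e - tarea T / 3 * C e $ k) * D e $ k)
      = (\<Sum>e\<in>edges T. w * (D e \<bullet> ?N e) - tarea T / 3 * (C e \<bullet> D e) - (\<Sum>e'\<in>edges T. j C e' / 12 * (?n e' \<bullet> ((?N e \<bullet> edge_vec e' / tarea T) *\<^sub>R D e))))"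
    proof (rule sum.cong[OF refl])
      fix e
      have "(\<Sum>k\<in>UNIV. (mean_stress w (j C) T k \<bullet> ?N e - tarea T / 3 * C e $ k) * D e $ k)
        = w * (D e \<bullet> ?N e) - tarea T / 3 * (C e \<bullet> D e)
          - (\<Sum>k\<in>UNIV. (\<Sum>e'\<in>edges T. j C e' / 12 * (?N e \<bullet> edge_vec e' / tarea T) * ?n e' $ k) * D e $ k)"
        unfolding ms by (simp only: sum_2 inner_vec_def[of "D e"] inner_vec_def[of "C e"] inner_real_def) (simp add: algebra_simps)
      then show "(\<Sum>k\<in>UNIV. (mean_stress w (j C) T k \<bullet> ?N e - tarea T / 3 * C e $ k) * D e $ k)
        = w * (D e \<bullet> ?N e) - tarea T / 3 * (C e \<bullet> D e) - (\<Sum>e'\<in>edges T. j C e' / 12 * (?n e' \<bullet> ((?N e \<bullet> edge_vec e' / tarea T) *\<^sub>R D e)))"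
        unfolding dyad by (simp add: mult.assoc)
    qed
    also have "\<dots> = w * (\<Sum>e\<in>edges T. D e \<bullet> ?N e) - tarea T / 3 * (\<Sum>e\<in>edges T. C e \<bullet> D e)
        - (\<Sum>e\<in>edges T. \<Sum>e'\<in>edges T. j C e' / 12 * (?n e' \<bullet> ((?N e \<bullet> edge_vec e' / tarea T) *\<^sub>R D e)))"
      by (simp add: sum_subtractf sum_distrib_left)
    also have "(\<Sum>e\<in>edges T. \<Sum>e'\<in>edges T. j C e' / 12 * (?n e' \<bullet> ((?N e \<bullet> edge_vec e' / tarea T) *\<^sub>R D e)))
        = (\<Sum>e'\<in>edges T. j C e' / 12 * (?n e' \<bullet> cr_grad D T (edge_vec e')))"
      by (subst sum.swap) (simp add: cr_grad_def inner_sum_right sum_distrib_left)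
    also have "(\<Sum>e\<in>edges T. D e \<bullet> ?N e) = tarea T * cdiv D T" using a by (simp add: cdiv_def)
    finally show ?thesis unfolding w_def by (simp add: algebra_simps)
  qed
  have g: "a - b - c - d = a - (c + d + b)" for a b c d :: real by simp
  have "(\<Sum>T\<in>\<T>. \<Sum>e\<in>edges T. \<Sum>k\<in>UNIV.
      (mean_stress (v T - cdiv C T) (j C) T k \<bullet> edge_normal T e - tarea T / 3 * C e $ k) * D e $ k)
    = (\<Sum>T\<in>\<T>. tarea T * (v T * cdiv D T) - tarea T * (cdiv C T * cdiv D T) - tarea T / 3 * (\<Sum>e\<in>edges T. C e \<bullet> D e)
        - (\<Sum>e\<in>edges T. j C e / 12 * (outward_normal T e \<bullet> cr_grad D T (edge_vec e))))"
    by (rule sum.cong[OF refl]) (rule loc)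
  also have "\<dots> = pair v (cdiv D) - (energy C D + pair (cdiv C) (cdiv D))"
    by (simp only: sum_subtractf sum.distrib st energy_def mass_def pair_def g)
  finally show ?thesis by (rule sym)
qed

text \<open>
  The residual identity with \<open>D\<close> supported on one edge and one component gives the balance of forces there,
  and the trace estimate applies.
\<close>

lemma dual_estimate:
  assumes r: "0 \<le> r" and sq: "\<And>T. T \<in> \<T> \<Longrightarrow> T \<subseteq> plane_square r"
    and C: "\<And>D. (\<And>e. e \<notin> (\<Union>T\<in>\<T>. edges T) \<Longrightarrow> D e = 0) \<Longrightarrow> energy C D + pair (cdiv C) (cdiv D) = pair v (cdiv D)"
  defines "w \<equiv> \<lambda>T. v T - cdiv C T"
  shows "pair w w \<le> 300 * (r + 1)\<^sup>2 * energy C C"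
proof -
  define j where "j e = (if e \<in> interior_edges \<T> then cjump C e else 0)" for e
  let ?F = "\<lambda>T e k. mean_stress (w T) j T k \<bullet> edge_normal T e - tarea T / 3 * C e $ k"
  have EQ: "(\<Sum>T\<in>{T\<in>\<T>. e \<in> edges T}. ?F T e k) = 0" if e: "e \<in> (\<Union>T\<in>\<T>. edges T)" for e k
  proof -
    let ?D = "\<lambda>e'. if e' = e then axis k 1 else 0 :: real^2"
    have "0 = pair v (cdiv ?D) - (energy C ?D + pair (cdiv C) (cdiv ?D))"
    proof -
      have "?D e' = 0" if "e' \<notin> (\<Union>T\<in>\<T>. edges T)" for e' using that e by auto
      then show ?thesis by (subst C) simp_all
    qed
    also have "\<dots> = (\<Sum>T\<in>\<T>. \<Sum>e'\<in>edges T. \<Sum>k'\<in>UNIV. ?F T e' k' * ?D e' $ k')"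
      unfolding residual_identity w_def j_def[abs_def] ..
    also have "\<dots> = (\<Sum>T\<in>\<T>. if e \<in> edges T then ?F T e k else 0)"
    proof (rule sum.cong[OF refl])
      fix T assume T: "T \<in> \<T>"
      have "(\<Sum>k'\<in>UNIV. ?F T e' k' * ?D e' $ k') = (if e' = e then ?F T e k else 0)" for e'
        by (auto simp: axis_def if_distrib[of "\<lambda>x. _ * x"] cong: if_cong)
      then show "(\<Sum>e'\<in>edges T. \<Sum>k'\<in>UNIV. ?F T e' k' * ?D e' $ k') = (if e \<in> edges T then ?F T e k else 0)"
        using finite_edges[OF simplices[OF T]] by simp
    qed
    also have "\<dots> = (\<Sum>T\<in>{T\<in>\<T>. e \<in> edges T}. ?F T e k)"
      by (rule sum.inter_filter[symmetric]) (rule finite_mesh)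
    finally show ?thesis by simp
  qed
  have J: "(\<Sum>T\<in>\<T>. \<Sum>e\<in>edges T. (j e)\<^sup>2) / 24 = stab C C"
  proof -
    have "(\<Sum>T\<in>\<T>. \<Sum>e\<in>edges T. (j e)\<^sup>2) = (\<Sum>T\<in>\<T>. \<Sum>e\<in>{e\<in>interior_edges \<T>. e \<in> edges T}. (cjump C e)\<^sup>2)"
    proof (rule sum.cong[OF refl])
      fix T assume T: "T \<in> \<T>"
      have "(\<Sum>e\<in>edges T. (j e)\<^sup>2) = (\<Sum>e\<in>edges T. if e \<in> interior_edges \<T> then (cjump C e)\<^sup>2 else 0)"
        by (intro sum.cong) (auto simp: j_def)
      also have "\<dots> = (\<Sum>e\<in>{e\<in>edges T. e \<in> interior_edges \<T>}. (cjump C e)\<^sup>2)"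
        using finite_edges[OF simplices[OF T]] by (rule sum.inter_filter[symmetric])
      also have "{e\<in>edges T. e \<in> interior_edges \<T>} = {e\<in>interior_edges \<T>. e \<in> edges T}" by auto
      finally show "(\<Sum>e\<in>edges T. (j e)\<^sup>2) = (\<Sum>e\<in>{e\<in>interior_edges \<T>. e \<in> edges T}. (cjump C e)\<^sup>2)" .
    qed
    also have "\<dots> = (\<Sum>e\<in>interior_edges \<T>. \<Sum>T\<in>{T\<in>\<T>. e \<in> edges T}. (cjump C e)\<^sup>2)"
      using finite_mesh finite_interior_edges by (rule sum.swap_restrict)
    also have "\<dots> = (\<Sum>e\<in>interior_edges \<T>. 2 * (cjump C e)\<^sup>2)"
    proof (rule sum.cong[OF refl])
      fix e assume e: "e \<in> interior_edges \<T>"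
      obtain T T' where T: "T \<noteq> T'" "{T \<in> \<T>. e edge_of T} = {T, T'}" using interior_edge_pair[OF e] by metis
      then show "(\<Sum>T\<in>{T\<in>\<T>. e \<in> edges T}. (cjump C e)\<^sup>2) = 2 * (cjump C e)\<^sup>2" by (simp add: edges_def)
    qed
    finally show ?thesis by (simp add: stab_def power2_eq_square sum_distrib_left[symmetric])
  qed
  have "(\<Sum>T\<in>\<T>. tarea T * (w T)\<^sup>2) \<le> 300 * (r + 1)\<^sup>2 *
    ((\<Sum>T\<in>\<T>. tarea T / 3 * (\<Sum>e\<in>edges T. (norm (C e))\<^sup>2)) + (\<Sum>T\<in>\<T>. \<Sum>e\<in>edges T. (j e)\<^sup>2) / 24)"
    by (rule stress_estimate[OF r sq EQ])
  then show ?thesis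
    unfolding J by (simp add: pair_def energy_def mass_def power2_eq_square[of "w _"] power2_norm_eq_inner)
qed

section \<open>The inf-sup condition\<close>

definition coeff_form :: "((real^2) set \<Rightarrow> real^2) \<Rightarrow> ((real^2) set \<Rightarrow> real) \<Rightarrow> ((real^2) set \<Rightarrow> real^2) \<Rightarrow> ((real^2) set \<Rightarrow> real) \<Rightarrow> real" where
  "coeff_form C v D w = energy C D - pair v (cdiv D) - pair w (cdiv C)"

definition coeff_norm2 :: "((real^2) set \<Rightarrow> real^2) \<Rightarrow> ((real^2) set \<Rightarrow> real) \<Rightarrow> real" where
  "coeff_norm2 C v = energy C C + pair (cdiv C) (cdiv C) + pair v v"

text \<open>
  Here \<open>S\<close> is the representer of \<open>b(_, v)\<close> and \<open>t\<close> its squared norm, so that testing with \<open>C - S\<close> produces \<open>+ t\<close>.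
  The choice \<open>x = - v - div C\<close> cancels the terms \<open>b(C, v)\<close> and leaves the squared divergence of \<open>C\<close>. The dual
  estimate bounds \<open>v\<close> by \<open>t\<close>, and \<open>t\<close> is bounded by \<open>v\<close>, which controls the norm of the test pair.
\<close>

lemma coeff_inf_sup:
  assumes r: "0 \<le> r" and sq: "\<And>T. T \<in> \<T> \<Longrightarrow> T \<subseteq> plane_square r"
  obtains D w where "coeff_norm2 C v \<le> 4 * (300 * (r + 1)\<^sup>2 + 1) * coeff_form C v D w" "coeff_norm2 D w \<le> 4 * coeff_norm2 C v"
proof -
  define K where "K = 300 * (r + 1)\<^sup>2"
  have K: "0 \<le> K" by (simp add: K_def)
  obtain S where S: "\<And>e. e \<notin> (\<Union>T\<in>\<T>. edges T) \<Longrightarrow> S e = 0"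
    "\<And>D. (\<And>e. e \<notin> (\<Union>T\<in>\<T>. edges T) \<Longrightarrow> D e = 0) \<Longrightarrow> energy S D + pair (cdiv S) (cdiv D) = pair v (cdiv D)"
    using riesz_representer[of v] by blast
  define t where "t = energy S S + pair (cdiv S) (cdiv S)"
  have "energy S S + pair (cdiv S) (cdiv S) = pair v (cdiv S)" by (rule S(2)) (rule S(1))
  then have tv: "pair v (cdiv S) = t" by (simp add: t_def)
  \<comment> \<open>Differences are written with the factor \<open>-1\<close> to fit the rules for bilinearity.\<close>
  define w where "w T = v T + (-1) * cdiv S T" for T
  have w: "pair w w \<le> K * energy S S" 
  proof -
    have w': "w = (\<lambda>T. v T - cdiv S T)" by (simp add: w_def fun_eq_iff)
    have "pair (\<lambda>T. v T - cdiv S T) (\<lambda>T. v T - cdiv S T) \<le> K * energy S S"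
      unfolding K_def
    proof (rule dual_estimate[OF r])
      show "T \<subseteq> plane_square r" if "T \<in> \<T>" for T by (rule sq[OF that])
      show "energy S E + pair (cdiv S) (cdiv E) = pair v (cdiv E)" if "\<And>e. e \<notin> (\<Union>T\<in>\<T>. edges T) \<Longrightarrow> E e = 0" for E
        by (rule S(2)) (rule that)
    qed
    then show ?thesis by (simp only: w')
  qed
  have nn: "0 \<le> energy S S" "0 \<le> pair (cdiv S) (cdiv S)" "0 \<le> energy C C" "0 \<le> pair (cdiv C) (cdiv C)" "0 \<le> pair v v"
    by (rule energy_nonneg pair_nonneg)+
  have t: "0 \<le> t" "energy S S \<le> t" "pair (cdiv S) (cdiv S) \<le> t" using nn by (auto simp: t_def)
  define D where "D e = C e + (-1) *\<^sub>R S e" for e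
  define x where "x T = (-1) * v T + (-1) * cdiv C T" for T
  have cD: "cdiv D = (\<lambda>T. cdiv C T + (-1) * cdiv S T)" unfolding D_def[abs_def] by (rule cdiv_add_scale)
  have U: "pair v v \<le> 2 * (K + 1) * t"
  proof -
    have "pair w w = pair v v - 2 * t + pair (cdiv S) (cdiv S)"
      unfolding w_def[abs_def] pair_square tv by simp
    moreover have "0 \<le> pair (\<lambda>T. v T + (-2) * cdiv S T) (\<lambda>T. v T + (-2) * cdiv S T)" by (rule pair_nonneg)
    then have "0 \<le> pair v v - 4 * t + 4 * pair (cdiv S) (cdiv S)" unfolding pair_square tv by simp
    ultimately have "pair v v \<le> 2 * pair w w + 2 * pair (cdiv S) (cdiv S)" by linarith
    also have "\<dots> \<le> 2 * (K * t) + 2 * t"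
      using w t mult_left_mono[OF t(2) K] by linarith
    finally show ?thesis by (simp add: algebra_simps)
  qed
  have xC: "pair x (cdiv C) = - pair v (cdiv C) - pair (cdiv C) (cdiv C)"
    unfolding x_def[abs_def] using pair_add_scale[of "\<lambda>T. (-1) * v T" "-1" "cdiv C" "cdiv C"] pair_add_scale[of "\<lambda>T. 0" "-1" v "cdiv C"]
    by (simp add: pair_def)
  have vD: "pair v (cdiv D) = pair v (cdiv C) - t"
    using pair_add_scale[of "cdiv C" "-1" "cdiv S" v] tv
    unfolding cD pair_commute[of _ v] by simp
  have eD: "energy C D = energy C C - energy C S"
    unfolding energy_commute[of C D] energy_commute[of C S] unfolding D_def[abs_def] energy_add_scale by simp
  have cs: "2 * energy C S \<le> energy C C + energy S S"
    using energy_nonneg[of "\<lambda>e. C e + (-1) *\<^sub>R S e"] unfolding energy_square by simp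
  have B: "energy C C / 2 + t / 2 + pair (cdiv C) (cdiv C) \<le> coeff_form C v D x"
    unfolding coeff_form_def eD vD xC using cs t by linarith
  have n1: "coeff_norm2 C v \<le> 4 * (K + 1) * coeff_form C v D x"
  proof -
    have "coeff_norm2 C v \<le> energy C C + pair (cdiv C) (cdiv C) + 2 * (K + 1) * t" using U by (simp add: coeff_norm2_def)
    also have "\<dots> \<le> 2 * (K + 1) * energy C C + 4 * (K + 1) * pair (cdiv C) (cdiv C) + 2 * (K + 1) * t"
    proof -
      have "1 * energy C C \<le> 2 * (K + 1) * energy C C" "1 * pair (cdiv C) (cdiv C) \<le> 4 * (K + 1) * pair (cdiv C) (cdiv C)"
        using K nn by (intro mult_right_mono; simp)+
      then show ?thesis by simp
    qed
    also have "\<dots> = 4 * (K + 1) * (energy C C / 2 + t / 2 + pair (cdiv C) (cdiv C))" by (simp add: algebra_simps)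
    also have "\<dots> \<le> 4 * (K + 1) * coeff_form C v D x" using K by (intro mult_left_mono B) simp
    finally show ?thesis .
  qed
  have tU: "t \<le> pair v v"
  proof -
    have "0 \<le> pair v v - 2 * t + pair (cdiv S) (cdiv S)"
      using pair_nonneg[of "\<lambda>T. v T + (-1) * cdiv S T"] unfolding pair_square tv by simp
    then show ?thesis using t by linarith
  qed
  have n2: "coeff_norm2 D x \<le> 4 * coeff_norm2 C v"
  proof -
    have 1: "energy D D \<le> 2 * energy C C + 2 * energy S S"
      using energy_nonneg[of "\<lambda>e. C e + 1 *\<^sub>R S e"] unfolding D_def[abs_def] energy_square by simp
    have 2: "pair (cdiv D) (cdiv D) \<le> 2 * pair (cdiv C) (cdiv C) + 2 * pair (cdiv S) (cdiv S)"
      using pair_nonneg[of "\<lambda>T. cdiv C T + 1 * cdiv S T"] unfolding cD pair_square by simp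
    have "pair x x = pair (\<lambda>T. v T + 1 * cdiv C T) (\<lambda>T. v T + 1 * cdiv C T)"
      by (simp add: pair_def x_def algebra_simps)
    then have 3: "pair x x \<le> 2 * pair v v + 2 * pair (cdiv C) (cdiv C)"
      using pair_nonneg[of "\<lambda>T. v T + (-1) * cdiv C T"] unfolding pair_square by simp
    have arith: "e + d + y \<le> 4 * (a + b + c)"
      if "e \<le> 2 * a + 2 * s" "d \<le> 2 * b + 2 * q" "y \<le> 2 * c + 2 * b" "s + q \<le> c" "0 \<le> a" for a b c d e q s y :: real
      using that by argo
    show ?thesis unfolding coeff_norm2_def by (rule arith[OF 1 2 3 tU[unfolded t_def] nn(3)])
  qed
  show ?thesis using n1 n2 unfolding K_def by (rule that)
qed

lemma mass_zero:
  assumes "mass D D = 0" "T \<in> \<T>" "e \<in> edges T" shows "D e = 0"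
proof -
  have nn: "0 \<le> tarea S / 3 * (\<Sum>e\<in>edges S. D e \<bullet> D e)" if "S \<in> \<T>" for S
    using tarea_pos[OF that] by (intro mult_nonneg_nonneg sum_nonneg) auto
  have "(\<Sum>S\<in>\<T>. tarea S / 3 * (\<Sum>e\<in>edges S. D e \<bullet> D e)) = 0" using assms(1) by (simp only: mass_def)
  then have "\<forall>S\<in>\<T>. tarea S / 3 * (\<Sum>e\<in>edges S. D e \<bullet> D e) = 0" by (rule iffD1[OF sum_nonneg_eq_0_iff[OF finite_mesh], rotated]) (rule nn)
  then have "tarea T / 3 * (\<Sum>e\<in>edges T. D e \<bullet> D e) = 0" using assms(2) by (rule bspec)
  then have "(\<Sum>e\<in>edges T. D e \<bullet> D e) = 0" using tarea_pos[OF assms(2)] by simp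
  then have "D e \<bullet> D e = 0"
    using sum_nonneg_eq_0_iff[OF finite_edges[OF simplices[OF assms(2)]], of "\<lambda>e. D e \<bullet> D e"] assms(3) by simp
  then show ?thesis by simp
qed

text \<open>
  Shows that a pair on which the form is nonzero is not almost everywhere zero and has a positive norm.
\<close>

lemma coeff_form_null:
  assumes "mass D D = 0" "pair w w = 0" shows "coeff_form C v D w = 0"
proof -
  note D = mass_zero[OF assms(1)] and w = pair_zero[OF assms(2)]
  have g: "cr_grad D T h = 0" if "T \<in> \<T>" for T h using D[OF that] by (simp add: cr_grad_def)
  have "mass C D = 0" using D by (simp add: mass_def)
  moreover have "cjump D e = 0" for e using g by (simp add: cjump_def)
  then have "stab C D = 0" by (simp add: stab_def)
  moreover have "cdiv D T = 0" if "T \<in> \<T>" for T using D[OF that] by (simp add: cdiv_def)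
  then have "pair v (cdiv D) = 0" by (simp add: pair_def)
  moreover have "pair w (cdiv C) = 0" using w by (simp add: pair_def)
  ultimately show ?thesis by (simp add: coeff_form_def energy_def)
qed

lemma B_s_coeff:
  assumes "cr_rep \<sigma> C" "const_rep u v" "cr_rep \<tau> D" "const_rep z w"
  shows "B_s \<Omega> \<T> (\<sigma>, u) (\<tau>, z) = coeff_form C v D w"
  using assms by (simp add: B_s_def coeff_form_def energy_def a_s_cr b_form_cr)

lemma nc_norm_coeff:
  assumes "cr_rep \<sigma> C" "const_rep u v"
  shows "nc_norm \<Omega> \<T> (\<sigma>, u) = sqrt (coeff_norm2 C v)"
  using assms by (simp add: nc_norm_cr coeff_norm2_def energy_def)

lemma ae_zero_coeff:
  assumes "cr_rep \<tau> D" "const_rep z w" "ae_zero \<Omega> (\<tau>, z)"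
  shows "mass D D = 0" "pair w w = 0"
proof -
  have ae: "AE x in lebesgue_on \<Omega>. \<tau> x \<bullet> \<tau> x = 0" "AE x in lebesgue_on \<Omega>. z x * z x = 0"
    using assms(3) unfolding ae_zero_def by auto
  show "mass D D = 0"
    using integral_eq_zero_AE[OF ae(1)] by (simp only: integral_product_cr[OF assms(1,1)])
  show "pair w w = 0"
    using integral_eq_zero_AE[OF ae(2)] by (simp only: integral_product_const[OF assms(2,2)])
qed

text \<open>
  If the norm of \<open>(\<sigma>, u)\<close> is positive, the pair of the previous estimate has a positive value and is
  admissible. If it is zero, the supremum must still be nonnegative: the pair \<open>(0, 1)\<close> has value zero.
\<close>

lemma inf_sup:
  assumes r: "0 \<le> r" and sq: "\<And>T. T \<in> \<T> \<Longrightarrow> T \<subseteq> plane_square r" and ne: "\<Omega> \<noteq> {}"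
    and \<sigma>: "\<sigma> \<in> Sigma_h \<Omega> \<T>" and u: "u \<in> V_h \<T>"
  shows "ereal (1 / (8 * (300 * (r + 1)\<^sup>2 + 1)) * nc_norm \<Omega> \<T> (\<sigma>, u)) \<le>
    (SUP (\<tau>, v)\<in>{(\<tau>, v). (\<tau>, v) \<in> Sigma_h \<Omega> \<T> \<times> V_h \<T> \<and> \<not> ae_zero \<Omega> (\<tau>, v)}.
       ereal (B_s \<Omega> \<T> (\<sigma>, u) (\<tau>, v) / nc_norm \<Omega> \<T> (\<tau>, v)))"
proof -
  define M where "M = 4 * (300 * (r + 1)\<^sup>2 + 1)"
  have M: "0 < M" by (simp add: M_def add_nonneg_pos)
  obtain C where C: "cr_rep \<sigma> C" using Sigma_h_cr_rep[OF \<sigma>] .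
  obtain v where v: "const_rep u v" using V_h_const_rep[OF u] .
  have upper: ?thesis
    if nz: "\<not> (mass D D = 0 \<and> pair w w = 0)"
      and le: "1 / (2 * M) * sqrt (coeff_norm2 C v) \<le> coeff_form C v D w / sqrt (coeff_norm2 D w)" for D w
  proof (rule SUP_upper2[of "(cr_fun D, mesh_fun (\<lambda>T x. w T))"])
    note D = cr_rep_cr_fun[of D] and w = mesh_fun_V_h(2)[of w]
    show "(cr_fun D, mesh_fun (\<lambda>T x. w T)) \<in> {(\<tau>, v). (\<tau>, v) \<in> Sigma_h \<Omega> \<T> \<times> V_h \<T> \<and> \<not> ae_zero \<Omega> (\<tau>, v)}"
      using cr_fun_Sigma_h mesh_fun_V_h(1) ae_zero_coeff[OF D w] nz by auto
    show "ereal (1 / (8 * (300 * (r + 1)\<^sup>2 + 1)) * nc_norm \<Omega> \<T> (\<sigma>, u)) \<le>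
      (case (cr_fun D, mesh_fun (\<lambda>T x. w T)) of (\<tau>, v) \<Rightarrow> ereal (B_s \<Omega> \<T> (\<sigma>, u) (\<tau>, v) / nc_norm \<Omega> \<T> (\<tau>, v)))"
      using le by (simp add: B_s_coeff[OF C v D w] nc_norm_coeff[OF C v] nc_norm_coeff[OF D w] M_def)
  qed
  obtain D w where D: "coeff_norm2 C v \<le> M * coeff_form C v D w" "coeff_norm2 D w \<le> 4 * coeff_norm2 C v"
    using coeff_inf_sup[OF r sq, of C v] unfolding M_def by blast
  have nn: "0 \<le> mass D D" "0 \<le> pair w w" "0 \<le> stab D D" "0 \<le> pair (cdiv D) (cdiv D)" "0 \<le> coeff_norm2 C v"
    unfolding coeff_norm2_def using energy_nonneg pair_nonneg mass_nonneg stab_nonneg by (auto intro!: add_nonneg_nonneg)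
  show ?thesis
  proof (cases "coeff_norm2 C v = 0")
    case False
    let ?B = "coeff_form C v D w" and ?n = "sqrt (coeff_norm2 C v)" and ?m = "sqrt (coeff_norm2 D w)"
    have "0 < M * ?B" using False nn D(1) by linarith
    then have B: "0 < ?B" using M by (simp add: zero_less_mult_iff)
    then have nz: "\<not> (mass D D = 0 \<and> pair w w = 0)" using coeff_form_null by fastforce
    then have "0 < mass D D + pair w w" using nn by linarith
    then have m: "0 < ?m" using nn by (simp add: coeff_norm2_def energy_def)
    have "?m \<le> 2 * ?n" using real_sqrt_le_mono[OF D(2)] by (simp add: real_sqrt_mult)
    then have "?n * ?m \<le> ?n * (2 * ?n)" using nn by (intro mult_left_mono) auto
    also have "\<dots> = 2 * coeff_norm2 C v" using nn by simp
    also have "\<dots> \<le> 2 * (M * ?B)" using D(1) by simp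
    finally have "1 / (2 * M) * ?n \<le> ?B / ?m" using m M by (simp add: field_simps)
    then show ?thesis by (rule upper[OF nz])
  next
    case True
    have "pair (cdiv C) (cdiv C) = 0"
      using True energy_nonneg[of C] pair_nonneg[of v] pair_nonneg[of "cdiv C"] unfolding coeff_norm2_def by linarith
    then have c0: "cdiv C T = 0" if "T \<in> \<T>" for T using pair_zero that by blast
    have "closure \<Omega> \<noteq> {}" using ne closure_subset[of \<Omega>] by blast
    then have "\<T> \<noteq> {}" by (metis covers Union_empty)
    then obtain T where T: "T \<in> \<T>" by blast
    let ?D = "\<lambda>_::(real^2) set. 0 :: real^2" and ?w = "\<lambda>_::(real^2) set. 1 :: real"
    have nz: "\<not> (mass ?D ?D = 0 \<and> pair ?w ?w = 0)" using pair_zero[OF _ T, of ?w] by auto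
    have "mass C ?D = 0" "stab C ?D = 0" "cdiv ?D T' = 0" for T'
      by (simp_all add: mass_def stab_def cjump_def cr_grad_def cdiv_def)
    then have "coeff_form C v ?D ?w = 0"
      using c0 by (simp add: coeff_form_def energy_def pair_def)
    then show ?thesis using upper[OF nz] True by simp
  qed
qed

end

theorem theorem3p1:
  fixes \<Omega> :: "(real^2) set"
    and H :: "real set"
    and \<T> :: "real \<Rightarrow> (real^2) set set"
  assumes "polygonal_domain \<Omega>"
    and "H \<subseteq> {0<..}"
    and "\<And>h. h \<in> H \<Longrightarrow> conforming_triangulation \<Omega> (\<T> h) \<and> mesh_size (\<T> h) = h"
  shows "\<exists>\<alpha>>0. \<forall>h\<in>H. \<forall>(\<sigma>, u)\<in>Sigma_h \<Omega> (\<T> h) \<times> V_h (\<T> h).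
    ereal (\<alpha> * nc_norm \<Omega> (\<T> h) (\<sigma>, u)) \<le>
    (SUP (\<tau>, v)\<in>{(\<tau>, v). (\<tau>, v) \<in> Sigma_h \<Omega> (\<T> h) \<times> V_h (\<T> h) \<and> \<not> ae_zero \<Omega> (\<tau>, v)}.
       ereal (B_s \<Omega> (\<T> h) (\<sigma>, u) (\<tau>, v) / nc_norm \<Omega> (\<T> h) (\<tau>, v)))"
proof -
  have \<Omega>: "open \<Omega>" "\<Omega> \<noteq> {}" "bounded \<Omega>" "interior (closure \<Omega>) = \<Omega>"
    using assms(1) by (auto simp: polygonal_domain_def polygonal_boundary_def)
  obtain r where r: "0 < r" "\<And>x. x \<in> closure \<Omega> \<Longrightarrow> norm x \<le> r"
    using bounded_closure[OF \<Omega>(3)] by (auto simp: bounded_pos)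
  show ?thesis
  proof (intro exI[of _ "1 / (8 * (300 * (r + 1)\<^sup>2 + 1))"] conjI ballI, goal_cases)
    case 1
    show ?case by (simp add: add_nonneg_pos)
  next
    case (2 h x)
    have c: "conforming_triangulation \<Omega> (\<T> h)" using assms(3) 2(1) by blast
    interpret domain_mesh "\<T> h" \<Omega>
      using c \<Omega> by unfold_locales (auto simp: conforming_triangulation_def)
    have "T \<subseteq> plane_square r" if "T \<in> \<T> h" for T
    proof
      fix x assume "x \<in> T"
      then have "norm x \<le> r" using r(2) covers that by blast
      then show "x \<in> plane_square r" using component_le_norm_cart[of x] order_trans by blast
    qed
    then show ?case
      using inf_sup[of r] r(1) \<Omega>(2) 2(2) by (auto simp: less_imp_le split: prod.splits)
  qed
qed

end
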